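(* Let $\Gamma$ be an ornamented tree consisting of a compact metric tree $\Gamma_{\rm T}$, with Dirichlet conditions at its exterior vertices, and pendants $P_1,\dots,P_m$, each containing at least one Dirichlet vertex. Let $\{\lambda_n\}$ denote the spectrum of $-\Delta$ on $\Gamma$, and let $\lambda_1(P_j)$ be the first eigenvalue of $P_j$ defined by assigning standard vertex conditions at the attachment point $q_j$. Suppose that $$\lambda_1\le\lambda_1(P_j)\quad\text{for each } j .$$ Then $$\frac{\lambda_2}{\lambda_1}\le5 .$$ In particular, this inequality holds if $$|P_j|\le\tfrac12\,\ell_{\rm max}(\Gamma_{\rm T})\quad\text{for each } j,$$ where $|P_j|$ is the total length of $P_j$ and $\ell_{\rm max}(\Gamma_{\rm T})$ is the maximum edge length of $\Gamma_{\rm T}$.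
   Context: A compact metric graph consists of finitely many edges, each identified with a compact interval of positive length, glued at a finite vertex set $\mathcal{V}=\mathcal{V}_{\rm N}\cup\mathcal{V}_0$ (disjoint union of standard and Dirichlet vertices); Dirichlet vertices have degree $1$. On such a connected graph $G$, $-\Delta$ is the self-adjoint operator on $L^2(G)$ associated to the quadratic form $\|u'\|^2$ with domain $\{u\in H^1(G):u=0\text{ on }\mathcal{V}_0\}$, where $H^1(G)$ consists of continuous functions that are $H^1$ on each edge. This gives Dirichlet conditions on $\mathcal{V}_0$ and standard (Kirchhoff--Neumann) conditions on $\mathcal{V}_{\rm N}$: continuity, and vanishing of the sum of outgoing derivatives. Eigenvalues are listed in ascending order with multiplicity. Ornamented tree: $\Gamma$ is constructed from a compact metric tree $\Gamma_{\rm T}$ (connected, no cycles) by attaching finitely many connected compact metric graphs $P_1,\dots,P_m$ (pendants): for each $j$ one non-Dirichlet point of $P_j$ is identified with an internal vertex $q_j$ of $\Gamma_{\rm T}$, where $q_j$ may be an artificial (degree $2$) vertex of $\Gamma_{\rm T}$. In $\Gamma$, the attachment vertices $q_j$ are standard vertices. The exterior vertices of $\Gamma_{\rm T}$ (degree one in $\Gamma_{\rm T}$) are Dirichlet, all other vertices of $\Gamma_{\rm T}$ are standard, and the vertex set of each pendant is a disjoint union of standard vertices (carrying Kirchhoff--Neumann conditions: continuity, and vanishing of the sum of outgoing derivatives) and Dirichlet vertices (of degree $1$, where functions are required to vanish). The points $q_j$ (including artificial ones) are counted as vertices of $\Gamma_{\rm T}$, so that edges of $\Gamma_{\rm T}$,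 in the definition of $\ell_{\rm max}(\Gamma_{\rm T})$, are edges of $\Gamma$ lying in $\Gamma_{\rm T}$. For $\lambda_1(P_j)$, the graph $P_j$ is considered on its own, with its own Dirichlet vertices and with the standard condition at $q_j$ involving only the edges of $P_j$. *)

theory Defs
  imports
    "HOL-Analysis.Analysis"
    "HOL-Library.Function_Algebras"
    "Graph_Theory.Digraph_Component"
begin

section \<open>Compact metric graphs\<close>

text \<open>
  The combinatorial skeleton is a directed multigraph (loops and parallel edges allowed). The
  direction of an edge only fixes its coordinate: the edge \<open>e\<close> is the interval from \<open>0\<close> (at its
  tail) to \<open>len e\<close> (at its head). The vertices outside \<open>dirichlet\<close> are the standard ones.
\<close>

record ('v, 'e) metric_graph =
  skel :: "('v, 'e) pre_digraph"
  len :: "'e \<Rightarrow> real"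
  dirichlet :: "'v set"

abbreviation Verts :: "('v, 'e) metric_graph \<Rightarrow> 'v set" where
  "Verts G \<equiv> verts (skel G)"

abbreviation Edges :: "('v, 'e) metric_graph \<Rightarrow> 'e set" where
  "Edges G \<equiv> arcs (skel G)"

text \<open>A loop contributes two to the degree.\<close>

definition degree :: "('v, 'e) metric_graph \<Rightarrow> 'v \<Rightarrow> nat" where
  "degree G v = in_degree (skel G) v + out_degree (skel G) v"

definition compact_metric_graph :: "('v, 'e) metric_graph \<Rightarrow> bool" where
  "compact_metric_graph G \<longleftrightarrow>
     fin_digraph (skel G) \<and> Edges G \<noteq> {} \<and> (\<forall>e\<in>Edges G. 0 < len G e) \<and>
     dirichlet G \<subseteq> Verts G \<and> (\<forall>v\<in>dirichlet G. degree G v = 1)"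

text \<open>The library's connectedness of a digraph disregards the directions of the edges.\<close>

definition connected_metric_graph :: "('v, 'e) metric_graph \<Rightarrow> bool" where
  "connected_metric_graph G \<longleftrightarrow>
     compact_metric_graph G \<and> Digraph_Component.connected (skel G)"

definition total_length :: "('v, 'e) metric_graph \<Rightarrow> real" where
  "total_length G = (\<Sum>e\<in>Edges G. len G e)"

definition max_edge_length :: "('v, 'e) metric_graph \<Rightarrow> real" where
  "max_edge_length G = Max (len G ` Edges G)"


section \<open>The Laplacian and its eigenvalues\<close>

definition L2_interval :: "real \<Rightarrow> (real \<Rightarrow> real) \<Rightarrow> bool" where
  "L2_interval l f \<longleftrightarrow>
     f \<in> borel_measurable (lebesgue_on {0..l}) \<and> integrable (lebesgue_on {0..l}) (\<lambda>x. (f x)\<^sup>2)"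

text \<open>
  \<open>f\<close> is the continuous representative of an element of \<open>H\<^sup>1(0, l)\<close> with weak derivative \<open>g\<close>.
\<close>

definition has_weak_deriv :: "real \<Rightarrow> (real \<Rightarrow> real) \<Rightarrow> (real \<Rightarrow> real) \<Rightarrow> bool" where
  "has_weak_deriv l f g \<longleftrightarrow>
     L2_interval l g \<and> (\<forall>x\<in>{0..l}. f x = f 0 + integral\<^sup>L (lebesgue_on {0..x}) g)"

text \<open>The weak derivative is unique up to null sets, so integrals do not depend on the choice.\<close>

definition weak_deriv :: "real \<Rightarrow> (real \<Rightarrow> real) \<Rightarrow> real \<Rightarrow> real" where
  "weak_deriv l f = (SOME g. has_weak_deriv l f g)"

text \<open>
  A function on \<open>G\<close> is a family \<open>u e x\<close> with \<open>e\<close> an edge and \<open>x\<close> in \<open>[0, len e]\<close>. In the form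
  domain it is made zero elsewhere, so that equality in HOL is equality of functions on \<open>G\<close>. The
  function \<open>\<phi>\<close> gives the common values at the vertices, which expresses continuity on \<open>G\<close>.
\<close>

definition form_domain :: "('v, 'e) metric_graph \<Rightarrow> ('e \<Rightarrow> real \<Rightarrow> real) set" where
  "form_domain G = {u.
     (\<forall>e x. \<not> (e \<in> Edges G \<and> 0 \<le> x \<and> x \<le> len G e) \<longrightarrow> u e x = 0) \<and>
     (\<forall>e\<in>Edges G. \<exists>g. has_weak_deriv (len G e) (u e) g) \<and>
     (\<exists>\<phi>. (\<forall>e\<in>Edges G. u e 0 = \<phi> (tail (skel G) e) \<and> u e (len G e) = \<phi> (head (skel G) e)) \<and>
          (\<forall>v\<in>dirichlet G. \<phi> v = 0))}"

definition dirichlet_form ::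
  "('v, 'e) metric_graph \<Rightarrow> ('e \<Rightarrow> real \<Rightarrow> real) \<Rightarrow> ('e \<Rightarrow> real \<Rightarrow> real) \<Rightarrow> real" where
  "dirichlet_form G u v = (\<Sum>e\<in>Edges G. integral\<^sup>L (lebesgue_on {0..len G e})
     (\<lambda>x. weak_deriv (len G e) (u e) x * weak_deriv (len G e) (v e) x))"

definition L2_function :: "('v, 'e) metric_graph \<Rightarrow> ('e \<Rightarrow> real \<Rightarrow> real) \<Rightarrow> bool" where
  "L2_function G f \<longleftrightarrow> (\<forall>e\<in>Edges G. L2_interval (len G e) (f e))"

definition L2_inner ::
  "('v, 'e) metric_graph \<Rightarrow> ('e \<Rightarrow> real \<Rightarrow> real) \<Rightarrow> ('e \<Rightarrow> real \<Rightarrow> real) \<Rightarrow> real" where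
  "L2_inner G f h = (\<Sum>e\<in>Edges G. integral\<^sup>L (lebesgue_on {0..len G e}) (\<lambda>x. f e x * h e x))"

text \<open>
  The graph of the operator \<open>-\<Delta>\<close> associated with the form: \<open>u\<close> is in its domain and \<open>-\<Delta> u = f\<close>.
\<close>

definition minus_Laplacian ::
  "('v, 'e) metric_graph \<Rightarrow> ('e \<Rightarrow> real \<Rightarrow> real) \<Rightarrow> ('e \<Rightarrow> real \<Rightarrow> real) \<Rightarrow> bool" where
  "minus_Laplacian G u f \<longleftrightarrow>
     u \<in> form_domain G \<and> L2_function G f \<and>
     (\<forall>v\<in>form_domain G. dirichlet_form G u v = L2_inner G f v)"

definition scale_fun :: "real \<Rightarrow> ('e \<Rightarrow> real \<Rightarrow> real) \<Rightarrow> 'e \<Rightarrow> real \<Rightarrow> real" where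
  "scale_fun c u = (\<lambda>e x. c * u e x)"

global_interpretation graph_fun: vector_space scale_fun
  by unfold_locales (auto simp: scale_fun_def fun_eq_iff algebra_simps)

definition eigenspace :: "('v, 'e) metric_graph \<Rightarrow> real \<Rightarrow> ('e \<Rightarrow> real \<Rightarrow> real) set" where
  "eigenspace G \<mu> = {u. minus_Laplacian G u (scale_fun \<mu> u)}"

definition multiplicity :: "('v, 'e) metric_graph \<Rightarrow> real \<Rightarrow> nat" where
  "multiplicity G \<mu> = graph_fun.dim (eigenspace G \<mu>)"

text \<open>
  The \<open>n\<close>-th eigenvalue (\<open>n \<ge> 1\<close>) in ascending order with multiplicity: the least \<open>\<mu>\<close> such that
  there are at least \<open>n\<close> eigenvalues in \<open>(-\<infinity>, \<mu>]\<close>, counted with multiplicity. Numbers that are not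
  eigenvalues have multiplicity zero and do not contribute to the sum.
\<close>

definition eigenvalue :: "('v, 'e) metric_graph \<Rightarrow> nat \<Rightarrow> real" where
  "eigenvalue G n =
     Inf {\<mu>. \<exists>A. finite A \<and> A \<subseteq> {..\<mu>} \<and> n \<le> (\<Sum>\<nu>\<in>A. multiplicity G \<nu>)}"


section \<open>Ornamented trees\<close>

definition joins :: "('v, 'e) metric_graph \<Rightarrow> 'e \<Rightarrow> 'v \<Rightarrow> 'v \<Rightarrow> bool" where
  "joins G e v w \<longleftrightarrow> e \<in> Edges G \<and>
     (tail (skel G) e = v \<and> head (skel G) e = w \<or> tail (skel G) e = w \<and> head (skel G) e = v)"

text \<open>Loops and pairs of parallel edges are cycles (of length one and two).\<close>

definition is_cycle :: "('v, 'e) metric_graph \<Rightarrow> 'v list \<Rightarrow> 'e list \<Rightarrow> bool" where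
  "is_cycle G vs es \<longleftrightarrow>
     es \<noteq> [] \<and> length vs = length es \<and> distinct vs \<and> distinct es \<and>
     (\<forall>i<length es. joins G (es ! i) (vs ! i) (vs ! (Suc i mod length es)))"

definition metric_tree :: "('v, 'e) metric_graph \<Rightarrow> bool" where
  "metric_tree T \<longleftrightarrow> connected_metric_graph T \<and> \<not> (\<exists>vs es. is_cycle T vs es)"

definition exterior_vertices :: "('v, 'e) metric_graph \<Rightarrow> 'v set" where
  "exterior_vertices T = {v \<in> Verts T. degree T v = 1}"

text \<open>
  The data of an ornamented tree: the pendants \<open>P 1, \<dots>, P m\<close>, where the point \<open>r j\<close> of \<open>P j\<close> is to be
  identified with the internal vertex \<open>q j\<close> of the tree \<open>T\<close>. Artificial vertices of degree two are
  allowed everywhere, so \<open>q j\<close> and \<open>r j\<close> may be arbitrary points in the interior of edges. The \<open>q j\<close>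
  need not be distinct.
\<close>

definition ornamented_tree ::
  "('v, 'e) metric_graph \<Rightarrow> nat \<Rightarrow> (nat \<Rightarrow> ('w, 'f) metric_graph) \<Rightarrow> (nat \<Rightarrow> 'w) \<Rightarrow> (nat \<Rightarrow> 'v) \<Rightarrow> bool"
where
  "ornamented_tree T m P r q \<longleftrightarrow>
     metric_tree T \<and> dirichlet T = exterior_vertices T \<and>
     (\<forall>j\<in>{1..m}. connected_metric_graph (P j) \<and> r j \<in> Verts (P j) - dirichlet (P j) \<and>
                 q j \<in> Verts T - exterior_vertices T)"

text \<open>
  The glued graph, built on the disjoint union of the vertices of \<open>T\<close> and of all \<open>P j\<close>, with
  \<open>r j\<close> replaced by \<open>q j\<close>.
\<close>

definition pendant_vertex ::
  "(nat \<Rightarrow> 'w) \<Rightarrow> (nat \<Rightarrow> 'v) \<Rightarrow> nat \<Rightarrow> 'w \<Rightarrow> 'v + nat \<times> 'w" where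
  "pendant_vertex r q j w = (if w = r j then Inl (q j) else Inr (j, w))"

definition attach_pendants ::
  "('v, 'e) metric_graph \<Rightarrow> nat \<Rightarrow> (nat \<Rightarrow> ('w, 'f) metric_graph) \<Rightarrow> (nat \<Rightarrow> 'w) \<Rightarrow> (nat \<Rightarrow> 'v) \<Rightarrow>
   ('v + nat \<times> 'w, 'e + nat \<times> 'f) metric_graph"
where
  "attach_pendants T m P r q =
     \<lparr> skel =
         \<lparr> verts = Inl ` Verts T \<union> (\<Union>j\<in>{1..m}. pendant_vertex r q j ` Verts (P j)),
           arcs = Inl ` Edges T \<union> (\<Union>j\<in>{1..m}. (\<lambda>f. Inr (j, f)) ` Edges (P j)),
           tail = case_sum (\<lambda>e. Inl (tail (skel T) e))
                    (\<lambda>(j, f). pendant_vertex r q j (tail (skel (P j)) f)),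
           head = case_sum (\<lambda>e. Inl (head (skel T) e))
                    (\<lambda>(j, f). pendant_vertex r q j (head (skel (P j)) f)) \<rparr>,
       len = case_sum (len T) (\<lambda>(j, f). len (P j) f),
       dirichlet = Inl ` dirichlet T \<union> (\<Union>j\<in>{1..m}. pendant_vertex r q j ` dirichlet (P j)) \<rparr>"

end

theory Submission
  imports Defs "HOL-Complex_Analysis.Great_Picard"
begin

text \<open>
  Let \<open>u\<close> be a normalised ground state. If \<open>g\<close> is Lipschitz on \<open>\<Gamma>\<close> and \<open>g u\<close> is orthogonal to
  \<open>u\<close>, then \<open>(\<lambda>\<^sub>2 - \<lambda>\<^sub>1) \<parallel>g u\<parallel>\<^sup>2 \<le> \<parallel>g' u\<parallel>\<^sup>2\<close>. Take \<open>g\<close> affine with slope \<open>\<alpha>\<close> on the edges of the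
  tree, constant on the pendants, and such that the outgoing slopes sum to zero at every internal
  vertex of the tree. Integration by parts then gives
  \<open>\<parallel>g' u\<parallel>\<^sup>2 = - 2 \<integral> g g' u u'\<close>, and therefore \<open>(\<lambda>\<^sub>2 - \<lambda>\<^sub>1) \<parallel>g' u\<parallel>\<^sup>2 \<le> 4 \<parallel>g' u'\<parallel>\<^sup>2\<close>. On a tree there
  are complex slopes of modulus one with this property; adding the inequalities for their real and
  imaginary parts yields \<open>(\<lambda>\<^sub>2 - \<lambda>\<^sub>1) \<integral>\<^sub>T u\<^sup>2 \<le> 4 \<integral>\<^sub>T u'\<^sup>2\<close>. Since \<open>\<lambda>\<^sub>1 \<le> \<lambda>\<^sub>1(P\<^sub>j)\<close>, the pendants
  have at least their share of the energy, so that \<open>\<integral>\<^sub>T u'\<^sup>2 \<le> \<lambda>\<^sub>1 \<integral>\<^sub>T u\<^sup>2\<close>, and \<open>u\<close> cannot vanish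
  on the tree because a nonnegative ground state has no zeros off the Dirichlet vertices.

  For short pendants the hypothesis holds by comparing \<open>\<lambda>\<^sub>1 \<le> (\<pi> / \<ell>\<^sub>m\<^sub>a\<^sub>x)\<^sup>2\<close> with Nicaise's inequality
  \<open>\<lambda>\<^sub>1(P\<^sub>j) \<ge> (\<pi> / (2 |P\<^sub>j|))\<^sup>2\<close>.
\<close>

section \<open>Weak derivatives on an interval\<close>

text \<open>Real slopes 1 and -1 cannot balance at a vertex of odd degree, whereas two or more
  complex numbers of modulus one can always be chosen with sum zero; hence complex slopes.
  Acyclicity does the rest: slopes prescribed on the edges of a tree always integrate to a function.
  At exterior vertices no balance is required, because \<open>u\<close> vanishes there. The constant
  is 5 = 1 + 4, where 4 is the square of the factor 2 in the derivative of \<open>u^2\<close>.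

  On the spectral side, \<open>eigenvalue\<close> is an infimum over finite families counted by
  \<open>multiplicity\<close>, and the dimension of an infinite-dimensional space is 0 in HOL.
  Eigenvalues therefore have to be produced: minimisers come from the direct method, and eigenspaces
  are shown to be finite-dimensional so that each eigenfunction found really counts. For the gap
  only one half of the min-max principle enters, namely that \<open>eigenvalue G 2\<close> is at
  most the minimum of the Rayleigh quotient on the orthogonal complement of a ground state.\<close>

lemma L2_interval_integrable:
  assumes "L2_interval l g"
  shows "integrable (lebesgue_on {0..l}) g"
proof (rule Bochner_Integration.integrable_bound)
  show "integrable (lebesgue_on {0..l}) (\<lambda>x. 1 + (g x)\<^sup>2)"
    using assms by (auto simp: L2_interval_def intro!: Bochner_Integration.integrable_add continuous_imp_integrable_real)
  have "\<bar>t\<bar> \<le> 1 + t\<^sup>2" for t :: real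
    using zero_le_power2[of "\<bar>t\<bar> - 1"] by (simp add: power2_diff)
  then show "AE x in lebesgue_on {0..l}. norm (g x) \<le> norm (1 + (g x)\<^sup>2)"
    by (auto simp: abs_of_nonneg)
qed (use assms in \<open>simp add: L2_interval_def\<close>)

lemma L2_interval_mult_integrable:
  assumes "L2_interval l f" "L2_interval l g"
  shows "integrable (lebesgue_on {0..l}) (\<lambda>x. f x * g x)"
proof (rule Bochner_Integration.integrable_bound)
  show "integrable (lebesgue_on {0..l}) (\<lambda>x. (f x)\<^sup>2 + (g x)\<^sup>2)"
    using assms by (auto simp: L2_interval_def)
  have "\<bar>s * t\<bar> \<le> s\<^sup>2 + t\<^sup>2" for s t :: real
  proof -
    have "0 \<le> \<bar>s\<bar> * \<bar>t\<bar>" by simp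
    then show ?thesis
      using zero_le_power2[of "\<bar>s\<bar> - \<bar>t\<bar>"] unfolding power2_diff abs_mult power2_abs by linarith
  qed
  then show "AE x in lebesgue_on {0..l}. norm (f x * g x) \<le> norm ((f x)\<^sup>2 + (g x)\<^sup>2)"
    by (auto simp: abs_of_nonneg)
qed (use assms in \<open>auto simp: L2_interval_def\<close>)

lemma L2_interval_add:
  assumes "L2_interval l f" "L2_interval l g"
  shows "L2_interval l (\<lambda>x. f x + g x)"
proof -
  have "integrable (lebesgue_on {0..l}) (\<lambda>x. (f x)\<^sup>2 + (g x)\<^sup>2 + 2 * (f x * g x))"
    using assms L2_interval_mult_integrable[OF assms] by (auto simp: L2_interval_def)
  then show ?thesis
    using assms by (auto simp: L2_interval_def power2_sum algebra_simps)
qed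

lemma L2_interval_cmult:
  assumes "L2_interval l f"
  shows "L2_interval l (\<lambda>x. c * f x)"
  using assms by (auto simp: L2_interval_def power_mult_distrib)

lemma L2_interval_diff:
  assumes "L2_interval l f" "L2_interval l g"
  shows "L2_interval l (\<lambda>x. f x - g x)"
  using L2_interval_add[OF assms(1) L2_interval_cmult[OF assms(2), of "-1"]] by simp

lemma L2_interval_bounded_mult:
  assumes f: "continuous_on {0..l} f" and g: "L2_interval l g"
  shows "L2_interval l (\<lambda>x. f x * g x)"
proof -
  have fm: "f \<in> borel_measurable (lebesgue_on {0..l})"
    using f by (simp add: continuous_imp_measurable_on_sets_lebesgue)
  obtain B where B: "\<And>x. x \<in> {0..l} \<Longrightarrow> \<bar>f x\<bar> \<le> B"
    using compact_imp_bounded[OF compact_continuous_image[OF f]] unfolding bounded_iff by fastforce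
  have "integrable (lebesgue_on {0..l}) (\<lambda>x. (f x * g x)\<^sup>2)"
  proof (rule Bochner_Integration.integrable_bound)
    show "integrable (lebesgue_on {0..l}) (\<lambda>x. B\<^sup>2 * (g x)\<^sup>2)"
      using g by (auto simp: L2_interval_def)
    have "(f x * g x)\<^sup>2 \<le> B\<^sup>2 * (g x)\<^sup>2" if "x \<in> {0..l}" for x
      unfolding power_mult_distrib using B[OF that]
      by (intro mult_right_mono) (auto intro: power2_le_iff_abs_le[THEN iffD2, of B] simp: abs_le_square_iff[symmetric])
    then show "AE x in lebesgue_on {0..l}. norm ((f x * g x)\<^sup>2) \<le> norm (B\<^sup>2 * (g x)\<^sup>2)"
      by (auto simp: intro!: AE_I2)
  qed (use fm g in \<open>auto simp: L2_interval_def\<close>)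
  then show ?thesis
    using fm g by (auto simp: L2_interval_def)
qed

lemma L2_interval_continuous:
  assumes "continuous_on {0..l} f"
  shows "L2_interval l f"
proof -
  have "L2_interval l (\<lambda>x. 1)"
    by (auto simp: L2_interval_def intro!: continuous_imp_integrable_real)
  from L2_interval_bounded_mult[OF assms this] show ?thesis by simp
qed

lemma L2_interval_integrable_on:
  assumes "L2_interval l g" "0 \<le> a" "b \<le> l"
  shows "integrable (lebesgue_on {a..b}) g" "g integrable_on {a..b}"
    "integral\<^sup>L (lebesgue_on {a..b}) g = integral {a..b} g"
proof -
  show *: "integrable (lebesgue_on {a..b}) g"
    by (rule integrable_subinterval[OF L2_interval_integrable[OF assms(1)]]) (use assms in auto)
  then show "g integrable_on {a..b}" by (auto intro: integrable_on_lebesgue_on)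
  show "integral\<^sup>L (lebesgue_on {a..b}) g = integral {a..b} g"
    using * by (auto intro: lebesgue_integral_eq_integral)
qed

lemma L2_interval_mult_integrable_on:
  assumes "L2_interval l f" "L2_interval l g" "0 \<le> a" "b \<le> l"
  shows "integrable (lebesgue_on {a..b}) (\<lambda>x. f x * g x)" "(\<lambda>x. f x * g x) integrable_on {a..b}"
    "integral\<^sup>L (lebesgue_on {a..b}) (\<lambda>x. f x * g x) = integral {a..b} (\<lambda>x. f x * g x)"
proof -
  show *: "integrable (lebesgue_on {a..b}) (\<lambda>x. f x * g x)"
    by (rule integrable_subinterval[OF L2_interval_mult_integrable[OF assms(1,2)]]) (use assms in auto)
  then show "(\<lambda>x. f x * g x) integrable_on {a..b}" by (auto intro: integrable_on_lebesgue_on)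
  show "integral\<^sup>L (lebesgue_on {a..b}) (\<lambda>x. f x * g x) = integral {a..b} (\<lambda>x. f x * g x)"
    using * by (auto intro: lebesgue_integral_eq_integral)
qed

lemma has_weak_deriv_L2: "has_weak_deriv l f g \<Longrightarrow> L2_interval l g"
  by (simp add: has_weak_deriv_def)

lemma has_weak_deriv_diff:
  assumes "has_weak_deriv l f g" "0 \<le> x" "x \<le> y" "y \<le> l"
  shows "f y - f x = integral {x..y} g"
proof -
  have L2: "L2_interval l g" using assms(1) by (simp add: has_weak_deriv_def)
  have z: "f z = f 0 + integral {0..z} g" if "z \<in> {0..l}" for z
  proof -
    have "f z = f 0 + integral\<^sup>L (lebesgue_on {0..z}) g"
      using assms(1) that unfolding has_weak_deriv_def by blast
    then show ?thesis using that L2_interval_integrable_on(3)[OF L2, of 0 z] by simp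
  qed
  have "integral {0..y} g = integral {0..x} g + integral {x..y} g"
    using Henstock_Kurzweil_Integration.integral_combine[of 0 x y g]
      L2_interval_integrable_on(2)[OF L2, of 0 y] assms by auto
  then show ?thesis using z[of x] z[of y] assms by auto
qed

lemma has_weak_derivI:
  assumes "L2_interval l g" "\<And>x. 0 \<le> x \<Longrightarrow> x \<le> l \<Longrightarrow> f x - f 0 = integral {0..x} g"
  shows "has_weak_deriv l f g"
  unfolding has_weak_deriv_def
proof (intro conjI ballI)
  fix x assume "x \<in> {0..l}"
  then show "f x = f 0 + integral\<^sup>L (lebesgue_on {0..x}) g"
    using assms(2)[of x] L2_interval_integrable_on(3)[OF assms(1), of 0 x] by auto
qed (rule assms(1))

section \<open>Cauchy-Schwarz and Hoelder estimates\<close>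

lemma integral_Cauchy_Schwarz:
  assumes "L2_interval l g" "0 \<le> x" "x \<le> y" "y \<le> l"
  shows "(integral {x..y} (\<lambda>t. \<bar>g t\<bar>))\<^sup>2 \<le> (y - x) * integral {x..y} (\<lambda>t. (g t)\<^sup>2)"
proof (cases "x = y")
  case False
  \<comment> \<open>\<open>c\<close> is the mean of \<open>\<bar>g\<bar>\<close>; expanding the
    integral of \<open>(\<bar>g\<bar> - c)^2\<close>, which is nonnegative, gives the claim.\<close>
  define c where "c = integral {x..y} (\<lambda>t. \<bar>g t\<bar>) / (y - x)"
  have L: "L2_interval l (\<lambda>t. \<bar>g t\<bar>)" using assms(1) by (auto simp: L2_interval_def)
  have i1: "(\<lambda>t. \<bar>g t\<bar>) integrable_on {x..y}"
    by (rule L2_interval_integrable_on[OF L]) (use assms in auto)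
  have i2: "(\<lambda>t. (g t)\<^sup>2) integrable_on {x..y}"
    unfolding power2_eq_square by (rule L2_interval_mult_integrable_on[OF assms(1,1)]) (use assms in auto)
  let ?I = "integral {x..y} (\<lambda>t. \<bar>g t\<bar>)" and ?J = "integral {x..y} (\<lambda>t. (g t)\<^sup>2)"
  have "((\<lambda>t. c\<^sup>2) has_integral (y - x) * c\<^sup>2) {x..y}"
    using has_integral_const_real[of "c\<^sup>2" x y] assms(3) by simp
  then have "((\<lambda>t. (g t)\<^sup>2 - 2 * c * \<bar>g t\<bar> + c\<^sup>2) has_integral (?J - 2 * c * ?I + (y - x) * c\<^sup>2)) {x..y}"
    by (intro has_integral_add has_integral_diff has_integral_mult_right integrable_integral i1 i2)
  moreover have "0 \<le> (g t)\<^sup>2 - 2 * c * \<bar>g t\<bar> + c\<^sup>2" for t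
    using zero_le_power2[of "\<bar>g t\<bar> - c"] by (simp add: power2_diff algebra_simps)
  ultimately have "0 \<le> ?J - 2 * c * ?I + (y - x) * c\<^sup>2"
    by (rule has_integral_nonneg) 
  also have "\<dots> = ?J - ?I\<^sup>2 / (y - x)"
  proof -
    have "c * (y - x) = ?I" using False by (simp add: c_def)
    moreover have "(y - x) * c\<^sup>2 = c * (c * (y - x))" by (simp add: power2_eq_square)
    ultimately have "(y - x) * c\<^sup>2 = c * ?I" by simp
    moreover have "?I\<^sup>2 / (y - x) = c * ?I" by (simp add: c_def power2_eq_square)
    ultimately show ?thesis by simp
  qed
  finally have "?I\<^sup>2 / (y - x) \<le> ?J" by simp
  then show ?thesis using False assms(3) pos_divide_le_eq[of "y - x" "?I\<^sup>2" ?J] by (simp add: mult.commute)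
qed auto

lemma has_weak_deriv_Hoelder:
  assumes "has_weak_deriv l f g" "0 \<le> x" "x \<le> y" "y \<le> l"
  shows "(f y - f x)\<^sup>2 \<le> (y - x) * integral {x..y} (\<lambda>t. (g t)\<^sup>2)"
    "\<bar>f y - f x\<bar> \<le> integral {x..y} (\<lambda>t. \<bar>g t\<bar>)"
proof -
  have L: "L2_interval l g" using assms(1) by (simp add: has_weak_deriv_def)
  then have L': "L2_interval l (\<lambda>t. \<bar>g t\<bar>)" by (auto simp: L2_interval_def)
  show *: "\<bar>f y - f x\<bar> \<le> integral {x..y} (\<lambda>t. \<bar>g t\<bar>)"
    using integral_norm_bound_integral[of g "{x..y}" "\<lambda>t. \<bar>g t\<bar>"]
      L2_interval_integrable_on(2)[OF L, of x y] L2_interval_integrable_on(2)[OF L', of x y] assms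
    by (simp add: has_weak_deriv_diff[OF assms])
  then have "(f y - f x)\<^sup>2 \<le> (integral {x..y} (\<lambda>t. \<bar>g t\<bar>))\<^sup>2"
    using power_mono[OF *, of 2] by simp
  also note integral_Cauchy_Schwarz[OF L assms(2-4)]
  finally show "(f y - f x)\<^sup>2 \<le> (y - x) * integral {x..y} (\<lambda>t. (g t)\<^sup>2)" .
qed

section \<open>Chain and product rules\<close>

text \<open>
  If the increments of \<open>D\<close> are bounded by \<open>(y - x) (G y - G x)\<close>, then splitting an interval into
  \<open>n\<close> equal parts bounds its increment by a multiple of \<open>1 / n\<close>.
\<close>

lemma const_on_interval:
  fixes D G :: "real \<Rightarrow> real"
  assumes D: "\<And>x y. 0 \<le> x \<Longrightarrow> x \<le> y \<Longrightarrow> y \<le> l \<Longrightarrow> \<bar>D y - D x\<bar> \<le> (y - x) * (G y - G x)"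
    and x: "0 \<le> x" "x \<le> l"
  shows "D x = D 0"
proof -
  have le: "\<bar>D x - D 0\<bar> \<le> x * (G x - G 0) / n" if n: "n > 0" for n :: nat
  proof -
    define p where "p i = x * real i / real n" for i
    have p: "0 \<le> p i" "p i \<le> p (Suc i)" "i < n \<Longrightarrow> p (Suc i) \<le> l" "p (Suc i) - p i = x / n" for i
    proof -
      show "0 \<le> p i" "p i \<le> p (Suc i)" using x n by (auto simp: p_def divide_simps intro!: mult_left_mono)
      show "p (Suc i) - p i = x / n"
        unfolding p_def by (simp add: diff_divide_distrib[symmetric] right_diff_distrib[symmetric])
      assume "i < n"
      then have "p (Suc i) \<le> x * real n / real n"
        unfolding p_def using x n by (intro divide_right_mono mult_left_mono) auto
      then show "p (Suc i) \<le> l" using n x by simp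
    qed
    have "\<bar>\<Sum>i<n. D (p (Suc i)) - D (p i)\<bar> \<le> (\<Sum>i<n. \<bar>D (p (Suc i)) - D (p i)\<bar>)"
      by (rule sum_abs)
    also have "\<dots> \<le> (\<Sum>i<n. x / n * (G (p (Suc i)) - G (p i)))"
    proof (rule sum_mono)
      fix i assume "i \<in> {..<n}"
      then show "\<bar>D (p (Suc i)) - D (p i)\<bar> \<le> x / n * (G (p (Suc i)) - G (p i))"
        using D[of "p i" "p (Suc i)"] p(1,2,3)[of i] unfolding p(4)[of i] by auto
    qed
    also have "\<dots> = x / n * (G (p n) - G (p 0))"
      by (simp only: sum_distrib_left[symmetric] sum_lessThan_telescope[of "\<lambda>i. G (p i)"])
    finally have "\<bar>D (p n) - D (p 0)\<bar> \<le> x / n * (G (p n) - G (p 0))"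
      by (simp only: sum_lessThan_telescope[of "\<lambda>i. D (p i)"])
    then show ?thesis using n by (simp add: p_def)
  qed
  have "(\<lambda>n. x * (G x - G 0) / real n) \<longlonglongrightarrow> 0" by real_asymp
  then have "\<bar>D x - D 0\<bar> \<le> 0"
    by (rule LIMSEQ_le_const) (use le in \<open>auto intro!: exI[of _ 1]\<close>)
  then show ?thesis by simp
qed

lemma has_weak_deriv_continuous:
  assumes "has_weak_deriv l f g"
  shows "continuous_on {0..l} f"
proof -
  have L: "L2_interval l g" using assms by (simp add: has_weak_deriv_def)
  have "continuous_on {0..l} (\<lambda>x. f 0 + integral {0..x} g)"
    by (intro continuous_intros indefinite_integral_continuous_1 L2_interval_integrable_on(2)[OF L]) auto
  then show ?thesis
    by (rule continuous_on_eq) (use has_weak_deriv_diff[OF assms, of 0] in fastforce)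
qed

text \<open>The difference \<open>D\<close> between \<open>F (f x)\<close> and the expected
  primitive has quadratically small increments: both the Taylor error of \<open>F\<close> and the
  variation of \<open>F' (f t)\<close> are controlled by the square of the integral of
  \<open>\<bar>g\<bar>\<close>, and Cauchy-Schwarz turns this into the form required by
  \<open>const_on_interval\<close>. In this way the rule follows from the primitive formula alone,
  without differentiation almost everywhere.\<close>

lemma has_weak_deriv_chain:
  assumes f: "has_weak_deriv l f g"
    and F: "\<And>t. (F has_real_derivative F' t) (at t)"
    and F': "\<And>s t. \<bar>F' s - F' t\<bar> \<le> C * \<bar>s - t\<bar>"
  shows "has_weak_deriv l (\<lambda>x. F (f x)) (\<lambda>x. F' (f x) * g x)"
proof -
  have C: "0 \<le> C" using F'[of 1 0] by simp
  have L: "L2_interval l g" using f by (simp add: has_weak_deriv_def)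
  then have L': "L2_interval l (\<lambda>t. \<bar>g t\<bar>)" by (auto simp: L2_interval_def)
  have cF': "continuous_on UNIV F'"
    using C by (intro uniformly_continuous_imp_continuous lipschitz_on_uniformly_continuous[of C])
      (auto simp: lipschitz_on_def dist_real_def F')
  have cf: "continuous_on {0..l} f" by (rule has_weak_deriv_continuous[OF f])
  have L2: "L2_interval l (\<lambda>x. F' (f x) * g x)"
    by (rule L2_interval_bounded_mult[OF continuous_on_compose2[OF cF' cf] L]) auto
  have taylor: "\<bar>F b - F a - F' a * (b - a)\<bar> \<le> C * (b - a)\<^sup>2" for a b
  proof -
    have "\<exists>c. F b - F a = F' c * (b - a) \<and> \<bar>c - a\<bar> \<le> \<bar>b - a\<bar>"
    proof (cases a b rule: linorder_cases)
      case less
      then obtain z where "a < z" "z < b" "F b - F a = (b - a) * F' z" using MVT2[of a b F F'] F by auto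
      then show ?thesis by (intro exI[of _ z]) auto
    next
      case greater
      then obtain z where "b < z" "z < a" "F a - F b = (a - b) * F' z" using MVT2[of b a F F'] F by auto
      then show ?thesis by (intro exI[of _ z]) (auto simp: algebra_simps)
    qed auto
    then obtain c where c: "F b - F a = F' c * (b - a)" "\<bar>c - a\<bar> \<le> \<bar>b - a\<bar>" by blast
    have "\<bar>F b - F a - F' a * (b - a)\<bar> = \<bar>F' c - F' a\<bar> * \<bar>b - a\<bar>"
      unfolding c abs_mult[symmetric] by (simp add: algebra_simps)
    also have "\<dots> \<le> C * \<bar>b - a\<bar> * \<bar>b - a\<bar>"
      using F'[of c a] c(2) C by (intro mult_right_mono) (auto intro: order_trans mult_left_mono)
    finally show ?thesis by (simp add: power2_eq_square)
  qed
  define D where "D x = F (f x) - integral {0..x} (\<lambda>t. F' (f t) * g t)" for x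
  define G where "G x = 2 * C * integral {0..x} (\<lambda>t. (g t)\<^sup>2)" for x
  have D: "\<bar>D y - D x\<bar> \<le> (y - x) * (G y - G x)" if xy: "0 \<le> x" "x \<le> y" "y \<le> l" for x y
  proof -
    let ?A = "integral {x..y} (\<lambda>t. \<bar>g t\<bar>)"
    have i1: "g integrable_on {x..y}" "(\<lambda>t. \<bar>g t\<bar>) integrable_on {x..y}"
      "(\<lambda>x. F' (f x) * g x) integrable_on {x..y}"
      using xy L2_interval_integrable_on(2)[OF L] L2_interval_integrable_on(2)[OF L'] L2_interval_integrable_on(2)[OF L2] by auto
    have A0: "0 \<le> ?A" using i1 by (intro Henstock_Kurzweil_Integration.integral_nonneg) auto
    have "integral {0..y} (\<lambda>t. F' (f t) * g t) = integral {0..x} (\<lambda>t. F' (f t) * g t) + integral {x..y} (\<lambda>t. F' (f t) * g t)"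
      using Henstock_Kurzweil_Integration.integral_combine[of 0 x y "\<lambda>t. F' (f t) * g t"]
      L2_interval_integrable_on(2)[OF L2, of 0 y] xy by auto
    moreover have "integral {x..y} (\<lambda>t. F' (f t) * g t) = integral {x..y} (\<lambda>t. (F' (f t) - F' (f x)) * g t) + F' (f x) * (f y - f x)"
    proof -
      have "((\<lambda>t. F' (f t) * g t - F' (f x) * g t) has_integral
          (integral {x..y} (\<lambda>t. F' (f t) * g t) - F' (f x) * integral {x..y} g)) {x..y}"
        using i1 by (intro has_integral_diff has_integral_mult_right integrable_integral)
      then show ?thesis
        unfolding has_weak_deriv_diff[OF f xy] by (simp add: left_diff_distrib integral_unique)
    qed
    ultimately have "D y - D x = (F (f y) - F (f x) - F' (f x) * (f y - f x)) - integral {x..y} (\<lambda>t. (F' (f t) - F' (f x)) * g t)"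
      unfolding D_def by simp
    moreover have "norm (integral {x..y} (\<lambda>t. (F' (f t) - F' (f x)) * g t)) \<le> integral {x..y} (\<lambda>t. C * ?A * \<bar>g t\<bar>)"
    proof (rule integral_norm_bound_integral)
      show "(\<lambda>t. (F' (f t) - F' (f x)) * g t) integrable_on {x..y}"
        unfolding left_diff_distrib using i1 by (intro integrable_diff integrable_on_mult_right)
      show "(\<lambda>t. C * ?A * \<bar>g t\<bar>) integrable_on {x..y}"
        using i1 by (intro integrable_on_mult_right)
      fix t assume t: "t \<in> {x..y}"
      have "\<bar>f t - f x\<bar> \<le> integral {x..t} (\<lambda>t. \<bar>g t\<bar>)" using t xy by (intro has_weak_deriv_Hoelder[OF f]) auto
      also have "\<dots> \<le> ?A" using t i1 xy L2_interval_integrable_on(2)[OF L'] by (intro integral_subset_le) auto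
      finally have "\<bar>F' (f t) - F' (f x)\<bar> \<le> C * ?A"
        using F'[of "f t" "f x"] C by (auto intro: order_trans mult_left_mono)
      then show "norm ((F' (f t) - F' (f x)) * g t) \<le> C * ?A * \<bar>g t\<bar>"
        by (auto simp: abs_mult intro!: mult_right_mono)
    qed
    moreover have "(f y - f x)\<^sup>2 \<le> ?A\<^sup>2"
      using power_mono[OF has_weak_deriv_Hoelder(2)[OF f xy], of 2] by simp
    then have "C * (f y - f x)\<^sup>2 \<le> C * ?A\<^sup>2" using C by (rule mult_left_mono)
    ultimately have "\<bar>D y - D x\<bar> \<le> C * ?A\<^sup>2 + C * ?A\<^sup>2"
      using taylor[of "f y" "f x"] by (simp add: power2_eq_square algebra_simps)
    also have "\<dots> \<le> (2 * C) * ((y - x) * integral {x..y} (\<lambda>t. (g t)\<^sup>2))"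
      using integral_Cauchy_Schwarz[OF L xy] C by (simp add: mult_left_mono)
    also have "\<dots> = (y - x) * (G y - G x)"
    proof -
      have "integral {0..x} (\<lambda>t. (g t)\<^sup>2) + integral {x..y} (\<lambda>t. (g t)\<^sup>2) = integral {0..y} (\<lambda>t. (g t)\<^sup>2)"
        using xy L2_interval_mult_integrable_on(2)[OF L L, of 0 y]
        by (intro Henstock_Kurzweil_Integration.integral_combine) (auto simp: power2_eq_square)
      then have "G y - G x = 2 * C * integral {x..y} (\<lambda>t. (g t)\<^sup>2)"
        unfolding G_def by (metis add_diff_cancel_left' right_diff_distrib')
      then show ?thesis by simp
    qed
    finally show ?thesis .
  qed
  show ?thesis
  proof (rule has_weak_derivI[OF L2])
    fix x assume "0 \<le> x" "x \<le> l"
    then have "D x = D 0" using const_on_interval[of l D G x] D by blast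
    then show "F (f x) - F (f 0) = integral {0..x} (\<lambda>t. F' (f t) * g t)"
      by (simp add: D_def)
  qed
qed

lemma has_weak_deriv_add:
  assumes "has_weak_deriv l f g" "has_weak_deriv l f' g'"
  shows "has_weak_deriv l (\<lambda>x. f x + f' x) (\<lambda>x. g x + g' x)"
proof -
  have L: "L2_interval l g" "L2_interval l g'" using assms by (auto simp: has_weak_deriv_def)
  show ?thesis
  proof (rule has_weak_derivI[OF L2_interval_add[OF L]])
    fix x assume x: "0 \<le> x" "x \<le> l"
    then show "f x + f' x - (f 0 + f' 0) = integral {0..x} (\<lambda>x. g x + g' x)"
      using has_weak_deriv_diff[OF assms(1), of 0 x] has_weak_deriv_diff[OF assms(2), of 0 x]
      by (subst Henstock_Kurzweil_Integration.integral_add) (auto intro!: L2_interval_integrable_on L)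
  qed
qed

lemma has_weak_deriv_cmult:
  assumes "has_weak_deriv l f g"
  shows "has_weak_deriv l (\<lambda>x. c * f x) (\<lambda>x. c * g x)"
proof -
  have L: "L2_interval l g" using assms by (auto simp: has_weak_deriv_def)
  show ?thesis
  proof (rule has_weak_derivI[OF L2_interval_cmult[OF L]])
    fix x assume x: "0 \<le> x" "x \<le> l"
    then show "c * f x - c * f 0 = integral {0..x} (\<lambda>x. c * g x)"
      using has_weak_deriv_diff[OF assms(1), of 0 x] by (simp add: right_diff_distrib[symmetric])
  qed
qed

text \<open>By polarisation the product is a combination of squares of \<open>f + f'\<close> and
  \<open>f - f'\<close>. The chain rule applies to the square because its derivative is globally
  Lipschitz.\<close>

lemma has_weak_deriv_mult:
  assumes f: "has_weak_deriv l f g" and f': "has_weak_deriv l f' g'"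
  shows "has_weak_deriv l (\<lambda>x. f x * f' x) (\<lambda>x. g x * f' x + f x * g' x)"
proof -
  have sq: "has_weak_deriv l (\<lambda>x. (h x)\<^sup>2) (\<lambda>x. 2 * h x * k x)" if "has_weak_deriv l h k" for h k
  proof (rule has_weak_deriv_chain[OF that, of _ "\<lambda>t. 2 * t" 2])
    show "((\<lambda>t. t\<^sup>2) has_real_derivative 2 * t) (at t)" for t :: real
      by (auto intro!: derivative_eq_intros)
    show "\<bar>2 * s - 2 * t\<bar> \<le> 2 * \<bar>s - t\<bar>" for s t :: real
      using abs_mult[of 2 "s - t"] unfolding right_diff_distrib by linarith
  qed
  have "has_weak_deriv l (\<lambda>x. 1/4 * (f x + f' x)\<^sup>2 + (-1/4) * (f x + (-1) * f' x)\<^sup>2)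
    (\<lambda>x. 1/4 * (2 * (f x + f' x) * (g x + g' x)) + (-1/4) * (2 * (f x + (-1) * f' x) * (g x + (-1) * g' x)))"
    by (intro has_weak_deriv_add has_weak_deriv_cmult sq f f')
  moreover have "1/4 * (f x + f' x)\<^sup>2 + (-1/4) * (f x + (-1) * f' x)\<^sup>2 = f x * f' x" for x
    by (simp add: power2_eq_square algebra_simps)
  moreover have "1/4 * (2 * (f x + f' x) * (g x + g' x)) + (-1/4) * (2 * (f x + (-1) * f' x) * (g x + (-1) * g' x))
    = g x * f' x + f x * g' x" for x
    by (simp add: algebra_simps)
  ultimately show ?thesis by simp
qed

lemma has_weak_deriv_cong:
  assumes "has_weak_deriv l f g" "\<And>x. 0 \<le> x \<Longrightarrow> x \<le> l \<Longrightarrow> f x = f' x" "0 \<le> l"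
  shows "has_weak_deriv l f' g"
proof (rule has_weak_derivI)
  show "L2_interval l g" using assms(1) by (simp add: has_weak_deriv_def)
  fix x assume x: "0 \<le> x" "x \<le> l"
  then show "f' x - f' 0 = integral {0..x} g"
    using has_weak_deriv_diff[OF assms(1), of 0 x] assms(2)[of x] assms(2)[of 0] by simp
qed

lemma has_weak_deriv_C1:
  assumes "\<And>x. 0 \<le> x \<Longrightarrow> x \<le> l \<Longrightarrow> (f has_real_derivative f' x) (at x)" "continuous_on {0..l} f'"
  shows "has_weak_deriv l f f'"
proof (rule has_weak_derivI)
  show "L2_interval l f'" by (rule L2_interval_continuous[OF assms(2)])
  fix x assume x: "0 \<le> x" "x \<le> l"
  have "(f' has_integral (f x - f 0)) {0..x}"
  proof (rule fundamental_theorem_of_calculus[OF x(1)])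
    fix y assume "y \<in> {0..x}"
    then have "(f has_real_derivative f' y) (at y)" using x by (intro assms(1)) auto
    then show "(f has_vector_derivative f' y) (at y within {0..x})"
      using has_field_derivative_at_within has_real_derivative_iff_has_vector_derivative by blast
  qed
  then show "f x - f 0 = integral {0..x} f'" by (simp add: integral_unique)
qed

lemma has_weak_deriv_const: "has_weak_deriv l (\<lambda>x. c) (\<lambda>x. 0)"
  by (rule has_weak_deriv_C1) auto

text \<open>Extend \<open>d\<close> by zero to \<open>D\<close>. The Borel sets over which
  \<open>D\<close> integrates to zero are closed under complements and disjoint unions and include
  all half-lines, hence they are all Borel sets.\<close>

lemma AE_zero_if_integrals_zero:
  fixes d :: "real \<Rightarrow> real"
  assumes d: "integrable (lebesgue_on {0..l}) d" and l: "0 \<le> l"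
    and zero: "\<And>x. 0 \<le> x \<Longrightarrow> x \<le> l \<Longrightarrow> integral\<^sup>L (lebesgue_on {0..x}) d = 0"
  shows "AE x in lebesgue_on {0..l}. d x = 0"
proof -
  define D where "D x = (if x \<in> {0..l} then d x else 0)" for x
  have D: "integrable lebesgue D"
  proof -
    have "integrable lebesgue (\<lambda>x. indicator {0..l} x *\<^sub>R d x)"
      using d by (subst (asm) integrable_restrict_space) auto
    then show ?thesis unfolding D_def indicator_scaleR_eq_if .
  qed
  have Iic: "(LINT x:{..a}|lebesgue. D x) = 0" for a
  proof -
    have "(LINT x:{..a}|lebesgue. D x) = integral\<^sup>L lebesgue (\<lambda>x. if x \<in> {0..min a l} then d x else 0)"
      unfolding set_lebesgue_integral_def D_def by (rule Bochner_Integration.integral_cong) (auto simp: indicator_def)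
    also have "\<dots> = integral\<^sup>L (lebesgue_on {0..min a l}) d"
      by (rule Lebesgue_Measure.integral_restrict_UNIV) auto
    also have "\<dots> = 0"
      by (cases "a < 0") (use zero[of "min a l"] l in auto)
    finally show ?thesis .
  qed
  have tot: "integral\<^sup>L lebesgue D = 0"
  proof -
    have "integral\<^sup>L lebesgue D = (LINT x:{..l}|lebesgue. D x)"
      unfolding set_lebesgue_integral_def D_def by (rule Bochner_Integration.integral_cong) (auto simp: indicator_def)
    then show ?thesis using Iic by simp
  qed
  have sets: "sigma_sets UNIV (range (\<lambda>a::real. {..a})) = sets borel"
    unfolding borel_eq_atMost by simp
  have borel: "(LINT x:A|lebesgue. D x) = 0" if "A \<in> sets borel" for A
  proof -
    have 1: "Int_stable (range (\<lambda>a::real. {..a}))"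
      unfolding Int_stable_def by (metis (no_types, lifting) Int_atMost image_iff rangeI)
    have 2: "A \<in> sigma_sets UNIV (range (\<lambda>a::real. {..a}))" using that sets by simp
    have 3: "range (\<lambda>a::real. {..a}) \<subseteq> Pow UNIV" by simp
    show ?thesis
      using 1 3 2
    proof (induction A rule: sigma_sets_induct_disjoint)
      case (basic A)
      then show ?case using Iic by auto
    next
      case empty
      show ?case by (simp add: set_lebesgue_integral_def)
    next
      case (compl A)
      note A = compl
      then have Am: "A \<in> sets lebesgue" using sets by simp
      have "(LINT x:UNIV - A|lebesgue. D x) = (LINT x|lebesgue. D x - indicator A x *\<^sub>R D x)"
        unfolding set_lebesgue_integral_def by (rule Bochner_Integration.integral_cong) (auto simp: indicator_def)
      also have "\<dots> = 0"
        using tot A(2) integrable_mult_indicator[OF Am D] D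
        by (subst Bochner_Integration.integral_diff) (auto simp: set_lebesgue_integral_def)
      finally show "(LINT x:UNIV - A|lebesgue. D x) = 0" .
    next
      case (union A)
      have Am: "A i \<in> sets lebesgue" for i
        using union(2) sets by auto
      have "(LINT x:(\<Union>i. A i)|lebesgue. D x) = (\<Sum>i. LINT x:A i|lebesgue. D x)"
      proof (rule lebesgue_integral_countable_add[OF Am])
        show "A i \<inter> A j = {}" if "i \<noteq> j" for i j using union(1) that by (auto simp: disjoint_family_on_def)
        show "set_integrable lebesgue (\<Union>i. A i) D"
          unfolding set_integrable_def using Am by (intro integrable_mult_indicator D) auto
      qed
      then show "(LINT x:(\<Union>i. A i)|lebesgue. D x) = 0" using union(3) by simp
    qed
  qed
  interpret finite_measure "lebesgue_on {0..l}"
    by (rule finite_measure_lebesgue_on) auto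
  show ?thesis
  proof (rule density_zero[OF d])
    fix A assume "A \<in> sets (lebesgue_on {0..l})"
    then have A: "A \<in> sets lebesgue"
      using lebesgue_on_mono sets_restrict_space_iff[of "{0..l}" lebesgue A] by auto
    \<comment> \<open>A Lebesgue set is a Borel set up to a null set, so the integral over it
      vanishes as well.\<close>
    then obtain B N where B: "B \<in> sets borel" "negligible N" "B \<union> N = A"
      using sets_lebesgue_almost_borel by blast
    have Dm: "D \<in> borel_measurable lebesgue" using D by simp
    have "AE x in lebesgue. x \<notin> N"
      using B(2) by (auto simp: negligible_iff_null_sets intro: AE_not_in)
    then have "AE x in lebesgue. indicator A x *\<^sub>R D x = indicator B x *\<^sub>R D x"
    proof eventually_elim
      case (elim x)
      then show ?case using B(3) by (auto simp: indicator_def)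
    qed
    then have "(LINT x:A|lebesgue. D x) = (LINT x:B|lebesgue. D x)"
      unfolding set_lebesgue_integral_def using Dm A B(1)
      by (intro integral_cong_AE borel_measurable_scaleR borel_measurable_indicator) auto
    also have "\<dots> = 0" using borel[OF B(1)] .
    finally have "(LINT x|lebesgue. (if x \<in> {0..l} then indicator A x *\<^sub>R d x else 0)) = 0"
      unfolding set_lebesgue_integral_def D_def by (simp add: if_distrib cong: if_cong)
    then show "(LINT x:A|lebesgue_on {0..l}. d x) = 0"
      unfolding set_lebesgue_integral_def
      by (subst (asm) Lebesgue_Measure.integral_restrict_UNIV) auto
  qed
qed

lemma weak_deriv_AE_unique:
  assumes "has_weak_deriv l f g" "has_weak_deriv l f h" "0 \<le> l"
  shows "AE x in lebesgue_on {0..l}. g x = h x"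
proof -
  have L: "L2_interval l g" "L2_interval l h" using assms has_weak_deriv_L2 by blast+
  have "AE x in lebesgue_on {0..l}. g x - h x = 0"
  proof (rule AE_zero_if_integrals_zero[OF _ assms(3)])
    show "integrable (lebesgue_on {0..l}) (\<lambda>x. g x - h x)"
      using L by (intro Bochner_Integration.integrable_diff L2_interval_integrable)
    fix x assume x: "0 \<le> x" "x \<le> l"
    have "integral\<^sup>L (lebesgue_on {0..x}) (\<lambda>x. g x - h x)
        = integral\<^sup>L (lebesgue_on {0..x}) g - integral\<^sup>L (lebesgue_on {0..x}) h"
      using L x by (intro Bochner_Integration.integral_diff L2_interval_integrable_on) auto
    then show "integral\<^sup>L (lebesgue_on {0..x}) (\<lambda>x. g x - h x) = 0"
      using has_weak_deriv_diff[OF assms(1), of 0 x] has_weak_deriv_diff[OF assms(2), of 0 x] x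
        L2_interval_integrable_on(3)[OF L(1), of 0 x] L2_interval_integrable_on(3)[OF L(2), of 0 x] by linarith
  qed
  then show ?thesis by eventually_elim simp
qed

text \<open>This frees the Dirichlet form from the choice made by \<open>SOME\<close>: it may be
  computed with any weak derivatives at hand.\<close>

lemma weak_deriv_integral_eq:
  assumes "has_weak_deriv l f g" "has_weak_deriv l f' g'" "0 \<le> l"
  shows "integral\<^sup>L (lebesgue_on {0..l}) (\<lambda>x. weak_deriv l f x * weak_deriv l f' x)
    = integral\<^sup>L (lebesgue_on {0..l}) (\<lambda>x. g x * g' x)"
proof -
  have w: "has_weak_deriv l f (weak_deriv l f)" "has_weak_deriv l f' (weak_deriv l f')"
    unfolding weak_deriv_def using someI[of "has_weak_deriv l f" g] someI[of "has_weak_deriv l f'" g'] assms by auto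
  have "AE x in lebesgue_on {0..l}. weak_deriv l f x * weak_deriv l f' x = g x * g' x"
    using weak_deriv_AE_unique[OF w(1) assms(1,3)] weak_deriv_AE_unique[OF w(2) assms(2,3)]
    by eventually_elim simp
  then show ?thesis
    using w[THEN has_weak_deriv_L2] assms(1,2)[THEN has_weak_deriv_L2]
    by (intro integral_cong_AE) (auto simp: L2_interval_def)
qed

section \<open>Completeness of L2 and closedness of the weak derivative\<close>

lemma L2_interval_abs_integral_le:
  assumes "L2_interval l h" "0 \<le> l"
  shows "(integral\<^sup>L (lebesgue_on {0..l}) (\<lambda>x. \<bar>h x\<bar>))\<^sup>2 \<le> l * integral\<^sup>L (lebesgue_on {0..l}) (\<lambda>x. (h x)\<^sup>2)"
proof -
  have L: "L2_interval l (\<lambda>x. \<bar>h x\<bar>)" using assms(1) by (auto simp: L2_interval_def)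
  have "integral\<^sup>L (lebesgue_on {0..l}) (\<lambda>x. \<bar>h x\<bar>) = integral {0..l} (\<lambda>x. \<bar>h x\<bar>)"
    using L assms by (intro L2_interval_integrable_on) auto
  moreover have "integral\<^sup>L (lebesgue_on {0..l}) (\<lambda>x. (h x)\<^sup>2) = integral {0..l} (\<lambda>x. (h x)\<^sup>2)"
    using L2_interval_mult_integrable_on(3)[OF assms(1,1), of 0 l] by (simp add: power2_eq_square)
  ultimately show ?thesis using integral_Cauchy_Schwarz[OF assms(1), of 0 l] assms(2) by simp
qed

text \<open>On a bounded interval an L2 Cauchy sequence is also an L1 Cauchy sequence, so a
  subsequence converges almost everywhere. Fatou's lemma then identifies its pointwise limit as the
  L2 limit of the whole sequence.\<close>

lemma L2_interval_complete:
  assumes L: "\<And>n. L2_interval l (g n)" and l: "0 \<le> l"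
    and Cauchy: "\<And>e. e > 0 \<Longrightarrow> \<exists>N. \<forall>i\<ge>N. \<forall>j\<ge>N. integral\<^sup>L (lebesgue_on {0..l}) (\<lambda>x. (g i x - g j x)\<^sup>2) < e"
  obtains h where "L2_interval l h" "(\<lambda>n. integral\<^sup>L (lebesgue_on {0..l}) (\<lambda>x. (g n x - h x)\<^sup>2)) \<longlonglongrightarrow> 0"
proof -
  let ?M = "lebesgue_on {0..l}"
  have gm[measurable]: "g n \<in> borel_measurable ?M" for n using L[of n] by (simp add: L2_interval_def)
  have int: "integrable ?M (g n)" for n by (rule L2_interval_integrable[OF L])
  have "\<exists>N. \<forall>i\<ge>N. \<forall>j\<ge>N. LINT x|?M. norm (g i x - g j x) < e" if e: "e > 0" for e :: real
  proof -
    obtain N where N: "\<And>i j. i \<ge> N \<Longrightarrow> j \<ge> N \<Longrightarrow> integral\<^sup>L ?M (\<lambda>x. (g i x - g j x)\<^sup>2) < e\<^sup>2 / (l + 1)"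
      using Cauchy[of "e\<^sup>2 / (l + 1)"] e l by auto
    have "LINT x|?M. norm (g i x - g j x) < e" if "i \<ge> N" "j \<ge> N" for i j
    proof -
      have "(LINT x|?M. \<bar>g i x - g j x\<bar>)\<^sup>2 \<le> l * integral\<^sup>L ?M (\<lambda>x. (g i x - g j x)\<^sup>2)"
        by (rule L2_interval_abs_integral_le[OF L2_interval_diff[OF L L] l])
      also have "\<dots> \<le> l * (e\<^sup>2 / (l + 1))"
        using N[OF that] l by (intro mult_left_mono) auto
      also have "\<dots> < e\<^sup>2" using e l by (simp add: field_simps)
      finally show ?thesis using e by (simp add: power2_less_imp_less)
    qed
    then show ?thesis by blast
  qed
  then obtain r where r: "strict_mono r" "AE x in ?M. Cauchy (\<lambda>i. g (r i) x)"
    using cauchy_L1_AE_cauchy_subseq[of ?M g] int by blast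
  define h where "h x = lim (\<lambda>i. g (r i) x)" for x
  have hm[measurable]: "h \<in> borel_measurable ?M" unfolding h_def by measurable
  have lim: "AE x in ?M. (\<lambda>i. g (r i) x) \<longlonglongrightarrow> h x"
    using r(2) by eventually_elim (simp add: h_def Cauchy_convergent_iff convergent_LIMSEQ_iff[symmetric])
  \<comment> \<open>Fatou's lemma along the subsequence yields integrability and the bound
    together.\<close>
  have est: "integrable ?M (\<lambda>x. (g n x - h x)\<^sup>2) \<and> integral\<^sup>L ?M (\<lambda>x. (g n x - h x)\<^sup>2) \<le> e"
    if N: "\<And>i. i \<ge> N \<Longrightarrow> integral\<^sup>L ?M (\<lambda>x. (g n x - g i x)\<^sup>2) < e" and e: "e > 0" for n e N
  proof -
    have i2: "integrable ?M (\<lambda>x. (g n x - g i x)\<^sup>2)" for i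
      using L2_interval_diff[OF L L] by (simp add: L2_interval_def)
    have "(\<integral>\<^sup>+x. ennreal ((g n x - h x)\<^sup>2) \<partial>?M) = (\<integral>\<^sup>+x. liminf (\<lambda>i. ennreal ((g n x - g (r i) x)\<^sup>2)) \<partial>?M)"
    proof (rule nn_integral_cong_AE)
      show "AE x in ?M. ennreal ((g n x - h x)\<^sup>2) = liminf (\<lambda>i. ennreal ((g n x - g (r i) x)\<^sup>2))"
        using lim
      proof eventually_elim
        case (elim x)
        then have "(\<lambda>i. ennreal ((g n x - g (r i) x)\<^sup>2)) \<longlonglongrightarrow> ennreal ((g n x - h x)\<^sup>2)"
          by (intro tendsto_ennrealI tendsto_intros)
        then show ?case using lim_imp_Liminf[OF trivial_limit_sequentially] by metis
      qed
    qed
    also have "\<dots> \<le> liminf (\<lambda>i. \<integral>\<^sup>+x. ennreal ((g n x - g (r i) x)\<^sup>2) \<partial>?M)"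
      by (rule nn_integral_liminf) measurable
    also have "\<dots> \<le> ennreal e"
    proof (rule Liminf_le)
      show "\<forall>\<^sub>F i in sequentially. (\<integral>\<^sup>+x. ennreal ((g n x - g (r i) x)\<^sup>2) \<partial>?M) \<le> ennreal e"
      proof (rule eventually_sequentiallyI[of N])
        fix i assume "N \<le> i"
        then have "N \<le> r i" using seq_suble[OF r(1), of i] by simp
        then show "(\<integral>\<^sup>+x. ennreal ((g n x - g (r i) x)\<^sup>2) \<partial>?M) \<le> ennreal e"
          using N[of "r i"] i2[of "r i"] by (subst nn_integral_eq_integral) (auto intro: ennreal_leI)
      qed
    qed simp
    finally have le: "(\<integral>\<^sup>+x. ennreal ((g n x - h x)\<^sup>2) \<partial>?M) \<le> ennreal e" .
    have int: "integrable ?M (\<lambda>x. (g n x - h x)\<^sup>2)"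
      by (rule integrableI_nonneg) (use le in \<open>auto intro: le_less_trans\<close>)
    then have "ennreal (integral\<^sup>L ?M (\<lambda>x. (g n x - h x)\<^sup>2)) \<le> ennreal e"
      using le by (subst (asm) nn_integral_eq_integral) auto
    then show ?thesis using int e by simp
  qed
  obtain N1 where "\<And>i j. i \<ge> N1 \<Longrightarrow> j \<ge> N1 \<Longrightarrow> integral\<^sup>L ?M (\<lambda>x. (g i x - g j x)\<^sup>2) < 1"
    using Cauchy[of 1] by auto
  then have "integrable ?M (\<lambda>x. (g N1 x - h x)\<^sup>2)" using est[of N1 N1 1] by auto
  then have "L2_interval l (\<lambda>x. g N1 x - h x)" unfolding L2_interval_def by simp
  from L2_interval_diff[OF L this, of N1] have hL: "L2_interval l h" by simp
  moreover have "(\<lambda>n. integral\<^sup>L ?M (\<lambda>x. (g n x - h x)\<^sup>2)) \<longlonglongrightarrow> 0"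
  proof (rule LIMSEQ_I)
    fix e :: real assume e: "e > 0"
    then obtain N where N: "\<And>i j. i \<ge> N \<Longrightarrow> j \<ge> N \<Longrightarrow> integral\<^sup>L ?M (\<lambda>x. (g i x - g j x)\<^sup>2) < e/2"
      using Cauchy[of "e/2"] by auto
    have "integral\<^sup>L ?M (\<lambda>x. (g n x - h x)\<^sup>2) < e" if "n \<ge> N" for n
    proof -
      have "integral\<^sup>L ?M (\<lambda>x. (g n x - h x)\<^sup>2) \<le> e/2"
        using est[of N n "e/2"] N that e by auto
      then show ?thesis using e by linarith
    qed
    then show "\<exists>no. \<forall>n\<ge>no. norm (integral\<^sup>L ?M (\<lambda>x. (g n x - h x)\<^sup>2) - 0) < e"
      using e by (intro exI[of _ N]) auto
  qed
  ultimately show ?thesis using that by blast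
qed

text \<open>L2 convergence of the derivatives controls their integrals over \<open>{0..x}\<close> by
  Cauchy-Schwarz, so the primitive formula survives a pointwise limit.\<close>

lemma has_weak_deriv_limit:
  assumes f: "\<And>n. has_weak_deriv l (f n) (g n)" and h: "L2_interval l h" and l: "0 \<le> l"
    and g: "(\<lambda>n. integral\<^sup>L (lebesgue_on {0..l}) (\<lambda>x. (g n x - h x)\<^sup>2)) \<longlonglongrightarrow> 0"
    and lim: "\<And>x. 0 \<le> x \<Longrightarrow> x \<le> l \<Longrightarrow> (\<lambda>n. f n x) \<longlonglongrightarrow> k x"
  shows "has_weak_deriv l k h"
proof (rule has_weak_derivI[OF h])
  fix x assume x: "0 \<le> x" "x \<le> l"
  have L: "L2_interval l (g n)" for n by (rule has_weak_deriv_L2[OF f])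
  have D: "L2_interval l (\<lambda>x. g n x - h x)" for n by (rule L2_interval_diff[OF L h])
  have "(\<lambda>n. integral {0..x} (g n) - integral {0..x} h) \<longlonglongrightarrow> 0"
  proof (rule Lim_null_comparison)
    show "(\<lambda>n. sqrt (l * integral\<^sup>L (lebesgue_on {0..l}) (\<lambda>x. (g n x - h x)\<^sup>2))) \<longlonglongrightarrow> 0"
      using tendsto_real_sqrt[OF tendsto_mult_right_zero[OF g, of l]] by (simp add: mult.commute)
    show "\<forall>\<^sub>F n in sequentially. norm (integral {0..x} (g n) - integral {0..x} h)
      \<le> sqrt (l * integral\<^sup>L (lebesgue_on {0..l}) (\<lambda>x. (g n x - h x)\<^sup>2))"
    proof (rule always_eventually, rule allI)
      fix n
      have D': "L2_interval l (\<lambda>x. \<bar>g n x - h x\<bar>)" using D[of n] by (auto simp: L2_interval_def)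
      have i: "g n integrable_on {0..x}" "h integrable_on {0..x}" "(\<lambda>x. \<bar>g n x - h x\<bar>) integrable_on {0..x}"
        "(\<lambda>x. \<bar>g n x - h x\<bar>) integrable_on {0..l}"
        using L[of n] h D' x by (auto intro!: L2_interval_integrable_on)
      have "norm (integral {0..x} (\<lambda>x. g n x - h x)) \<le> integral {0..x} (\<lambda>x. \<bar>g n x - h x\<bar>)"
        using i by (intro integral_norm_bound_integral integrable_diff) auto
      also have "\<dots> \<le> integral {0..l} (\<lambda>x. \<bar>g n x - h x\<bar>)"
        using i x by (intro integral_subset_le) auto
      also have "\<dots> = integral\<^sup>L (lebesgue_on {0..l}) (\<lambda>x. \<bar>g n x - h x\<bar>)"
        using L2_interval_integrable_on(3)[OF D', of 0 l] by simp
      also have "\<dots> \<le> sqrt (l * integral\<^sup>L (lebesgue_on {0..l}) (\<lambda>x. (g n x - h x)\<^sup>2))"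
        using L2_interval_abs_integral_le[OF D l] by (rule real_le_rsqrt)
      finally show "norm (integral {0..x} (g n) - integral {0..x} h)
      \<le> sqrt (l * integral\<^sup>L (lebesgue_on {0..l}) (\<lambda>x. (g n x - h x)\<^sup>2))"
        using i by (simp add: Henstock_Kurzweil_Integration.integral_diff)
    qed
  qed
  then have "(\<lambda>n. integral {0..x} (g n)) \<longlonglongrightarrow> integral {0..x} h" by (rule LIM_zero_cancel)
  moreover have "integral {0..x} (g n) = f n x - f n 0" for n
    using has_weak_deriv_diff[OF f, of 0 x] x by simp
  ultimately have "(\<lambda>n. f n x - f n 0) \<longlonglongrightarrow> integral {0..x} h" by simp
  moreover have "(\<lambda>n. f n x - f n 0) \<longlonglongrightarrow> k x - k 0"
    using x l by (intro tendsto_diff lim) auto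
  ultimately show "k x - k 0 = integral {0..x} h" using LIMSEQ_unique by blast
qed

section \<open>The form domain\<close>

lemma has_weak_deriv_sup_bound:
  assumes f: "has_weak_deriv l f g" and x: "0 \<le> x" "x \<le> l"
  shows "l * (f x)\<^sup>2 \<le> 2 * integral\<^sup>L (lebesgue_on {0..l}) (\<lambda>t. (f t)\<^sup>2)
     + 2 * l\<^sup>2 * integral\<^sup>L (lebesgue_on {0..l}) (\<lambda>t. (g t)\<^sup>2)"
proof -
  have L: "L2_interval l g" by (rule has_weak_deriv_L2[OF f])
  have Lf: "L2_interval l f" by (rule L2_interval_continuous[OF has_weak_deriv_continuous[OF f]])
  let ?J = "integral {0..l} (\<lambda>t. (g t)\<^sup>2)"
  have ig: "(\<lambda>t. (g t)\<^sup>2) integrable_on {a..b}" if "0 \<le> a" "b \<le> l" for a b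
    using L2_interval_mult_integrable_on(2)[OF L L that] by (simp add: power2_eq_square)
  have i_f: "(\<lambda>t. (f t)\<^sup>2) integrable_on {0..l}"
    using L2_interval_mult_integrable_on(2)[OF Lf Lf, of 0 l] by (simp add: power2_eq_square)
  \<comment> \<open>Integrating this over \<open>t\<close> replaces the values of \<open>f\<close>
    by its L2 norm. The resulting bound makes minimising sequences equibounded on every
    edge.\<close>
  have pt: "(f x)\<^sup>2 \<le> 2 * (f t)\<^sup>2 + 2 * l * ?J" if t: "t \<in> {0..l}" for t
  proof -
    have *: "(f b - f a)\<^sup>2 \<le> l * ?J" if "0 \<le> a" "a \<le> b" "b \<le> l" for a b
    proof -
      have "integral {a..b} (\<lambda>t. (g t)\<^sup>2) \<le> ?J" "0 \<le> integral {a..b} (\<lambda>t. (g t)\<^sup>2)"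
        using ig that by (auto intro!: integral_subset_le Henstock_Kurzweil_Integration.integral_nonneg)
      then have "(b - a) * integral {a..b} (\<lambda>t. (g t)\<^sup>2) \<le> l * ?J"
        using that by (intro mult_mono) auto
      then show ?thesis using has_weak_deriv_Hoelder(1)[OF f that] by linarith
    qed
    have "(f x - f t)\<^sup>2 \<le> l * ?J"
      using *[of x t] *[of t x] t x by (cases "x \<le> t") (auto simp: power2_commute)
    moreover have "(f x)\<^sup>2 \<le> 2 * (f t)\<^sup>2 + 2 * (f x - f t)\<^sup>2"
      using zero_le_power2[of "f x - 2 * f t"] by (simp add: power2_eq_square algebra_simps)
    ultimately show ?thesis by linarith
  qed
  have "integral {0..l} (\<lambda>t. (f x)\<^sup>2) \<le> integral {0..l} (\<lambda>t. 2 * (f t)\<^sup>2 + 2 * l * ?J)"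
    using pt i_f by (intro integral_le integrable_add integrable_on_mult_right) auto
  also have "\<dots> = 2 * integral {0..l} (\<lambda>t. (f t)\<^sup>2) + l * (2 * l * ?J)"
    using i_f x by (subst Henstock_Kurzweil_Integration.integral_add) (auto intro: integrable_on_mult_right)
  finally have "l * (f x)\<^sup>2 \<le> 2 * integral {0..l} (\<lambda>t. (f t)\<^sup>2) + 2 * l\<^sup>2 * ?J"
    using x by (simp add: power2_eq_square algebra_simps)
  moreover have "integral {0..l} (\<lambda>t. (f t)\<^sup>2) = integral\<^sup>L (lebesgue_on {0..l}) (\<lambda>t. (f t)\<^sup>2)"
    using L2_interval_mult_integrable_on(3)[OF Lf Lf, of 0 l] by (simp add: power2_eq_square)
  moreover have "?J = integral\<^sup>L (lebesgue_on {0..l}) (\<lambda>t. (g t)\<^sup>2)"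
    using L2_interval_mult_integrable_on(3)[OF L L, of 0 l] by (simp add: power2_eq_square)
  ultimately show ?thesis by simp
qed

lemma has_weak_deriv_Hoelder_half:
  assumes f: "has_weak_deriv l f g" and x: "x \<in> {0..l}" "y \<in> {0..l}"
  shows "(f y - f x)\<^sup>2 \<le> \<bar>y - x\<bar> * integral\<^sup>L (lebesgue_on {0..l}) (\<lambda>t. (g t)\<^sup>2)"
proof -
  have L: "L2_interval l g" by (rule has_weak_deriv_L2[OF f])
  let ?J = "integral {0..l} (\<lambda>t. (g t)\<^sup>2)"
  have ig: "(\<lambda>t. (g t)\<^sup>2) integrable_on {a..b}" if "0 \<le> a" "b \<le> l" for a b
    using L2_interval_mult_integrable_on(2)[OF L L that] by (simp add: power2_eq_square)
  have *: "(f b - f a)\<^sup>2 \<le> (b - a) * ?J" if "0 \<le> a" "a \<le> b" "b \<le> l" for a b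
  proof -
    have "integral {a..b} (\<lambda>t. (g t)\<^sup>2) \<le> ?J"
      using ig that by (auto intro!: integral_subset_le)
    then have "(b - a) * integral {a..b} (\<lambda>t. (g t)\<^sup>2) \<le> (b - a) * ?J"
      using that by (intro mult_left_mono) auto
    then show ?thesis using has_weak_deriv_Hoelder(1)[OF f that] by linarith
  qed
  have "(f y - f x)\<^sup>2 \<le> \<bar>y - x\<bar> * ?J"
    using *[of x y] *[of y x] x by (cases "x \<le> y") (auto simp: power2_commute abs_if)
  then show ?thesis
    using L2_interval_mult_integrable_on(3)[OF L L, of 0 l] by (simp add: power2_eq_square)
qed

text \<open>Arzela-Ascoli is applied to one edge after another, each time thinning out the
  subsequence found so far. Convergence on the earlier edges persists, and finitely many steps
  suffice.\<close>

lemma uniform_limit_subseq_edges: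
  fixes f :: "nat \<Rightarrow> 'e \<Rightarrow> real \<Rightarrow> real"
  assumes "finite F"
    and bd: "\<And>n e x. e \<in> F \<Longrightarrow> x \<in> {0..L e} \<Longrightarrow> (f n e x)\<^sup>2 \<le> B e"
    and Hd: "\<And>n e x y. e \<in> F \<Longrightarrow> x \<in> {0..L e} \<Longrightarrow> y \<in> {0..L e} \<Longrightarrow> (f n e y - f n e x)\<^sup>2 \<le> \<bar>y - x\<bar> * A"
  shows "\<exists>k w. strict_mono (k :: nat \<Rightarrow> nat) \<and>
    (\<forall>e\<in>F. continuous_on {0..L e} (w e) \<and> (\<forall>\<epsilon>>0. \<exists>N. \<forall>n\<ge>N. \<forall>x\<in>{0..L e}. \<bar>f (k n) e x - w e x\<bar> < \<epsilon>))"
  using assms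
proof (induction F)
  case empty
  show ?case by (auto intro: exI[of _ id] strict_mono_id)
next
  case (insert d F)
  have "\<exists>k w. strict_mono (k :: nat \<Rightarrow> nat) \<and>
    (\<forall>e\<in>F. continuous_on {0..L e} (w e) \<and> (\<forall>\<epsilon>>0. \<exists>N. \<forall>n\<ge>N. \<forall>x\<in>{0..L e}. \<bar>f (k n) e x - w e x\<bar> < \<epsilon>))"
    by (rule insert.IH) (use insert.prems in blast)+
  then obtain k w where k: "strict_mono (k :: nat \<Rightarrow> nat)"
    and w: "\<And>e. e \<in> F \<Longrightarrow> continuous_on {0..L e} (w e)"
      "\<And>e \<epsilon>. e \<in> F \<Longrightarrow> \<epsilon> > 0 \<Longrightarrow> \<exists>N. \<forall>n\<ge>N. \<forall>x\<in>{0..L e}. \<bar>f (k n) e x - w e x\<bar> < \<epsilon>"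
    by metis
  obtain v r where v: "continuous_on {0..L d} v" "strict_mono (r :: nat \<Rightarrow> nat)"
    "\<And>\<epsilon>. 0 < \<epsilon> \<Longrightarrow> \<exists>N. \<forall>n x. n \<ge> N \<and> x \<in> {0..L d} \<longrightarrow> norm (f (k (r n)) d x - v x) < \<epsilon>"
  proof (rule Arzela_Ascoli[of "{0..L d}" "\<lambda>n. f (k n) d" "sqrt (B d)"])
    show "norm (f (k n) d x) \<le> sqrt (B d)" if "x \<in> {0..L d}" for n x
      using insert.prems(1)[of d x "k n"] that by (auto intro: real_le_rsqrt)
    fix x \<epsilon> :: real assume x: "x \<in> {0..L d}" and e: "0 < \<epsilon>"
    \<comment> \<open>Chosen so that
      \<open>?\<delta> * (\<bar>A\<bar> + 1) = \<epsilon>\<^sup>2\<close>; the added 1 keeps the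
      denominator positive.\<close>
    let ?\<delta> = "\<epsilon>\<^sup>2 / (\<bar>A\<bar> + 1)"
    have "norm (f (k n) d x - f (k n) d y) < \<epsilon>" if y: "y \<in> {0..L d}" "norm (x - y) < ?\<delta>" for n y
    proof -
      have "(f (k n) d x - f (k n) d y)\<^sup>2 \<le> \<bar>x - y\<bar> * A"
        using insert.prems(2)[of d y x "k n"] x y by simp
      also have "\<dots> \<le> \<bar>x - y\<bar> * (\<bar>A\<bar> + 1)" by (intro mult_left_mono) auto
      also have "\<dots> < ?\<delta> * (\<bar>A\<bar> + 1)" using y(2) by (intro mult_strict_right_mono) auto
      also have "\<dots> = \<epsilon>\<^sup>2" by simp
      finally have "\<bar>f (k n) d x - f (k n) d y\<bar>\<^sup>2 < \<epsilon>\<^sup>2" by simp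
      then show ?thesis using e by (simp add: power2_less_imp_less)
    qed
    moreover have "?\<delta> > 0" using e by (simp add: add_nonneg_pos)
    ultimately show "\<exists>\<delta>. 0 < \<delta> \<and> (\<forall>n y. y \<in> {0..L d} \<and> norm (x - y) < \<delta> \<longrightarrow> norm (f (k n) d x - f (k n) d y) < \<epsilon>)"
      by blast
  qed auto
  have kr: "strict_mono (k \<circ> r)" using k v(2) by (rule strict_mono_o)
  show ?case
  proof (rule exI[of _ "k \<circ> r"], rule exI[of _ "w(d := v)"], intro conjI kr ballI allI impI)
    fix e assume e: "e \<in> insert d F"
    show "continuous_on {0..L e} ((w(d := v)) e)" using e v(1) w(1) insert.hyps by auto
    fix \<epsilon> :: real assume eps: "\<epsilon> > 0"
    show "\<exists>N. \<forall>n\<ge>N. \<forall>x\<in>{0..L e}. \<bar>f ((k \<circ> r) n) e x - (w(d := v)) e x\<bar> < \<epsilon>"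
    proof (cases "e = d")
      case True
      then show ?thesis using v(3)[OF eps] by fastforce
    next
      case False
      then obtain N where N: "\<forall>n\<ge>N. \<forall>x\<in>{0..L e}. \<bar>f (k n) e x - w e x\<bar> < \<epsilon>" using w(2)[of e \<epsilon>] e eps by auto
      have "\<forall>n\<ge>N. r n \<ge> N" using seq_suble[OF v(2)] by (meson le_trans)
      then show ?thesis using N False by auto
    qed
  qed
qed

text \<open>The variational theory is developed once in this locale and then instantiated both for
  the glued graph and for each pendant.\<close>

locale finite_graph =
  fixes G :: "('v, 'e) metric_graph"
  assumes finite_edges: "finite (Edges G)"
    and len_pos: "e \<in> Edges G \<Longrightarrow> 0 < len G e"
begin

abbreviation "V \<equiv> form_domain G"
abbreviation "a \<equiv> dirichlet_form G"
abbreviation "b \<equiv> L2_inner G"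
abbreviation "D u e \<equiv> weak_deriv (len G e) (u e)"
abbreviation "Leb e \<equiv> lebesgue_on {0..len G e}"

lemma form_domain_weak_deriv:
  assumes "u \<in> V" "e \<in> Edges G"
  shows "has_weak_deriv (len G e) (u e) (D u e)"
proof -
  obtain g where "has_weak_deriv (len G e) (u e) g" using assms unfolding form_domain_def by blast
  then show ?thesis unfolding weak_deriv_def by (rule someI[where P = "has_weak_deriv (len G e) (u e)"])
qed

lemma form_domain_outside:
  "u \<in> V \<Longrightarrow> \<not> (e \<in> Edges G \<and> 0 \<le> x \<and> x \<le> len G e) \<Longrightarrow> u e x = 0"
  unfolding form_domain_def by blast

lemma form_domainE:
  assumes "u \<in> V"
  obtains \<phi> where "\<And>e. e \<in> Edges G \<Longrightarrow> u e 0 = \<phi> (tail (skel G) e)"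
    "\<And>e. e \<in> Edges G \<Longrightarrow> u e (len G e) = \<phi> (head (skel G) e)" "\<And>v. v \<in> dirichlet G \<Longrightarrow> \<phi> v = 0"
  using assms unfolding form_domain_def by blast

lemma form_domainI:
  assumes "\<And>e x. \<not> (e \<in> Edges G \<and> 0 \<le> x \<and> x \<le> len G e) \<Longrightarrow> u e x = 0"
    and "\<And>e. e \<in> Edges G \<Longrightarrow> has_weak_deriv (len G e) (u e) (g e)"
    and "\<And>e. e \<in> Edges G \<Longrightarrow> u e 0 = \<phi> (tail (skel G) e)"
    and "\<And>e. e \<in> Edges G \<Longrightarrow> u e (len G e) = \<phi> (head (skel G) e)"
    and "\<And>v. v \<in> dirichlet G \<Longrightarrow> \<phi> v = 0"
  shows "u \<in> V"
  unfolding form_domain_def using assms by blast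

lemma L2_form_domain: "u \<in> V \<Longrightarrow> e \<in> Edges G \<Longrightarrow> L2_interval (len G e) (u e)"
  using L2_interval_continuous[OF has_weak_deriv_continuous[OF form_domain_weak_deriv]] .

lemma L2_deriv: "u \<in> V \<Longrightarrow> e \<in> Edges G \<Longrightarrow> L2_interval (len G e) (D u e)"
  using has_weak_deriv_L2[OF form_domain_weak_deriv] .

lemma form_domain_add: assumes "u \<in> V" "v \<in> V" shows "u + v \<in> V"
proof -
  obtain \<phi> where \<phi>: "\<And>e. e \<in> Edges G \<Longrightarrow> u e 0 = \<phi> (tail (skel G) e)"
    "\<And>e. e \<in> Edges G \<Longrightarrow> u e (len G e) = \<phi> (head (skel G) e)" "\<And>v. v \<in> dirichlet G \<Longrightarrow> \<phi> v = 0"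
    using form_domainE[OF assms(1)] by blast
  obtain \<psi> where \<psi>: "\<And>e. e \<in> Edges G \<Longrightarrow> v e 0 = \<psi> (tail (skel G) e)"
    "\<And>e. e \<in> Edges G \<Longrightarrow> v e (len G e) = \<psi> (head (skel G) e)" "\<And>v. v \<in> dirichlet G \<Longrightarrow> \<psi> v = 0"
    using form_domainE[OF assms(2)] by blast
  show ?thesis
  proof (rule form_domainI[where \<phi> = "\<lambda>x. \<phi> x + \<psi> x"])
    show "has_weak_deriv (len G e) ((u + v) e) (\<lambda>x. D u e x + D v e x)" if "e \<in> Edges G" for e
      using has_weak_deriv_add[OF assms[THEN form_domain_weak_deriv[OF _ that]]]
      by (simp add: plus_fun_def)
    show "(u + v) e x = 0" if "\<not> (e \<in> Edges G \<and> 0 \<le> x \<and> x \<le> len G e)" for e x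
      using form_domain_outside[OF assms(1) that] form_domain_outside[OF assms(2) that] by simp
  qed (use \<phi> \<psi> in auto)
qed

lemma form_domain_scale: assumes "u \<in> V" shows "scale_fun c u \<in> V"
proof -
  obtain \<phi> where \<phi>: "\<And>e. e \<in> Edges G \<Longrightarrow> u e 0 = \<phi> (tail (skel G) e)"
    "\<And>e. e \<in> Edges G \<Longrightarrow> u e (len G e) = \<phi> (head (skel G) e)" "\<And>v. v \<in> dirichlet G \<Longrightarrow> \<phi> v = 0"
    using form_domainE[OF assms(1)] by blast
  show ?thesis
  proof (rule form_domainI[where \<phi> = "\<lambda>x. c * \<phi> x"])
    show "has_weak_deriv (len G e) (scale_fun c u e) (\<lambda>x. c * D u e x)" if "e \<in> Edges G" for e
      using has_weak_deriv_cmult[OF form_domain_weak_deriv[OF assms that]]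
      by (simp add: scale_fun_def)
    show "scale_fun c u e x = 0" if "\<not> (e \<in> Edges G \<and> 0 \<le> x \<and> x \<le> len G e)" for e x
      using form_domain_outside[OF assms that] by (simp add: scale_fun_def)
  qed (use \<phi> in \<open>auto simp: scale_fun_def\<close>)
qed

lemma zero_form_domain: "(\<lambda>e x. 0) \<in> V"
  by (rule form_domainI[where \<phi> = "\<lambda>_. 0" and g = "\<lambda>_ _. 0"]) (auto intro: has_weak_deriv_const)

lemma dirichlet_form_eq:
  assumes "\<And>e. e \<in> Edges G \<Longrightarrow> has_weak_deriv (len G e) (u e) (g e)"
    "\<And>e. e \<in> Edges G \<Longrightarrow> has_weak_deriv (len G e) (v e) (h e)"
  shows "a u v = (\<Sum>e\<in>Edges G. integral\<^sup>L (Leb e) (\<lambda>x. g e x * h e x))"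
  unfolding dirichlet_form_def
proof (rule sum.cong[OF refl])
  fix e assume e: "e \<in> Edges G"
  show "integral\<^sup>L (Leb e) (\<lambda>x. D u e x * D v e x) = integral\<^sup>L (Leb e) (\<lambda>x. g e x * h e x)"
    using weak_deriv_integral_eq[OF assms(1)[OF e] assms(2)[OF e]] len_pos[OF e] by simp
qed

lemma a_sym: "a u v = a v u" unfolding dirichlet_form_def by (simp add: mult.commute)

lemma b_sym: "b u v = b v u" unfolding L2_inner_def by (simp add: mult.commute)

lemma a_add: assumes "u \<in> V" "v \<in> V" "w \<in> V" shows "a (u + v) w = a u w + a v w"
proof -
  have "a (u + v) w = (\<Sum>e\<in>Edges G. integral\<^sup>L (Leb e) (\<lambda>x. (D u e x + D v e x) * D w e x))"
    by (rule dirichlet_form_eq)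
      (use has_weak_deriv_add assms form_domain_weak_deriv in \<open>force simp: plus_fun_def\<close>)+
  also have "\<dots> = (\<Sum>e\<in>Edges G. integral\<^sup>L (Leb e) (\<lambda>x. D u e x * D w e x) + integral\<^sup>L (Leb e) (\<lambda>x. D v e x * D w e x))"
    unfolding distrib_right
    by (intro sum.cong Bochner_Integration.integral_add L2_interval_mult_integrable L2_deriv assms refl)
  finally show ?thesis by (simp add: dirichlet_form_def sum.distrib)
qed

lemma a_scale: assumes "u \<in> V" "v \<in> V" shows "a (scale_fun c u) v = c * a u v"
proof -
  have "a (scale_fun c u) v = (\<Sum>e\<in>Edges G. integral\<^sup>L (Leb e) (\<lambda>x. (c * D u e x) * D v e x))"
    by (rule dirichlet_form_eq)
      (use has_weak_deriv_cmult assms form_domain_weak_deriv in \<open>force simp: scale_fun_def\<close>)+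
  then show ?thesis by (simp add: dirichlet_form_def sum_distrib_left mult.assoc)
qed

lemma b_add: assumes "u \<in> V" "v \<in> V" "w \<in> V" shows "b (u + v) w = b u w + b v w"
proof -
  have "b (u + v) w = (\<Sum>e\<in>Edges G. integral\<^sup>L (Leb e) (\<lambda>x. u e x * w e x) + integral\<^sup>L (Leb e) (\<lambda>x. v e x * w e x))"
    unfolding L2_inner_def plus_fun_def distrib_right
    by (intro sum.cong Bochner_Integration.integral_add L2_interval_mult_integrable L2_form_domain assms refl)
  then show ?thesis by (simp add: L2_inner_def sum.distrib)
qed

lemma b_scale: "b (scale_fun c u) v = c * b u v"
  by (simp add: L2_inner_def scale_fun_def sum_distrib_left mult.assoc)

lemma a_nonneg: "0 \<le> a u u"
  unfolding dirichlet_form_def by (intro sum_nonneg Bochner_Integration.integral_nonneg) simp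

lemma b_nonneg: "0 \<le> b u u"
  unfolding L2_inner_def by (intro sum_nonneg Bochner_Integration.integral_nonneg) simp

lemma edge_zero_if_norm_zero:
  assumes u: "u \<in> V" and e: "e \<in> Edges G" and z: "integral\<^sup>L (Leb e) (\<lambda>x. u e x * u e x) = 0"
    and x: "0 \<le> x" "x \<le> len G e"
  shows "u e x = 0"
proof -
  have c: "continuous_on {0..len G e} (\<lambda>x. u e x * u e x)"
    using has_weak_deriv_continuous[OF form_domain_weak_deriv[OF u e]] by (intro continuous_intros)
  have "integral {0..len G e} (\<lambda>x. u e x * u e x) = 0"
    using L2_interval_mult_integrable_on(3)[OF L2_form_domain[OF u e] L2_form_domain[OF u e], of 0 "len G e"] z by simp
  then have "\<forall>x\<in>{0..len G e}. u e x * u e x = 0"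
    using integral_eq_0_iff[of 0 "len G e" "\<lambda>x. u e x * u e x"] c len_pos[OF e] by simp
  then show ?thesis using x by auto
qed

lemma b_zero_imp:
  assumes u: "u \<in> V" "b u u = 0"
  shows "u = (\<lambda>e x. 0)"
proof (intro ext)
  fix e x
  show "u e x = 0"
  proof (cases "e \<in> Edges G \<and> 0 \<le> x \<and> x \<le> len G e")
    case True
    then have e: "e \<in> Edges G" by simp
    have "integral\<^sup>L (Leb e) (\<lambda>x. u e x * u e x) = 0"
      using u(2) e unfolding L2_inner_def
      by (subst (asm) sum_nonneg_eq_0_iff) (auto simp: finite_edges intro!: Bochner_Integration.integral_nonneg)
    then show ?thesis using edge_zero_if_norm_zero[OF u(1) e] True by blast
  qed (use form_domain_outside[OF u(1)] in blast)
qed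

lemma b_pos: "u \<in> V \<Longrightarrow> u \<noteq> (\<lambda>e x. 0) \<Longrightarrow> 0 < b u u"
  using b_zero_imp b_nonneg[of u] by fastforce

end

text \<open>Stated for a general semidefinite form on a set \<open>W\<close>, because it is applied
  to the Dirichlet form, to the inner product and to \<open>a - \<mu> b\<close>; the last is
  nonnegative only on a suitable \<open>W\<close>.\<close>

lemma psd_form_Cauchy_Schwarz:
  fixes q :: "('e \<Rightarrow> real \<Rightarrow> real) \<Rightarrow> ('e \<Rightarrow> real \<Rightarrow> real) \<Rightarrow> real"
  assumes W: "\<And>u v. u \<in> W \<Longrightarrow> v \<in> W \<Longrightarrow> u + v \<in> W" "\<And>c u. u \<in> W \<Longrightarrow> scale_fun c u \<in> W"
    and sym: "\<And>u v. q u v = q v u"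
    and add: "\<And>u v w. u \<in> W \<Longrightarrow> v \<in> W \<Longrightarrow> w \<in> W \<Longrightarrow> q (u + v) w = q u w + q v w"
    and scale: "\<And>c u v. u \<in> W \<Longrightarrow> v \<in> W \<Longrightarrow> q (scale_fun c u) v = c * q u v"
    and nonneg: "\<And>u. u \<in> W \<Longrightarrow> 0 \<le> q u u"
    and u: "u \<in> W" and v: "v \<in> W"
  shows "(q u v)\<^sup>2 \<le> q u u * q v v"
proof -
  have quad: "0 \<le> q u u + 2 * t * q u v + t\<^sup>2 * q v v" for t
  proof -
    have tv: "scale_fun t v \<in> W" using W v by blast
    then have utv: "u + scale_fun t v \<in> W" using W u by blast
    have "q (u + scale_fun t v) (u + scale_fun t v) = q u (u + scale_fun t v) + t * q v (u + scale_fun t v)"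
      using add[OF u tv utv] scale[OF v utv] by simp
    also have "q u (u + scale_fun t v) = q u u + t * q u v"
      using sym[of u "u + scale_fun t v"] add[OF u tv u] scale[OF v u, of t] sym[of u v] by simp
    also have "q v (u + scale_fun t v) = q u v + t * q v v"
      using sym[of v "u + scale_fun t v"] add[OF u tv v] scale[OF v v, of t] by simp
    finally have "q (u + scale_fun t v) (u + scale_fun t v) = q u u + t * q u v + t * (q u v + t * q v v)" .
    with nonneg[OF utv] have "0 \<le> q u u + t * q u v + t * (q u v + t * q v v)" by (simp only:)
    then show ?thesis by (simp add: power2_eq_square algebra_simps)
  qed
  show ?thesis
  proof (cases "q v v = 0")
    case True
    have "q u v = 0"
    proof (rule ccontr)
      assume n: "q u v \<noteq> 0"
      \<comment> \<open>At this value of \<open>t\<close> the nonnegative quadratic would equal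
        -1.\<close>
      have "2 * (- (q u u + 1) / (2 * q u v)) * q u v = - (q u u + 1)" using n by simp
      then show False using quad[of "- (q u u + 1) / (2 * q u v)"] True by simp
    qed
    then show ?thesis using True by simp
  next
    case False
    then have p: "q v v > 0" using nonneg[OF v] by simp
    have "0 \<le> q u u + 2 * (- q u v / q v v) * q u v + (- q u v / q v v)\<^sup>2 * q v v" by (rule quad)
    also have "\<dots> = q u u - (q u v)\<^sup>2 / q v v" using p by (simp add: power2_eq_square field_simps)
    finally have "(q u v)\<^sup>2 / q v v \<le> q u u" by simp
    then show ?thesis using p pos_divide_le_eq by blast
  qed
qed

section \<open>Existence of minimizers\<close>

text \<open>Written with \<open>+\<close> and \<open>scale_fun\<close> only, so that closure under
  these two operations covers differences.\<close>

definition dif :: "('e \<Rightarrow> real \<Rightarrow> real) \<Rightarrow> ('e \<Rightarrow> real \<Rightarrow> real) \<Rightarrow> 'e \<Rightarrow> real \<Rightarrow> real" where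
  "dif u v = u + scale_fun (- 1) v"

lemma dif_apply: "dif u v e x = u e x - v e x"
  by (simp add: dif_def scale_fun_def)

text \<open>Cauchy-Schwarz passes from convergence in the seminorm of \<open>q\<close> to
  convergence of pairings; expanding \<open>q (s n) (s n)\<close> around \<open>w\<close> then gives
  the squares.\<close>

lemma psd_form_tendsto:
  fixes q :: "('e \<Rightarrow> real \<Rightarrow> real) \<Rightarrow> ('e \<Rightarrow> real \<Rightarrow> real) \<Rightarrow> real"
  assumes W: "\<And>u v. u \<in> W \<Longrightarrow> v \<in> W \<Longrightarrow> u + v \<in> W" "\<And>c u. u \<in> W \<Longrightarrow> scale_fun c u \<in> W"
    and sym: "\<And>u v. q u v = q v u"
    and add: "\<And>u v w. u \<in> W \<Longrightarrow> v \<in> W \<Longrightarrow> w \<in> W \<Longrightarrow> q (u + v) w = q u w + q v w"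
    and scale: "\<And>c u v. u \<in> W \<Longrightarrow> v \<in> W \<Longrightarrow> q (scale_fun c u) v = c * q u v"
    and nonneg: "\<And>u. u \<in> W \<Longrightarrow> 0 \<le> q u u"
    and s: "\<And>n. s n \<in> W" and w: "w \<in> W"
    and lim: "(\<lambda>n. q (dif (s n) w) (dif (s n) w)) \<longlonglongrightarrow> 0"
  shows "v \<in> W \<Longrightarrow> (\<lambda>n. q (s n) v) \<longlonglongrightarrow> q w v" "(\<lambda>n. q (s n) (s n)) \<longlonglongrightarrow> q w w"
proof -
  define d where "d n = dif (s n) w" for n
  have d: "d n \<in> W" for n unfolding d_def dif_def by (intro W s w)
  have sd: "s n = w + d n" for n
    by (intro ext) (simp add: d_def dif_def scale_fun_def)
  have lim': "(\<lambda>n. q (d n) (d n)) \<longlonglongrightarrow> 0" using lim by (simp add: d_def)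
  have small: "(\<lambda>n. q (d n) v) \<longlonglongrightarrow> 0" if v: "v \<in> W" for v
  proof (rule Lim_null_comparison)
    show "\<forall>\<^sub>F n in sequentially. norm (q (d n) v) \<le> sqrt (q (d n) (d n) * q v v)"
      using psd_form_Cauchy_Schwarz[where W = W and q = q, OF W sym add scale nonneg d v]
      by (intro always_eventually allI) (auto intro!: real_le_rsqrt)
    show "(\<lambda>n. sqrt (q (d n) (d n) * q v v)) \<longlonglongrightarrow> 0"
      using tendsto_real_sqrt[OF tendsto_mult_left_zero[OF lim', of "q v v"]] by simp
  qed
  show *: "(\<lambda>n. q (s n) v) \<longlonglongrightarrow> q w v" if v: "v \<in> W" for v
  proof -
    have "(\<lambda>n. q w v + q (d n) v) \<longlonglongrightarrow> q w v + 0" by (intro tendsto_intros small v)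
    then show ?thesis unfolding sd using add[OF w d v] by simp
  qed
  have "q (s n) (s n) = q (s n) w + (q (d n) w + q (d n) (d n))" for n
  proof -
    have "q (s n) (s n) = q w (s n) + q (d n) (s n)" using add[OF w d s, of n n] sd by metis
    moreover have "q (d n) (s n) = q w (d n) + q (d n) (d n)"
      using add[OF w d d, of n n] sd[of n] sym by metis
    ultimately show ?thesis using sym by simp
  qed
  moreover have "(\<lambda>n. q (s n) w + (q (d n) w + q (d n) (d n))) \<longlonglongrightarrow> q w w + (0 + 0)"
    by (intro tendsto_add * small lim' w)
  ultimately show "(\<lambda>n. q (s n) (s n)) \<longlonglongrightarrow> q w w" by simp
qed

section \<open>The direct method on a finite graph\<close>

context finite_graph
begin

lemma dif_form_domain: "u \<in> V \<Longrightarrow> v \<in> V \<Longrightarrow> dif u v \<in> V"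
  unfolding dif_def by (intro form_domain_add form_domain_scale)

lemma a_tendsto:
  assumes "\<And>n. s n \<in> V" "w \<in> V" "(\<lambda>n. a (dif (s n) w) (dif (s n) w)) \<longlonglongrightarrow> 0"
  shows "(\<lambda>n. a (s n) (s n)) \<longlonglongrightarrow> a w w"
  by (rule psd_form_tendsto(2)[where W = V and q = a])
    (fact form_domain_add form_domain_scale a_sym a_add a_scale | rule a_nonneg | fact assms)+

lemma b_tendsto:
  assumes "\<And>n. s n \<in> V" "w \<in> V" "(\<lambda>n. b (dif (s n) w) (dif (s n) w)) \<longlonglongrightarrow> 0"
  shows "(\<lambda>n. b (s n) (s n)) \<longlonglongrightarrow> b w w" "v \<in> V \<Longrightarrow> (\<lambda>n. b (s n) v) \<longlonglongrightarrow> b w v"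
proof -
  show "(\<lambda>n. b (s n) (s n)) \<longlonglongrightarrow> b w w"
    by (rule psd_form_tendsto(2)[where W = V and q = b])
      (fact form_domain_add form_domain_scale b_sym b_add | rule b_nonneg b_scale | fact assms)+
  show "(\<lambda>n. b (s n) v) \<longlonglongrightarrow> b w v" if "v \<in> V"
    by (rule psd_form_tendsto(1)[where W = V and q = b])
      (fact form_domain_add form_domain_scale b_sym b_add | rule b_nonneg b_scale | fact assms that)+
qed

lemma a_square_add: "u \<in> V \<Longrightarrow> v \<in> V \<Longrightarrow> a (u + v) (u + v) = a u u + 2 * a u v + a v v"
  using a_add[of u v "u + v"] a_add[of u v u] a_add[of u v v] form_domain_add[of u v]
    a_sym[of u "u + v"] a_sym[of v "u + v"] a_sym[of v u] by simp

lemma b_square_add: "u \<in> V \<Longrightarrow> v \<in> V \<Longrightarrow> b (u + v) (u + v) = b u u + 2 * b u v + b v v"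
  using b_add[of u v "u + v"] b_add[of u v u] b_add[of u v v] form_domain_add[of u v]
    b_sym[of u "u + v"] b_sym[of v "u + v"] b_sym[of v u] by simp

lemma a_scale_right: "u \<in> V \<Longrightarrow> v \<in> V \<Longrightarrow> a u (scale_fun c v) = c * a u v"
  using a_scale[of v u c] a_sym by metis

lemma b_scale_right: "b u (scale_fun c v) = c * b u v"
  using b_scale[of c v u] b_sym by metis

lemma a_square_dif: "u \<in> V \<Longrightarrow> v \<in> V \<Longrightarrow> a (dif u v) (dif u v) = a u u - 2 * a u v + a v v"
  unfolding dif_def using a_scale_right[of "scale_fun (- 1) v" v "- 1"] a_scale[of v v "- 1"]
  by (subst a_square_add) (auto simp: form_domain_scale a_scale_right simp del: graph_fun.scale_minus_left)

lemma b_square_dif: "u \<in> V \<Longrightarrow> v \<in> V \<Longrightarrow> b (dif u v) (dif u v) = b u u - 2 * b u v + b v v"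
  unfolding dif_def using b_scale_right[of "scale_fun (- 1) v" "- 1" v] b_scale[of "- 1" v v]
  by (subst b_square_add) (auto simp: form_domain_scale b_scale_right simp del: graph_fun.scale_minus_left)

lemma edge_energy_le:
  assumes "u \<in> V" "e \<in> Edges G"
  shows "integral\<^sup>L (Leb e) (\<lambda>x. (D u e x)\<^sup>2) \<le> a u u" "integral\<^sup>L (Leb e) (\<lambda>x. (u e x)\<^sup>2) \<le> b u u"
  unfolding dirichlet_form_def L2_inner_def power2_eq_square using finite_edges assms(2)
  by (auto intro!: member_le_sum[where f = "\<lambda>e. integral\<^sup>L (Leb e) (\<lambda>x. D u e x * D u e x)"]
    member_le_sum[where f = "\<lambda>e. integral\<^sup>L (Leb e) (\<lambda>x. u e x * u e x)"] Bochner_Integration.integral_nonneg)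

lemma b_le_sup:
  assumes u: "u \<in> V" and le: "\<And>e x. e \<in> Edges G \<Longrightarrow> 0 \<le> x \<Longrightarrow> x \<le> len G e \<Longrightarrow> \<bar>u e x\<bar> \<le> c"
  shows "b u u \<le> c\<^sup>2 * total_length G"
proof -
  have "integral\<^sup>L (Leb e) (\<lambda>x. u e x * u e x) \<le> c\<^sup>2 * len G e" if e: "e \<in> Edges G" for e
  proof -
    have L: "L2_interval (len G e) (u e)" by (rule L2_form_domain[OF u e])
    have "integral {0..len G e} (\<lambda>x. u e x * u e x) \<le> integral {0..len G e} (\<lambda>x. c\<^sup>2)"
    proof (rule integral_le)
      show "(\<lambda>x. u e x * u e x) integrable_on {0..len G e}"
        by (rule L2_interval_mult_integrable_on[OF L L]) auto
      fix x assume "x \<in> {0..len G e}"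
      then have "\<bar>u e x\<bar>\<^sup>2 \<le> c\<^sup>2" using le[OF e] by (intro power_mono) auto
      then show "u e x * u e x \<le> c\<^sup>2" by (simp add: power2_eq_square)
    qed auto
    then show ?thesis
      using L2_interval_mult_integrable_on(3)[OF L L, of 0 "len G e"] len_pos[OF e] by (simp add: mult.commute)
  qed
  then show ?thesis
    unfolding L2_inner_def total_length_def sum_distrib_left by (rule sum_mono)
qed

text \<open>Bounded energy makes the sequence equibounded and equi-Hoelder, so a subsequence
  converges uniformly and hence in L2. The parallelogram identity together with the lower bound on
  \<open>W\<close> upgrades this to the Cauchy property in energy, so that the limit attains
  \<open>\<mu>\<close>. The norms only have to tend to 1, which lets approximations of a ground
  state be fed in later.\<close>

lemma minimizing_sequence:
  assumes WV: "W \<subseteq> V" and W: "\<And>u v. u \<in> W \<Longrightarrow> v \<in> W \<Longrightarrow> u + v \<in> W"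
    and low: "\<And>v. v \<in> W \<Longrightarrow> \<mu> * b v v \<le> a v v"
    and u: "\<And>n. u n \<in> W" and bu: "(\<lambda>n. b (u n) (u n)) \<longlonglongrightarrow> 1" and au: "(\<lambda>n. a (u n) (u n)) \<longlonglongrightarrow> \<mu>"
  obtains w k where "w \<in> V" "strict_mono (k :: nat \<Rightarrow> nat)"
    "\<And>e x. e \<in> Edges G \<Longrightarrow> 0 \<le> x \<Longrightarrow> x \<le> len G e \<Longrightarrow> (\<lambda>n. u (k n) e x) \<longlonglongrightarrow> w e x"
    "a w w = \<mu>" "b w w = 1" "\<And>v. v \<in> V \<Longrightarrow> (\<lambda>n. b (u (k n)) v) \<longlonglongrightarrow> b w v"
proof -
  have uV: "u n \<in> V" for n using u WV by blast
  obtain A where A: "\<And>n. a (u n) (u n) \<le> A"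
    using convergent_imp_Bseq[of "\<lambda>n. a (u n) (u n)"] au unfolding convergent_def Bseq_def
    by (metis abs_le_D1 real_norm_def)
  obtain B where B: "\<And>n. b (u n) (u n) \<le> B"
    using convergent_imp_Bseq[of "\<lambda>n. b (u n) (u n)"] bu unfolding convergent_def Bseq_def
    by (metis abs_le_D1 real_norm_def)
  have bd: "(u n e x)\<^sup>2 \<le> (2 * B + 2 * (len G e)\<^sup>2 * A) / len G e"
    if e: "e \<in> Edges G" and x: "x \<in> {0..len G e}" for n e x
  proof -
    have "len G e * (u n e x)\<^sup>2 \<le> 2 * integral\<^sup>L (Leb e) (\<lambda>t. (u n e t)\<^sup>2)
     + 2 * (len G e)\<^sup>2 * integral\<^sup>L (Leb e) (\<lambda>t. (D (u n) e t)\<^sup>2)"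
      using has_weak_deriv_sup_bound[OF form_domain_weak_deriv[OF uV e]] x by simp
    also have "\<dots> \<le> 2 * B + 2 * (len G e)\<^sup>2 * A"
      using edge_energy_le[OF uV e, of n] A[of n] B[of n] by (intro add_mono mult_left_mono) auto
    finally show ?thesis using len_pos[OF e] by (simp add: pos_le_divide_eq mult.commute)
  qed
  have Hd: "(u n e y - u n e x)\<^sup>2 \<le> \<bar>y - x\<bar> * A"
    if e: "e \<in> Edges G" and x: "x \<in> {0..len G e}" and y: "y \<in> {0..len G e}" for n e x y
  proof -
    have "(u n e y - u n e x)\<^sup>2 \<le> \<bar>y - x\<bar> * integral\<^sup>L (Leb e) (\<lambda>t. (D (u n) e t)\<^sup>2)"
      by (rule has_weak_deriv_Hoelder_half[OF form_domain_weak_deriv[OF uV e] x y])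
    also have "\<dots> \<le> \<bar>y - x\<bar> * A"
      using edge_energy_le(1)[OF uV e, of n] A[of n] by (intro mult_left_mono) auto
    finally show ?thesis .
  qed
  have "\<exists>k w. strict_mono (k :: nat \<Rightarrow> nat) \<and>
    (\<forall>e\<in>Edges G. continuous_on {0..len G e} (w e) \<and>
      (\<forall>\<epsilon>>0. \<exists>N. \<forall>n\<ge>N. \<forall>x\<in>{0..len G e}. \<bar>u (k n) e x - w e x\<bar> < \<epsilon>))"
    by (rule uniform_limit_subseq_edges[OF finite_edges bd Hd])
  then obtain k w0 where k: "strict_mono (k :: nat \<Rightarrow> nat)"
    and w0: "\<And>e \<epsilon>. e \<in> Edges G \<Longrightarrow> \<epsilon> > 0 \<Longrightarrow> \<exists>N. \<forall>n\<ge>N. \<forall>x\<in>{0..len G e}. \<bar>u (k n) e x - w0 e x\<bar> < \<epsilon>"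
    by metis
  define w where "w e x = (if e \<in> Edges G \<and> 0 \<le> x \<and> x \<le> len G e then w0 e x else 0)" for e x
  define s where "s n = u (k n)" for n
  have sW: "s n \<in> W" and sV: "s n \<in> V" for n using u uV by (auto simp: s_def)
  have sa: "(\<lambda>n. a (s n) (s n)) \<longlonglongrightarrow> \<mu>" and sb: "(\<lambda>n. b (s n) (s n)) \<longlonglongrightarrow> 1"
    unfolding s_def using LIMSEQ_subseq_LIMSEQ[OF au k] LIMSEQ_subseq_LIMSEQ[OF bu k] by (simp_all add: o_def)
  have unif: "\<exists>N. \<forall>n\<ge>N. \<forall>e\<in>Edges G. \<forall>x\<in>{0..len G e}. \<bar>s n e x - w e x\<bar> < \<epsilon>" if "\<epsilon> > 0" for \<epsilon>
  proof -
    have "\<forall>e\<in>Edges G. \<forall>\<^sub>F n in sequentially. \<forall>x\<in>{0..len G e}. \<bar>s n e x - w e x\<bar> < \<epsilon>"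
      using w0[OF _ that] by (auto simp: eventually_sequentially s_def w_def)
    from eventually_ball_finite[OF finite_edges this] show ?thesis
      unfolding eventually_sequentially .
  qed
  have ptw: "(\<lambda>n. s n e x) \<longlonglongrightarrow> w e x" if "e \<in> Edges G" "0 \<le> x" "x \<le> len G e" for e x
    using unif that by (intro LIMSEQ_I) (metis atLeastAtMost_iff real_norm_def)
  let ?L = "total_length G"
  have L0: "0 \<le> ?L" unfolding total_length_def using len_pos by (intro sum_nonneg) (auto intro: less_imp_le)
  have a_dif: "a (dif x y) (dif x y) = (\<Sum>e\<in>Edges G. integral\<^sup>L (Leb e) (\<lambda>t. (D x e t - g e t)\<^sup>2))"
    if x: "x \<in> V" and y: "\<And>e. e \<in> Edges G \<Longrightarrow> has_weak_deriv (len G e) (y e) (g e)" for x y g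
  proof -
    have "has_weak_deriv (len G e) (dif x y e) (\<lambda>t. D x e t - g e t)" if e: "e \<in> Edges G" for e
      using has_weak_deriv_add[OF form_domain_weak_deriv[OF x e] has_weak_deriv_cmult[OF y[OF e], of "- 1"]]
      by (simp add: dif_def plus_fun_def scale_fun_def)
    then show ?thesis
      using dirichlet_form_eq[of "dif x y" "\<lambda>e t. D x e t - g e t" "dif x y" "\<lambda>e t. D x e t - g e t"]
      by (simp add: power2_eq_square)
  qed
  define \<delta> where "\<delta> n = a (s n) (s n) - \<mu> * b (s n) (s n)" for n
  have \<delta>: "\<delta> \<longlonglongrightarrow> 0"
    unfolding \<delta>_def using tendsto_diff[OF sa tendsto_mult[OF tendsto_const[of \<mu>] sb]] by simp
  \<comment> \<open>The parallelogram identity for \<open>a\<close> and \<open>b\<close>, with the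
    lower bound applied to \<open>s i + s j\<close>; here \<open>\<delta>\<close> measures how far a
    member is from being a minimiser.\<close>
  have par: "a (dif (s i) (s j)) (dif (s i) (s j)) \<le> 2 * \<delta> i + 2 * \<delta> j + \<mu> * b (dif (s i) (s j)) (dif (s i) (s j))" for i j
  proof -
    have "\<mu> * b (s i + s j) (s i + s j) \<le> a (s i + s j) (s i + s j)" by (intro low W sW)
    then show ?thesis
      unfolding \<delta>_def a_square_dif[OF sV sV] b_square_dif[OF sV sV] a_square_add[OF sV sV] b_square_add[OF sV sV]
      by (simp add: algebra_simps)
  qed
  have cauchy: "\<exists>N. \<forall>i\<ge>N. \<forall>j\<ge>N. a (dif (s i) (s j)) (dif (s i) (s j)) < \<epsilon>" if e: "\<epsilon> > 0" for \<epsilon>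
  proof -
    \<comment> \<open>With \<open>c\<^sup>2 * K = \<epsilon> / 4\<close> the norm term in
      \<open>par\<close> costs at most \<epsilon>/4, and the two doubled defects together less than
      \<epsilon>/2. The added 1 keeps \<open>K\<close> positive.\<close>
    define K where "K = \<bar>\<mu>\<bar> * ?L + 1"
    define c where "c = sqrt (\<epsilon> / (4 * K))"
    have pos: "K > 0" using L0 by (simp add: K_def add_nonneg_pos)
    then have c: "c > 0" "c\<^sup>2 = \<epsilon> / (4 * K)" using e by (auto simp: c_def)
    obtain N1 where N1: "\<And>n. n \<ge> N1 \<Longrightarrow> \<bar>\<delta> n\<bar> < \<epsilon> / 8" using LIMSEQ_D[OF \<delta>, of "\<epsilon>/8"] e by auto
    obtain N2 where N2: "\<And>n e x. n \<ge> N2 \<Longrightarrow> e \<in> Edges G \<Longrightarrow> x \<in> {0..len G e} \<Longrightarrow> \<bar>s n e x - w e x\<bar> < c / 2"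
      using unif[of "c / 2"] c(1) half_gt_zero by blast
    have "a (dif (s i) (s j)) (dif (s i) (s j)) < \<epsilon>" if ij: "i \<ge> max N1 N2" "j \<ge> max N1 N2" for i j
    proof -
      have "b (dif (s i) (s j)) (dif (s i) (s j)) \<le> c\<^sup>2 * ?L"
      proof (rule b_le_sup[OF dif_form_domain[OF sV sV]])
        fix e x assume "e \<in> Edges G" "0 \<le> x" "x \<le> len G e"
        then show "\<bar>dif (s i) (s j) e x\<bar> \<le> c"
          using N2[of i e x] N2[of j e x] ij unfolding dif_apply by (simp add: abs_if split: if_splits)
      qed
      then have "\<bar>\<mu>\<bar> * b (dif (s i) (s j)) (dif (s i) (s j)) \<le> \<bar>\<mu>\<bar> * (c\<^sup>2 * ?L)" by (rule mult_left_mono) simp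
      moreover have "\<mu> * b (dif (s i) (s j)) (dif (s i) (s j)) \<le> \<bar>\<mu>\<bar> * b (dif (s i) (s j)) (dif (s i) (s j))"
        using b_nonneg by (intro mult_right_mono) auto
      moreover have "\<bar>\<mu>\<bar> * (c\<^sup>2 * ?L) \<le> \<epsilon> / 4"
      proof -
        have "\<bar>\<mu>\<bar> * (c\<^sup>2 * ?L) = c\<^sup>2 * (\<bar>\<mu>\<bar> * ?L)" by simp
        also have "\<dots> \<le> c\<^sup>2 * K" unfolding K_def by (intro mult_left_mono) auto
        also have "\<dots> = \<epsilon> / 4" unfolding c(2) using pos by simp
        finally show ?thesis .
      qed
      ultimately show ?thesis using par[of i j] N1[of i] N1[of j] ij e by (simp add: abs_if split: if_splits)
    qed
    then show ?thesis by blast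
  qed
  have "\<forall>e\<in>Edges G. \<exists>h. L2_interval (len G e) h \<and> (\<lambda>n. integral\<^sup>L (Leb e) (\<lambda>x. (D (s n) e x - h x)\<^sup>2)) \<longlonglongrightarrow> 0"
  proof
    fix e assume e: "e \<in> Edges G"
    have ce: "\<exists>N. \<forall>i\<ge>N. \<forall>j\<ge>N. integral\<^sup>L (Leb e) (\<lambda>x. (D (s i) e x - D (s j) e x)\<^sup>2) < \<epsilon>" if eps: "\<epsilon> > 0" for \<epsilon>
    proof -
      have "integral\<^sup>L (Leb e) (\<lambda>x. (D (s i) e x - D (s j) e x)\<^sup>2) \<le> a (dif (s i) (s j)) (dif (s i) (s j))" for i j
      proof -
        have "a (dif (s i) (s j)) (dif (s i) (s j)) = (\<Sum>e\<in>Edges G. integral\<^sup>L (Leb e) (\<lambda>x. (D (s i) e x - D (s j) e x)\<^sup>2))"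
          by (rule a_dif[OF sV form_domain_weak_deriv[OF sV]])
        then show ?thesis
          using finite_edges e by (auto intro!: member_le_sum[where f = "\<lambda>e. integral\<^sup>L (Leb e) (\<lambda>x. (D (s i) e x - D (s j) e x)\<^sup>2)"]
          Bochner_Integration.integral_nonneg)
      qed
      then show ?thesis using cauchy[OF eps] by (meson le_less_trans)
    qed
    show "\<exists>h. L2_interval (len G e) h \<and> (\<lambda>n. integral\<^sup>L (Leb e) (\<lambda>x. (D (s n) e x - h x)\<^sup>2)) \<longlonglongrightarrow> 0"
      using L2_interval_complete[OF L2_deriv[OF sV e] less_imp_le[OF len_pos[OF e]] ce] by blast
  qed
  from bchoice[OF this] obtain h where "\<forall>e\<in>Edges G. L2_interval (len G e) (h e) \<and>
    (\<lambda>n. integral\<^sup>L (Leb e) (\<lambda>x. (D (s n) e x - h e x)\<^sup>2)) \<longlonglongrightarrow> 0" by blast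
  then have h: "\<And>e. e \<in> Edges G \<Longrightarrow> L2_interval (len G e) (h e)"
    "\<And>e. e \<in> Edges G \<Longrightarrow> (\<lambda>n. integral\<^sup>L (Leb e) (\<lambda>x. (D (s n) e x - h e x)\<^sup>2)) \<longlonglongrightarrow> 0"
    by blast+
  have wh: "has_weak_deriv (len G e) (w e) (h e)" if e: "e \<in> Edges G" for e
    using has_weak_deriv_limit[OF form_domain_weak_deriv[OF sV e] h(1)[OF e] _ h(2)[OF e] ptw[OF e]] len_pos[OF e] by simp
  have "\<exists>\<phi>. (\<forall>e\<in>Edges G. s n e 0 = \<phi> (tail (skel G) e) \<and> s n e (len G e) = \<phi> (head (skel G) e)) \<and>
          (\<forall>v\<in>dirichlet G. \<phi> v = 0)" for n
    using sV[of n] unfolding form_domain_def by blast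
  then obtain \<phi> where \<phi>: "\<And>n e. e \<in> Edges G \<Longrightarrow> s n e 0 = \<phi> n (tail (skel G) e)"
    "\<And>n e. e \<in> Edges G \<Longrightarrow> s n e (len G e) = \<phi> n (head (skel G) e)" "\<And>n v. v \<in> dirichlet G \<Longrightarrow> \<phi> n v = 0"
    by metis
  \<comment> \<open>The vertex values of \<open>w\<close> are limits of vertex values. They converge
    at the ends of edges by \<open>ptw\<close> and at Dirichlet vertices because they are constantly
    0; at other vertices \<open>lim\<close> may be arbitrary, since the form domain imposes no
    condition there.\<close>
  have wV: "w \<in> V"
  proof (rule form_domainI[OF _ wh, where \<phi> = "\<lambda>v. lim (\<lambda>n. \<phi> n v)"])
    show "w e 0 = lim (\<lambda>n. \<phi> n (tail (skel G) e))" if e: "e \<in> Edges G" for e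
      using ptw[OF e, of 0] len_pos[OF e] \<phi>(1)[OF e] by (simp add: limI)
    show "w e (len G e) = lim (\<lambda>n. \<phi> n (head (skel G) e))" if e: "e \<in> Edges G" for e
      using ptw[OF e, of "len G e"] len_pos[OF e] \<phi>(2)[OF e] by (simp add: limI)
    show "lim (\<lambda>n. \<phi> n v) = 0" if "v \<in> dirichlet G" for v
      using \<phi>(3)[OF that] by (simp add: limI)
  qed (auto simp: w_def)
  have "(\<lambda>n. a (dif (s n) w) (dif (s n) w)) \<longlonglongrightarrow> (\<Sum>e\<in>Edges G. 0)"
    by (simp only: a_dif[where y = w and g = h, OF sV wh]) (rule tendsto_sum, rule h(2))
  then have a0: "(\<lambda>n. a (dif (s n) w) (dif (s n) w)) \<longlonglongrightarrow> 0" by simp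
  have b0: "(\<lambda>n. b (dif (s n) w) (dif (s n) w)) \<longlonglongrightarrow> 0"
  proof (rule LIMSEQ_I)
    fix \<epsilon> :: real assume e: "\<epsilon> > 0"
    define c where "c = sqrt (\<epsilon> / (?L + 1))"
    have c: "c > 0" "c\<^sup>2 = \<epsilon> / (?L + 1)" using e L0 by (auto simp: c_def)
    obtain N where N: "\<And>n e x. n \<ge> N \<Longrightarrow> e \<in> Edges G \<Longrightarrow> x \<in> {0..len G e} \<Longrightarrow> \<bar>s n e x - w e x\<bar> < c"
      using unif[of c] c(1) by blast
    have "b (dif (s n) w) (dif (s n) w) < \<epsilon>" if n: "n \<ge> N" for n
    proof -
      have "b (dif (s n) w) (dif (s n) w) \<le> c\<^sup>2 * ?L"
        using N[OF n] by (intro b_le_sup dif_form_domain sV wV) (auto simp: dif_apply less_imp_le)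
      also have "\<dots> < \<epsilon>" using e L0 unfolding c(2) by (simp add: field_simps)
      finally show ?thesis .
    qed
    then show "\<exists>no. \<forall>n\<ge>no. norm (b (dif (s n) w) (dif (s n) w) - 0) < \<epsilon>"
      using b_nonneg by (intro exI[of _ N]) (auto simp: abs_of_nonneg)
  qed
  have "a w w = \<mu>" by (rule LIMSEQ_unique[OF a_tendsto[where s = s, OF sV wV a0] sa])
  moreover have "b w w = 1" by (rule LIMSEQ_unique[OF b_tendsto(1)[where s = s, OF sV wV b0] sb])
  moreover have "(\<lambda>n. b (s n) v) \<longlonglongrightarrow> b w v" if "v \<in> V" for v
    by (rule b_tendsto(2)[where s = s, OF sV wV b0 that])
  ultimately show ?thesis using that[OF wV k] ptw unfolding s_def by blast
qed

text \<open>The form \<open>a - \<mu> b\<close> is semidefinite on \<open>W\<close> and vanishes at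
  the pair \<open>w\<close>, \<open>w\<close>; Cauchy-Schwarz makes it vanish at \<open>w\<close>,
  \<open>v\<close> for every \<open>v\<close>.\<close>

lemma minimizer_Euler_Lagrange:
  assumes WV: "W \<subseteq> V" and W: "\<And>u v. u \<in> W \<Longrightarrow> v \<in> W \<Longrightarrow> u + v \<in> W" "\<And>c u. u \<in> W \<Longrightarrow> scale_fun c u \<in> W"
    and low: "\<And>v. v \<in> W \<Longrightarrow> \<mu> * b v v \<le> a v v"
    and w: "w \<in> W" "a w w = \<mu> * b w w" and v: "v \<in> W"
  shows "a w v = \<mu> * b w v"
proof -
  have V: "x \<in> V" if "x \<in> W" for x using that WV by blast
  have "(a w v - \<mu> * b w v)\<^sup>2 \<le> (a w w - \<mu> * b w w) * (a v v - \<mu> * b v v)"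
  proof (rule psd_form_Cauchy_Schwarz[where W = W and q = "\<lambda>x y. a x y - \<mu> * b x y"])
    show "a x y - \<mu> * b x y = a y x - \<mu> * b y x" for x y using a_sym b_sym by metis
    show "a (x + y) z - \<mu> * b (x + y) z = a x z - \<mu> * b x z + (a y z - \<mu> * b y z)"
      if "x \<in> W" "y \<in> W" "z \<in> W" for x y z
      using that[THEN V] by (simp add: a_add b_add algebra_simps)
    show "a (scale_fun c x) y - \<mu> * b (scale_fun c x) y = c * (a x y - \<mu> * b x y)"
      if "x \<in> W" "y \<in> W" for c x y
      using that[THEN V] by (simp add: a_scale b_scale algebra_simps)
    show "0 \<le> a x x - \<mu> * b x x" if "x \<in> W" for x using low[OF that] by simp
  qed (use W w v in blast)+
  then show ?thesis using w by simp
qed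

text \<open>Used with \<open>W = V\<close> for the first eigenvalue and with the orthogonal
  complement of a ground state for the second. Closedness is phrased through pairings with
  \<open>b\<close>, a mode of convergence that \<open>minimizing_sequence\<close> provides and that
  visibly preserves orthogonality.\<close>

lemma Rayleigh_minimizer:
  assumes WV: "W \<subseteq> V" and W: "\<And>u v. u \<in> W \<Longrightarrow> v \<in> W \<Longrightarrow> u + v \<in> W" "\<And>c u. u \<in> W \<Longrightarrow> scale_fun c u \<in> W"
    and closed: "\<And>s w. (\<And>n :: nat. s n \<in> W) \<Longrightarrow> w \<in> V \<Longrightarrow> (\<And>v. v \<in> V \<Longrightarrow> (\<lambda>n. b (s n) v) \<longlonglongrightarrow> b w v) \<Longrightarrow> w \<in> W"
    and v0: "v0 \<in> W" "v0 \<noteq> (\<lambda>e x. 0)"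
  obtains w \<mu> where "w \<in> W" "b w w = 1" "\<And>v. v \<in> W \<Longrightarrow> \<mu> * b v v \<le> a v v"
    "\<And>v. v \<in> W \<Longrightarrow> a w v = \<mu> * b w v"
proof -
  define R where "R = {a v v |v. v \<in> W \<and> b v v = 1}"
  define \<mu> where "\<mu> = Inf R"
  have norm: "scale_fun (1 / sqrt (b v v)) v \<in> W \<and> b (scale_fun (1 / sqrt (b v v)) v) (scale_fun (1 / sqrt (b v v)) v) = 1
     \<and> a (scale_fun (1 / sqrt (b v v)) v) (scale_fun (1 / sqrt (b v v)) v) = a v v / b v v"
    if v: "v \<in> W" "v \<noteq> (\<lambda>e x. 0)" for v
  proof -
    have "b v v > 0" using b_pos v WV by blast
    moreover have "v \<in> V" using v WV by blast
    ultimately show ?thesis using W(2)[OF v(1)] form_domain_scale[of v]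
      by (auto simp: b_scale b_scale_right a_scale a_scale_right)
  qed
  have Rne: "R \<noteq> {}" using norm[OF v0] unfolding R_def by blast
  have Rbd: "bdd_below R" unfolding R_def by (rule bdd_belowI[of _ 0]) (auto simp: a_nonneg)
  have low: "\<mu> * b v v \<le> a v v" if v: "v \<in> W" for v
  proof (cases "v = (\<lambda>e x. 0)")
    case True
    then have "b v v = 0" by (simp add: L2_inner_def)
    then show ?thesis using a_nonneg by simp
  next
    case False
    have "a v v / b v v \<in> R" unfolding R_def
      by (rule CollectI, rule exI[of _ "scale_fun (1 / sqrt (b v v)) v"]) (simp only: norm[OF v False])
    then have "\<mu> \<le> a v v / b v v" unfolding \<mu>_def using Rbd by (rule cInf_lower)
    moreover have "b v v > 0" using b_pos v WV False by blast
    ultimately show ?thesis by (simp add: pos_le_divide_eq)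
  qed
  have "\<exists>v. v \<in> W \<and> b v v = 1 \<and> a v v < \<mu> + 1 / real (Suc n)" for n
  proof -
    have "\<exists>r\<in>R. r < \<mu> + 1 / real (Suc n)"
      using cInf_lessD[OF Rne, of "\<mu> + 1 / real (Suc n)"] by (simp add: \<mu>_def)
    then show ?thesis unfolding R_def by blast
  qed
  then obtain u where u: "\<And>n. u n \<in> W" "\<And>n. b (u n) (u n) = 1" "\<And>n. a (u n) (u n) < \<mu> + 1 / real (Suc n)"
    by metis
  have au: "(\<lambda>n. a (u n) (u n)) \<longlonglongrightarrow> \<mu>"
  proof (rule tendsto_sandwich[of "\<lambda>_. \<mu>" _ _ "\<lambda>n. \<mu> + 1 / real (Suc n)"])
    show "\<forall>\<^sub>F n in sequentially. \<mu> \<le> a (u n) (u n)" using low[OF u(1)] u(2) by (intro always_eventually) simp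
    show "\<forall>\<^sub>F n in sequentially. a (u n) (u n) \<le> \<mu> + 1 / real (Suc n)"
      using u(3) by (intro always_eventually) (simp add: less_imp_le)
    show "(\<lambda>n. \<mu> + 1 / real (Suc n)) \<longlonglongrightarrow> \<mu>"
      using tendsto_add[OF tendsto_const[of \<mu>] LIMSEQ_Suc[OF lim_1_over_n]] by simp
  qed simp
  have bu: "(\<lambda>n. b (u n) (u n)) \<longlonglongrightarrow> 1" using u(2) by simp
  have "\<exists>w k. w \<in> V \<and> strict_mono (k :: nat \<Rightarrow> nat) \<and> a w w = \<mu> \<and> b w w = 1 \<and>
      (\<forall>v\<in>V. (\<lambda>n. b (u (k n)) v) \<longlonglongrightarrow> b w v)"
  proof (rule minimizing_sequence[OF WV W(1) low u(1) bu au])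
    fix w and k :: "nat \<Rightarrow> nat"
    assume "w \<in> V" "strict_mono k" "a w w = \<mu>" "b w w = 1" "\<And>v. v \<in> V \<Longrightarrow> (\<lambda>n. b (u (k n)) v) \<longlonglongrightarrow> b w v"
    then show ?thesis by (intro exI[of _ w] exI[of _ k]) auto
  qed
  then obtain w k where w: "w \<in> V" "a w w = \<mu>" "b w w = 1"
      "\<And>v. v \<in> V \<Longrightarrow> (\<lambda>n. b (u (k n)) v) \<longlonglongrightarrow> b w v"
    by blast
  have wW: "w \<in> W" using closed[of "\<lambda>n. u (k n)" w] u(1) w by blast
  have EL: "a w v = \<mu> * b w v" if "v \<in> W" for v
    by (rule minimizer_Euler_Lagrange[OF WV W low wW _ that]) (use w in simp_all)
  show ?thesis using that[OF wW w(3) low EL] .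
qed

end

section \<open>Eigenvalues\<close>

text \<open>Induction on the points: requiring the value 0 at one more point lowers the dimension by
  at most one, so a single vector \<open>v\<close> restores what is lost.\<close>

lemma determined_by_points_finite_span:
  fixes S :: "('e \<Rightarrow> real \<Rightarrow> real) set"
  assumes "finite X" "graph_fun.subspace S" "\<And>u. u \<in> S \<Longrightarrow> (\<And>e x. (e, x) \<in> X \<Longrightarrow> u e x = 0) \<Longrightarrow> u = 0"
  shows "\<exists>B. finite B \<and> S \<subseteq> graph_fun.span B"
  using assms
proof (induction X arbitrary: S)
  case empty
  then have "S \<subseteq> graph_fun.span {}" by (auto simp: zero_fun_def)
  then show ?case by blast
next
  case (insert p X)
  obtain e0 x0 where p: "p = (e0, x0)" by (cases p)
  define S0 where "S0 = {u \<in> S. u e0 x0 = 0}"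
  have sub: "graph_fun.subspace S0"
    using insert.prems(1) unfolding graph_fun.subspace_def S0_def by (auto simp: scale_fun_def)
  have "u = 0" if u: "u \<in> S0" and z: "\<And>e x. (e, x) \<in> X \<Longrightarrow> u e x = 0" for u
    by (rule insert.prems(2)) (use u z in \<open>auto simp: S0_def p\<close>)
  then obtain B where B: "finite B" "S0 \<subseteq> graph_fun.span B" using insert.IH[OF sub] by blast
  show ?case
  proof (cases "S = S0")
    case True
    then show ?thesis using B by blast
  next
    case False
    then obtain v where v: "v \<in> S" "v e0 x0 \<noteq> 0" unfolding S0_def by blast
    have "u \<in> graph_fun.span (insert v B)" if u: "u \<in> S" for u
    proof -
      define c where "c = u e0 x0 / v e0 x0"
      have "u - scale_fun c v \<in> S0"
        unfolding S0_def using graph_fun.subspace_diff[OF insert.prems(1) u graph_fun.subspace_scale[OF insert.prems(1) v(1)]] v(2)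
        by (simp add: c_def) (simp add: scale_fun_def)
      then have "u - scale_fun c v \<in> graph_fun.span (insert v B)"
        using B(2) graph_fun.span_mono[of B "insert v B"] by blast
      moreover have "scale_fun c v \<in> graph_fun.span (insert v B)"
        by (intro graph_fun.span_scale graph_fun.span_base) simp
      ultimately have "(u - scale_fun c v) + scale_fun c v \<in> graph_fun.span (insert v B)"
        by (rule graph_fun.span_add)
      then show ?thesis by simp
    qed
    then show ?thesis using B(1) by (intro exI[of _ "insert v B"]) auto
  qed
qed

text \<open>The finite spanning set is essential, since \<open>dim\<close> is 0 for a space whose
  bases are infinite. With it, exhibiting independent eigenfunctions bounds a multiplicity from
  below.\<close>

lemma card_independent_le_dim:
  assumes B: "finite B" "S \<subseteq> graph_fun.span B" and I: "I \<subseteq> S" "\<not> graph_fun.dependent I"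
  shows "card I \<le> graph_fun.dim S"
proof -
  obtain C where C: "C \<subseteq> S" "\<not> graph_fun.dependent C" "S \<subseteq> graph_fun.span C" "card C = graph_fun.dim S"
    using graph_fun.basis_exists[of S] by blast
  have "finite C" using graph_fun.independent_span_bound[OF B(1) C(2)] C(1) B(2) by auto
  then show ?thesis using graph_fun.independent_span_bound[OF _ I(2), of C] I(1) C by auto
qed

lemma pos_dim_nonzero:
  assumes "0 < graph_fun.dim S"
  obtains u where "u \<in> S" "u \<noteq> 0"
proof -
  obtain C where C: "C \<subseteq> S" "\<not> graph_fun.dependent C" "card C = graph_fun.dim S"
    by (rule graph_fun.basis_exists[of S])
  then have "C \<noteq> {}" using assms by force
  then obtain u where u: "u \<in> C" by blast
  moreover have "u \<noteq> 0" using graph_fun.dependent_zero[of C] C(2) u by auto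
  ultimately show ?thesis using that C(1) by blast
qed

context finite_graph
begin

lemma eigenspaceI:
  assumes "u \<in> V" "\<And>v. v \<in> V \<Longrightarrow> a u v = \<mu> * b u v"
  shows "u \<in> eigenspace G \<mu>"
proof -
  have "L2_function G (scale_fun \<mu> u)"
    unfolding L2_function_def using L2_form_domain[OF form_domain_scale[OF assms(1)]] by blast
  then show ?thesis
    unfolding eigenspace_def minus_Laplacian_def using assms by (simp add: b_scale)
qed

lemma eigenspaceD:
  assumes "u \<in> eigenspace G \<mu>"
  shows "u \<in> V" "v \<in> V \<Longrightarrow> a u v = \<mu> * b u v"
  using assms unfolding eigenspace_def minus_Laplacian_def by (auto simp: b_scale)

lemma eigenspace_subspace: "graph_fun.subspace (eigenspace G \<mu>)"
  unfolding graph_fun.subspace_def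
proof (intro conjI ballI allI)
  show "0 \<in> eigenspace G \<mu>"
  proof (rule eigenspaceI)
    have z: "(0 :: 'e \<Rightarrow> real \<Rightarrow> real) = scale_fun 0 (\<lambda>e x. 0)" by (simp add: scale_fun_def zero_fun_def)
    then show "0 \<in> V" using form_domain_scale[OF zero_form_domain] by metis
    fix v assume v: "v \<in> V"
    have "a (scale_fun 0 (\<lambda>e x. 0)) v = \<mu> * b (scale_fun 0 (\<lambda>e x. 0)) v"
      by (simp only: a_scale[OF zero_form_domain v] b_scale mult_zero_left mult_zero_right)
    then show "a 0 v = \<mu> * b 0 v" by (simp only: z)
  qed
  fix u v assume uv: "u \<in> eigenspace G \<mu>" "v \<in> eigenspace G \<mu>"
  show "u + v \<in> eigenspace G \<mu>"
    using eigenspaceD[OF uv(1)] eigenspaceD[OF uv(2)]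
    by (intro eigenspaceI form_domain_add) (auto simp: a_add b_add algebra_simps)
next
  fix u c assume u: "u \<in> eigenspace G \<mu>"
  show "scale_fun c u \<in> eigenspace G \<mu>"
    using eigenspaceD[OF u] by (intro eigenspaceI form_domain_scale) (auto simp: a_scale b_scale)
qed

text \<open>
  An eigenfunction that vanishes on a sufficiently fine grid violates the Poincare inequality on the
  cells of the grid unless it is zero.
\<close>

lemma eigenspace_finite_span: "\<exists>B. finite B \<and> eigenspace G \<mu> \<subseteq> graph_fun.span B"
proof -
  define K where "K = (\<Sum>e\<in>Edges G. (len G e)\<^sup>2)"
  have K: "(len G e)\<^sup>2 \<le> K" if "e \<in> Edges G" for e
    unfolding K_def using finite_edges that by (intro member_le_sum) auto
  have K0: "0 \<le> K" unfolding K_def by (intro sum_nonneg) auto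
  \<comment> \<open>Fine enough that the factor in the final estimate of \<open>b u u\<close> by a
    multiple of itself is below 1, which forces \<open>b u u = 0\<close>.\<close>
  obtain N :: nat where N: "N > \<bar>\<mu>\<bar> * (real (card (Edges G)) * K)" using reals_Archimedean2 by blast
  have N0: "real N > 0" using N K0 by (smt (verit) mult_nonneg_nonneg of_nat_0_le_iff abs_ge_zero)
  define X where "X = (\<lambda>(e, i). (e, real i * len G e / real N)) ` (Edges G \<times> {..N})"
  have "finite X" unfolding X_def using finite_edges by auto
  then show ?thesis
  proof (rule determined_by_points_finite_span[OF _ eigenspace_subspace])
    fix u assume u: "u \<in> eigenspace G \<mu>" and z: "\<And>e x. (e, x) \<in> X \<Longrightarrow> u e x = 0"
    note uV = eigenspaceD(1)[OF u]
    have est: "integral\<^sup>L (Leb e) (\<lambda>x. u e x * u e x) \<le> K / N * a u u" if e: "e \<in> Edges G" for e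
    proof -
      let ?l = "len G e"
      have l: "?l > 0" by (rule len_pos[OF e])
      have L: "L2_interval ?l (u e)" by (rule L2_form_domain[OF uV e])
      have pt: "u e x * u e x \<le> ?l / N * a u u" if x: "x \<in> {0..?l}" for x
      proof -
        define i where "i = nat \<lfloor>x * N / ?l\<rfloor>"
        define y where "y = real i * ?l / N"
        have r: "0 \<le> x * N / ?l" using x l N0 by simp
        then have i: "real i \<le> x * N / ?l" "x * N / ?l < real i + 1" unfolding i_def by linarith+
        have "x * N / ?l \<le> N" using x l N0 by (simp add: pos_divide_le_eq mult.commute)
        then have iN: "i \<le> N" using i(1) by linarith
        have y: "0 \<le> y" "y \<le> x" "x - y \<le> ?l / N"
        proof -
          show "0 \<le> y" using l N0 by (simp add: y_def)
          have "real i * ?l \<le> x * N" using i(1) l by (simp add: pos_le_divide_eq)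
          then show "y \<le> x" unfolding y_def using N0 by (simp add: pos_divide_le_eq)
          have "x * N < (real i + 1) * ?l" using i(2) l by (simp add: pos_divide_less_eq)
          then have "x < (real i + 1) * ?l / N" using N0 by (simp add: pos_less_divide_eq)
          then show "x - y \<le> ?l / N" unfolding y_def by (simp add: distrib_right add_divide_distrib)
        qed
        have "u e y = 0" using z[of e y] e iN unfolding X_def y_def by force
        then have "(u e x)\<^sup>2 \<le> \<bar>x - y\<bar> * integral\<^sup>L (Leb e) (\<lambda>t. (D u e t)\<^sup>2)"
          using has_weak_deriv_Hoelder_half[OF form_domain_weak_deriv[OF uV e], of y x] x y by simp
        also have "\<dots> \<le> ?l / N * a u u"
          using y edge_energy_le(1)[OF uV e] l N0 by (intro mult_mono) (auto intro!: Bochner_Integration.integral_nonneg)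
        finally show ?thesis by (simp add: power2_eq_square)
      qed
      have "integral {0..?l} (\<lambda>x. u e x * u e x) \<le> integral {0..?l} (\<lambda>x. ?l / N * a u u)"
        using pt by (intro integral_le L2_interval_mult_integrable_on[OF L L]) auto
      also have "\<dots> = ?l\<^sup>2 / N * a u u" using l by (simp add: power2_eq_square)
      also have "\<dots> \<le> K / N * a u u"
        using K[OF e] N0 a_nonneg by (intro mult_right_mono divide_right_mono) auto
      finally show ?thesis using L2_interval_mult_integrable_on(3)[OF L L, of 0 ?l] by simp
    qed
    have "b u u \<le> (\<Sum>e\<in>Edges G. K / N * a u u)"
      unfolding L2_inner_def by (rule sum_mono) (rule est)
    also have "\<dots> = real (card (Edges G)) * K / N * (\<mu> * b u u)"
      using eigenspaceD(2)[OF u uV] by simp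
    also have "\<dots> = (\<mu> * (real (card (Edges G)) * K)) / N * b u u" by simp
    finally have le: "b u u \<le> (\<mu> * (real (card (Edges G)) * K)) / N * b u u" .
    have "\<mu> * (real (card (Edges G)) * K) \<le> \<bar>\<mu>\<bar> * (real (card (Edges G)) * K)"
      using K0 by (intro mult_right_mono) auto
    then have "(\<mu> * (real (card (Edges G)) * K)) / N < 1" using N N0 by (simp add: pos_divide_less_eq)
    then have "b u u = 0"
      using le b_nonneg[of u] mult_less_cancel_right2[of "(\<mu> * (real (card (Edges G)) * K)) / N" "b u u"] by linarith
    then have "u = (\<lambda>e x. 0)" using b_zero_imp[OF uV] by blast
    then show "u = 0" by (simp add: zero_fun_def)
  qed
qed

lemma multiplicity_pos:
  assumes "u \<in> eigenspace G \<mu>" "u \<noteq> 0"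
  shows "1 \<le> multiplicity G \<mu>"
proof -
  obtain B where B: "finite B" "eigenspace G \<mu> \<subseteq> graph_fun.span B" using eigenspace_finite_span by blast
  have "card {u} \<le> graph_fun.dim (eigenspace G \<mu>)"
    by (rule card_independent_le_dim[OF B]) (use assms in auto)
  then show ?thesis by (simp add: multiplicity_def)
qed

lemma multiplicity_ge_2:
  assumes "u \<in> eigenspace G \<mu>" "v \<in> eigenspace G \<mu>" "b u u \<noteq> 0" "b v v \<noteq> 0" "b u v = 0"
  shows "2 \<le> multiplicity G \<mu>"
proof -
  obtain B where B: "finite B" "eigenspace G \<mu> \<subseteq> graph_fun.span B" using eigenspace_finite_span by blast
  have nz: "v \<noteq> 0" "u \<noteq> v" using assms(3-5) by (auto simp: L2_inner_def)
  have "\<not> graph_fun.dependent {u, v}"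
  proof -
    have "u \<notin> graph_fun.span {v}"
    proof
      assume "u \<in> graph_fun.span {v}"
      then obtain c where "u = scale_fun c v" unfolding graph_fun.span_singleton by auto
      then have "b u u = c * b v u" using b_scale by metis
      then show False using assms(3,5) b_sym by simp
    qed
    then show ?thesis using nz graph_fun.independent_insert[of u "{v}"] by auto
  qed
  then have "card {u, v} \<le> graph_fun.dim (eigenspace G \<mu>)"
    by (intro card_independent_le_dim[OF B]) (use assms in auto)
  then show ?thesis using nz by (simp add: multiplicity_def)
qed

section \<open>The first two eigenvalues as minima\<close>

lemma counted_eigenvalue_ge:
  assumes low: "\<And>v. v \<in> V \<Longrightarrow> \<kappa> * b v v \<le> a v v"
    and "finite A" "A \<subseteq> {..\<mu>}" "n \<le> (\<Sum>\<nu>\<in>A. multiplicity G \<nu>)" "1 \<le> n"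
  shows "\<kappa> \<le> \<mu>"
proof -
  have "\<exists>\<nu>\<in>A. multiplicity G \<nu> > 0"
    using assms(4,5) by (metis not_gr_zero not_one_le_zero order.trans sum.neutral)
  then obtain \<nu> where \<nu>: "\<nu> \<in> A" "0 < graph_fun.dim (eigenspace G \<nu>)" unfolding multiplicity_def by blast
  obtain u where u: "u \<in> eigenspace G \<nu>" "u \<noteq> 0" using pos_dim_nonzero[OF \<nu>(2)] by blast
  have uV: "u \<in> V" by (rule eigenspaceD[OF u(1)])
  have "b u u > 0" using b_pos[OF uV] u(2) by (simp add: zero_fun_def)
  moreover have "\<kappa> * b u u \<le> \<nu> * b u u" using low[OF uV] eigenspaceD(2)[OF u(1) uV] by simp
  ultimately have "\<kappa> \<le> \<nu>" by simp
  then show ?thesis using assms(3) \<nu>(1) by force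
qed

lemma eigenvalue_1_eq:
  assumes low: "\<And>v. v \<in> V \<Longrightarrow> \<kappa> * b v v \<le> a v v"
    and u: "u \<in> V" "b u u = 1" "\<And>v. v \<in> V \<Longrightarrow> a u v = \<kappa> * b u v"
  shows "eigenvalue G 1 = \<kappa>"
  unfolding eigenvalue_def
proof (rule cInf_eq_minimum)
  have "u \<noteq> 0" using u(2) by (auto simp: L2_inner_def)
  then have "1 \<le> multiplicity G \<kappa>" using multiplicity_pos eigenspaceI u by blast
  then show "\<kappa> \<in> {\<mu>. \<exists>A. finite A \<and> A \<subseteq> {..\<mu>} \<and> 1 \<le> (\<Sum>\<nu>\<in>A. multiplicity G \<nu>)}"
    by (intro CollectI exI[of _ "{\<kappa>}"]) auto
qed (use counted_eigenvalue_ge[OF low] in blast)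

lemma eigenvalue_2_le:
  assumes low: "\<And>v. v \<in> V \<Longrightarrow> \<kappa> * b v v \<le> a v v"
    and u: "u \<in> eigenspace G \<kappa>" "b u u = 1"
    and w: "w \<in> eigenspace G \<mu>" "b w w = 1" and uw: "b u w = 0"
  shows "eigenvalue G 2 \<le> \<mu>"
  unfolding eigenvalue_def
proof (rule cInf_lower)
  have nz: "u \<noteq> 0" "w \<noteq> 0" using u(2) w(2) by (auto simp: L2_inner_def)
  have le: "\<kappa> \<le> \<mu>"
    using low[OF eigenspaceD(1)[OF w(1)]] eigenspaceD(2)[OF w(1) eigenspaceD(1)[OF w(1)]] w(2) by simp
  \<comment> \<open>Distinct \<kappa> and \<mu> contribute one eigenfunction each; if they coincide,
    orthogonality of \<open>u\<close> and \<open>w\<close> supplies multiplicity two.\<close>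
  show "\<mu> \<in> {\<mu>. \<exists>A. finite A \<and> A \<subseteq> {..\<mu>} \<and> 2 \<le> (\<Sum>\<nu>\<in>A. multiplicity G \<nu>)}"
  proof (cases "\<kappa> = \<mu>")
    case True
    then have "2 \<le> multiplicity G \<mu>" using multiplicity_ge_2[of u \<mu> w] u w uw by simp
    then show ?thesis by (intro CollectI exI[of _ "{\<mu>}"]) auto
  next
    case False
    then show ?thesis using multiplicity_pos[OF u(1) nz(1)] multiplicity_pos[OF w(1) nz(2)] le
      by (intro CollectI exI[of _ "{\<kappa>, \<mu>}"]) auto
  qed
  show "bdd_below {\<mu>. \<exists>A. finite A \<and> A \<subseteq> {..\<mu>} \<and> 2 \<le> (\<Sum>\<nu>\<in>A. multiplicity G \<nu>)}"
    using counted_eigenvalue_ge[OF low, where n = 2] by (intro bdd_belowI[of _ \<kappa>]) auto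
qed

text \<open>Dirichlet eigenfunctions of a single edge, extended by zero. Vanishing at both ends
  makes them admissible under all vertex conditions.\<close>

definition edge_sine :: "'e \<Rightarrow> nat \<Rightarrow> 'e \<Rightarrow> real \<Rightarrow> real" where
  "edge_sine d m = (\<lambda>e x. if e = d \<and> 0 \<le> x \<and> x \<le> len G d then sin (real m * pi / len G d * x) else 0)"

lemma edge_sine_weak_deriv:
  assumes d: "d \<in> Edges G"
  shows "has_weak_deriv (len G e) (edge_sine d m e)
    (\<lambda>x. if e = d then real m * pi / len G d * cos (real m * pi / len G d * x) else 0)"
proof (cases "e = d")
  case True
  have "has_weak_deriv (len G d) (\<lambda>x. sin (real m * pi / len G d * x))
    (\<lambda>x. real m * pi / len G d * cos (real m * pi / len G d * x))"
    by (rule has_weak_deriv_C1) (use len_pos[OF d] in \<open>auto intro!: derivative_eq_intros continuous_intros\<close>)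
  then have "has_weak_deriv (len G d) (edge_sine d m d)
    (\<lambda>x. real m * pi / len G d * cos (real m * pi / len G d * x))"
    by (rule has_weak_deriv_cong) (use len_pos[OF d] in \<open>auto simp: edge_sine_def\<close>)
  then show ?thesis using True by simp
qed (use has_weak_deriv_const in \<open>simp add: edge_sine_def\<close>)

lemma edge_sine_form_domain: 
  assumes d: "d \<in> Edges G"
  shows "edge_sine d m \<in> V"
  by (rule form_domainI[OF _ edge_sine_weak_deriv[OF d], where \<phi> = "\<lambda>_. 0"])
    (use d len_pos in \<open>auto simp: edge_sine_def\<close>)

lemma first_eigenvalue:
  assumes "Edges G \<noteq> {}"
  obtains u where "u \<in> V" "b u u = 1" "\<And>v. v \<in> V \<Longrightarrow> a u v = eigenvalue G 1 * b u v"
    "\<And>v. v \<in> V \<Longrightarrow> eigenvalue G 1 * b v v \<le> a v v"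
proof -
  obtain d where d: "d \<in> Edges G" using assms by blast
  have "edge_sine d 1 d (len G d / 2) = 1" using len_pos[OF d] by (simp add: edge_sine_def)
  then have nz: "edge_sine d 1 \<noteq> (\<lambda>e x. 0)" by auto
  obtain w \<mu> where w: "w \<in> V" "b w w = 1" "\<And>v. v \<in> V \<Longrightarrow> \<mu> * b v v \<le> a v v"
    "\<And>v. v \<in> V \<Longrightarrow> a w v = \<mu> * b w v"
    by (rule Rayleigh_minimizer[OF subset_refl form_domain_add form_domain_scale _ edge_sine_form_domain[OF d] nz]) blast+
  then have "eigenvalue G 1 = \<mu>" by (intro eigenvalue_1_eq) auto
  then show ?thesis using that w by blast
qed

text \<open>The minimiser \<open>w\<close> on the orthogonal complement of \<open>u\<close>
  satisfies the eigenvalue equation against all of \<open>V\<close>, because the component along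
  \<open>u\<close> drops out. Its Rayleigh quotient is thus an eigenvalue counted besides the first,
  so it bounds \<open>eigenvalue G 2\<close> from above.\<close>

lemma second_eigenvalue:
  assumes ne: "Edges G \<noteq> {}"
    and u: "u \<in> V" "b u u = 1" "\<And>v. v \<in> V \<Longrightarrow> a u v = eigenvalue G 1 * b u v"
    and v: "v \<in> V" "b v u = 0"
  shows "eigenvalue G 2 * b v v \<le> a v v"
proof -
  define W where "W = {v \<in> V. b v u = 0}"
  obtain u0 where low: "\<And>v. v \<in> V \<Longrightarrow> eigenvalue G 1 * b v v \<le> a v v" using first_eigenvalue[OF ne] by metis
  obtain d where d: "d \<in> Edges G" using ne by blast
  \<comment> \<open>Among the combinations of two sines on one edge some nonzero one is orthogonal
    to \<open>u\<close>. Values at the midpoint, where the second sine vanishes, show that the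
    combination is nonzero.\<close>
  obtain v0 where v0: "v0 \<in> W" "v0 \<noteq> (\<lambda>e x. 0)"
  proof -
    let ?s = "edge_sine d 1" and ?t = "edge_sine d 2"
    have s: "?s d (len G d / 2) = 1" and t: "?t d (len G d / 2) = 0" "?t d (len G d / 4) = 1"
      using len_pos[OF d] by (auto simp: edge_sine_def)
    note [simp del] = graph_fun.scale_minus_left add_uminus_conv_diff
    show ?thesis
    proof (cases "b ?t u = 0")
      case True
      have "?t \<noteq> (\<lambda>e x. 0)" using t(2) by auto
      then show ?thesis using that[of ?t] True edge_sine_form_domain[OF d] by (simp add: W_def)
    next
      case False
      let ?v = "scale_fun (b ?t u) ?s + scale_fun (- b ?s u) ?t"
      have "?v d (len G d / 2) \<noteq> 0" using False s t by (simp add: scale_fun_def)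
      then have "?v \<noteq> (\<lambda>e x. 0)" by metis
      moreover have "?v \<in> W" unfolding W_def
        using b_add[of "scale_fun (b ?t u) ?s" "scale_fun (- b ?s u) ?t" u] b_scale u(1)
          form_domain_add[of "scale_fun (b ?t u) ?s" "scale_fun (- b ?s u) ?t"]
          form_domain_scale[OF edge_sine_form_domain[OF d]]
        by (simp add: mult.commute)
      ultimately show ?thesis using that by blast
    qed
  qed
  obtain w \<mu> where w: "w \<in> W" "b w w = 1" "\<And>v. v \<in> W \<Longrightarrow> \<mu> * b v v \<le> a v v"
    "\<And>v. v \<in> W \<Longrightarrow> a w v = \<mu> * b w v"
  proof (rule Rayleigh_minimizer[of W v0])
    show "W \<subseteq> V" by (auto simp: W_def)
    show "x + y \<in> W" if "x \<in> W" "y \<in> W" for x y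
      using that u(1) by (auto simp: W_def form_domain_add b_add)
    show "scale_fun c x \<in> W" if "x \<in> W" for c x
      using that by (auto simp: W_def form_domain_scale b_scale)
    show "w \<in> W" if s: "\<And>n :: nat. s n \<in> W" and w: "w \<in> V" "\<And>v. v \<in> V \<Longrightarrow> (\<lambda>n. b (s n) v) \<longlonglongrightarrow> b w v" for s w
    proof -
      have "b (s n) u = 0" for n using s[of n] by (simp add: W_def)
      then have "b w u = 0" using w(2)[OF u(1)] LIMSEQ_unique[OF tendsto_const, of 0 "b w u"] by simp
      then show ?thesis using w(1) by (simp add: W_def)
    qed
  qed (use v0 in blast)+
  have wV: "w \<in> V" and wu: "b w u = 0" using w(1) by (auto simp: W_def)
  have "a w x = \<mu> * b w x" if x: "x \<in> V" for x
  proof -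
    \<comment> \<open>The projection of \<open>x\<close> onto the complement of
      \<open>u\<close>.\<close>
    define y where "y = x + scale_fun (- b x u) u"
    have yW: "y \<in> W" unfolding W_def y_def using x u(1,2)
      by (auto intro!: form_domain_add form_domain_scale simp: b_add b_scale form_domain_scale simp del: graph_fun.scale_minus_left)
    have xy: "x = y + scale_fun (b x u) u" by (intro ext) (simp add: y_def scale_fun_def)
    have yV: "y \<in> V" using yW by (simp add: W_def)
    have "a x w = a (y + scale_fun (b x u) u) w" "b x w = b (y + scale_fun (b x u) u) w"
      by (rule arg_cong[OF xy])+
    then have ab: "a x w = a y w + b x u * a u w" "b x w = b y w + b x u * b u w"
      using a_add[OF yV form_domain_scale[OF u(1)] wV, of "b x u"] a_scale[OF u(1) wV, of "b x u"]
        b_add[OF yV form_domain_scale[OF u(1)] wV, of "b x u"] b_scale[of "b x u" u w] by simp_all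
    have "a w x = a w y + b x u * a w u"
      using ab(1) a_sym[of w x] a_sym[of w y] a_sym[of w u] by simp
    also have "a w u = 0" using u(3)[OF wV] wu a_sym[of w u] b_sym[of w u] by simp
    also have "a w y = \<mu> * b w y" by (rule w(4)[OF yW])
    also have "b w y = b w x"
      using ab(2) b_sym[of w x] b_sym[of w y] b_sym[of w u] wu by simp
    finally show ?thesis by simp
  qed
  then have "w \<in> eigenspace G \<mu>" using wV eigenspaceI by blast
  then have "eigenvalue G 2 \<le> \<mu>"
    using eigenvalue_2_le[OF low, of u w \<mu>] eigenspaceI[OF u(1,3)] u(2) w(2) wu b_sym by metis
  then have "eigenvalue G 2 * b v v \<le> \<mu> * b v v" using b_nonneg by (intro mult_right_mono)
  also have "\<dots> \<le> a v v" using w(3) v by (simp add: W_def)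
  finally show ?thesis .
qed

lemma eigenvalue_1_le_edge:
  assumes d: "d \<in> Edges G"
  shows "eigenvalue G 1 \<le> (pi / len G d)\<^sup>2"
proof -
  let ?k = "pi / len G d" and ?l = "len G d"
  have l: "?l > 0" by (rule len_pos[OF d])
  obtain u0 where low: "\<And>v. v \<in> V \<Longrightarrow> eigenvalue G 1 * b v v \<le> a v v"
    using first_eigenvalue d by (metis empty_iff)
  let ?s = "edge_sine d 1"
  have sV: "?s \<in> V" by (rule edge_sine_form_domain[OF d])
  have s1: "?s d (?l / 2) = 1" using l by (simp add: edge_sine_def)
  have bpos: "b ?s ?s > 0" by (rule b_pos[OF sV]) (use s1 in auto)
  have sine: "has_weak_deriv ?l (\<lambda>x. sin (k * x)) (\<lambda>x. k * cos (k * x))"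
    and cosine: "has_weak_deriv ?l (\<lambda>x. k * cos (k * x)) (\<lambda>x. - k\<^sup>2 * sin (k * x))" for k
    by (rule has_weak_deriv_C1; auto intro!: derivative_eq_intros continuous_intros simp: power2_eq_square)+
  note S = sine[of ?k] and C = cosine[of ?k]
  let ?I = "integral {0..?l} (\<lambda>x. sin (?k * x) * sin (?k * x))"
  let ?J = "integral {0..?l} (\<lambda>x. (?k * cos (?k * x)) * (?k * cos (?k * x)))"
  have i: "(\<lambda>x. sin (?k * x) * sin (?k * x)) integrable_on {0..?l}"
      "(\<lambda>x. (?k * cos (?k * x)) * (?k * cos (?k * x))) integrable_on {0..?l}"
    by (intro integrable_continuous_real continuous_intros)+
  \<comment> \<open>Both boundary terms vanish, so integrating the derivative of this product shows
    that the Rayleigh quotient of the sine is \<open>?k\<^sup>2\<close>.\<close>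
  have "sin (?k * ?l) * (?k * cos (?k * ?l)) - sin (?k * 0) * (?k * cos (?k * 0))
     = integral {0..?l} (\<lambda>x. (?k * cos (?k * x)) * (?k * cos (?k * x)) + sin (?k * x) * (- ?k\<^sup>2 * sin (?k * x)))"
    using has_weak_deriv_diff[OF has_weak_deriv_mult[OF S C], of 0 ?l] l by simp
  also have "\<dots> = integral {0..?l} (\<lambda>x. (?k * cos (?k * x)) * (?k * cos (?k * x)) - ?k\<^sup>2 * (sin (?k * x) * sin (?k * x)))"
    by (rule Henstock_Kurzweil_Integration.integral_cong) simp
  also have "\<dots> = ?J - ?k\<^sup>2 * ?I"
    using i by (subst Henstock_Kurzweil_Integration.integral_diff) (auto intro: integrable_on_mult_right)
  finally have JI: "?J = ?k\<^sup>2 * ?I" using l by simp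
  have "a ?s ?s = (\<Sum>e\<in>Edges G. if e = d then ?J else 0)"
  proof (subst dirichlet_form_eq)
    fix e
    show "has_weak_deriv (len G e) (?s e) (\<lambda>x. if e = d then real 1 * pi / ?l * cos (real 1 * pi / ?l * x) else 0)"
      "has_weak_deriv (len G e) (?s e) (\<lambda>x. if e = d then real 1 * pi / ?l * cos (real 1 * pi / ?l * x) else 0)"
      by (rule edge_sine_weak_deriv[OF d])+
  next
    show "(\<Sum>e\<in>Edges G. integral\<^sup>L (Leb e) (\<lambda>x. (if e = d then real 1 * pi / ?l * cos (real 1 * pi / ?l * x) else 0) *
      (if e = d then real 1 * pi / ?l * cos (real 1 * pi / ?l * x) else 0))) = (\<Sum>e\<in>Edges G. if e = d then ?J else 0)"
    proof (rule sum.cong[OF refl])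
    fix e
    have "integrable (lebesgue_on {0..?l}) (\<lambda>x. (?k * cos (?k * x)) * (?k * cos (?k * x)))"
      by (intro continuous_imp_integrable_real continuous_intros)
    then show "integral\<^sup>L (Leb e) (\<lambda>x. (if e = d then real 1 * pi / ?l * cos (real 1 * pi / ?l * x) else 0) *
      (if e = d then real 1 * pi / ?l * cos (real 1 * pi / ?l * x) else 0)) = (if e = d then ?J else 0)"
      using lebesgue_integral_eq_integral[of "{0..?l}" "\<lambda>x. (?k * cos (?k * x)) * (?k * cos (?k * x))"] by simp
    qed
  qed
  then have aJ: "a ?s ?s = ?J" using d finite_edges by simp
  have "b ?s ?s = (\<Sum>e\<in>Edges G. if e = d then ?I else 0)"
    unfolding L2_inner_def
  proof (rule sum.cong[OF refl])
    fix e
    have *: "integrable (lebesgue_on {0..?l}) (\<lambda>x. sin (?k * x) * sin (?k * x))"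
      by (intro continuous_imp_integrable_real continuous_intros)
    have "integral\<^sup>L (lebesgue_on {0..?l}) (\<lambda>x. ?s d x * ?s d x) = integral\<^sup>L (lebesgue_on {0..?l}) (\<lambda>x. sin (?k * x) * sin (?k * x))"
      by (rule Bochner_Integration.integral_cong) (auto simp: edge_sine_def)
    then show "integral\<^sup>L (Leb e) (\<lambda>x. ?s e x * ?s e x) = (if e = d then ?I else 0)"
      using lebesgue_integral_eq_integral[OF *] by (auto simp: edge_sine_def)
  qed
  then have bI: "b ?s ?s = ?I" using d finite_edges by simp
  have "eigenvalue G 1 * b ?s ?s \<le> ?k\<^sup>2 * b ?s ?s" using low[OF sV] JI aJ bI by simp
  then show ?thesis using bpos by simp
qed

end

section \<open>Ground states\<close>

text \<open>This function replaces the modulus, which the chain rule does not cover. Subtracting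
  \<open>c\<close> makes it vanish at 0, so that Dirichlet conditions and the extension by zero are
  preserved.\<close>

lemma smoothed_abs_has_derivative:
  assumes "(0::real) < c"
  shows "((\<lambda>t. sqrt (t\<^sup>2 + c\<^sup>2) - c) has_real_derivative t / sqrt (t\<^sup>2 + c\<^sup>2)) (at t)"
proof -
  have "0 < t\<^sup>2 + c\<^sup>2" using assms by (simp add: add_nonneg_pos)
  have "((\<lambda>t. t\<^sup>2 + c\<^sup>2) has_real_derivative 2 * t) (at t)"
    by (auto intro!: derivative_eq_intros)
  from DERIV_diff[OF DERIV_chain2[OF DERIV_real_sqrt[OF \<open>0 < t\<^sup>2 + c\<^sup>2\<close>] this] DERIV_const[of c]]
  have "((\<lambda>t. sqrt (t\<^sup>2 + c\<^sup>2) - c) has_real_derivative inverse (sqrt (t\<^sup>2 + c\<^sup>2)) / 2 * (2 * t) - 0) (at t)" .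
  moreover have "inverse y / 2 * (2 * t) - 0 = t / y" for y :: real
    by (cases "y = 0") (auto simp: field_simps)
  ultimately show ?thesis by simp
qed

lemma smoothed_abs_derivative_Lipschitz:
  assumes c: "(0::real) < c"
  shows "\<bar>s / sqrt (s\<^sup>2 + c\<^sup>2) - t / sqrt (t\<^sup>2 + c\<^sup>2)\<bar> \<le> 2 / c * \<bar>s - t\<bar>"
proof -
  let ?S = "sqrt (s\<^sup>2 + c\<^sup>2)" and ?T = "sqrt (t\<^sup>2 + c\<^sup>2)"
  have S: "\<bar>s\<bar> \<le> ?S" "c \<le> ?S" and T: "\<bar>t\<bar> \<le> ?T" "c \<le> ?T"
    by (auto intro!: real_le_rsqrt)
  have pos: "0 < ?S" "0 < ?T" using S(2) T(2) c by linarith+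
  have "(?S - ?T) * (?S + ?T) = ?S\<^sup>2 - ?T\<^sup>2" by (simp only: power2_eq_square square_diff_square_factored mult.commute)
  also have "\<dots> = (s - t) * (s + t)" by (simp add: power2_eq_square algebra_simps)
  finally have "\<bar>?S - ?T\<bar> * (?S + ?T) = \<bar>s - t\<bar> * \<bar>s + t\<bar>"
    using pos abs_mult[of "?S - ?T" "?S + ?T"] abs_mult[of "s - t" "s + t"] by (simp add: abs_of_pos)
  also have "\<dots> \<le> \<bar>s - t\<bar> * (?S + ?T)" using S T by (intro mult_left_mono) linarith+
  finally have ST: "\<bar>?S - ?T\<bar> \<le> \<bar>s - t\<bar>" using pos by (simp add: mult_le_cancel_right)
  have "s / S - t / T = (s - t) / T + (s / S) * ((T - S) / T)" if "0 < S" "0 < T" for S T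
    using that by (simp add: field_simps)
  from this[OF pos] have "\<bar>s / ?S - t / ?T\<bar> \<le> \<bar>(s - t) / ?T\<bar> + \<bar>(s / ?S) * ((?T - ?S) / ?T)\<bar>"
    by (metis abs_triangle_ineq)
  also have "\<bar>(s - t) / ?T\<bar> \<le> \<bar>s - t\<bar> / c"
    using T(2) c pos by (simp add: abs_divide frac_le)
  also have "\<bar>(s / ?S) * ((?T - ?S) / ?T)\<bar> \<le> 1 * (\<bar>s - t\<bar> / c)"
    unfolding abs_mult
  proof (rule mult_mono)
    show "\<bar>s / ?S\<bar> \<le> 1" using S(1) pos by (simp add: abs_divide)
    show "\<bar>(?T - ?S) / ?T\<bar> \<le> \<bar>s - t\<bar> / c"
      using ST T(2) c pos by (simp add: abs_divide abs_minus_commute frac_le)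
  qed auto
  finally show ?thesis by (simp add: field_simps)
qed

text \<open>In order: nonnegativity of the approximations, an upper and a lower bound that determine
  their norms as \<open>c\<close> tends to 0, and the slope bound by which smoothing does not raise
  the energy.\<close>

lemma smoothed_abs_bounds:
  assumes c: "(0::real) < c"
  shows "0 \<le> sqrt (t\<^sup>2 + c\<^sup>2) - c" "(sqrt (t\<^sup>2 + c\<^sup>2) - c)\<^sup>2 \<le> t\<^sup>2"
    "t\<^sup>2 - 2 * c * (t\<^sup>2 + 1) \<le> (sqrt (t\<^sup>2 + c\<^sup>2) - c)\<^sup>2" "(t / sqrt (t\<^sup>2 + c\<^sup>2))\<^sup>2 \<le> 1"
proof -
  let ?T = "sqrt (t\<^sup>2 + c\<^sup>2)"
  have T: "c \<le> ?T" "\<bar>t\<bar> \<le> ?T" by (auto intro!: real_le_rsqrt)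
  have T2: "?T\<^sup>2 = t\<^sup>2 + c\<^sup>2" by simp
  have sq: "(?T - c)\<^sup>2 = t\<^sup>2 + 2 * c * (c - ?T)" unfolding power2_diff T2 by (simp add: power2_eq_square algebra_simps)
  show "0 \<le> ?T - c" using T by simp
  show "(?T - c)\<^sup>2 \<le> t\<^sup>2" unfolding sq using T c by (simp add: mult_nonneg_nonpos)
  have "?T \<le> \<bar>t\<bar> + c" by (rule real_le_lsqrt) (use c in \<open>auto simp: power2_sum\<close>)
  moreover have "\<bar>t\<bar> \<le> t\<^sup>2 + 1" using zero_le_power2[of "\<bar>t\<bar> - 1"] by (simp add: power2_diff)
  ultimately have "?T - c \<le> t\<^sup>2 + 1" by linarith
  then have "2 * c * (?T - c) \<le> 2 * c * (t\<^sup>2 + 1)" using c by (intro mult_left_mono) auto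
  then show "t\<^sup>2 - 2 * c * (t\<^sup>2 + 1) \<le> (?T - c)\<^sup>2" unfolding sq by (simp add: algebra_simps)
  have "t\<^sup>2 / ?T\<^sup>2 \<le> 1" unfolding T2 using c by (simp add: add_nonneg_pos)
  then show "(t / ?T)\<^sup>2 \<le> 1" by (simp only: power_divide)
qed

context finite_graph
begin

lemma L2_integral_mono:
  fixes f g :: "'e \<Rightarrow> real \<Rightarrow> real"
  assumes "\<And>e. e \<in> Edges G \<Longrightarrow> integrable (Leb e) (f e)" "\<And>e. e \<in> Edges G \<Longrightarrow> integrable (Leb e) (g e)"
    and "\<And>e x. e \<in> Edges G \<Longrightarrow> 0 \<le> x \<Longrightarrow> x \<le> len G e \<Longrightarrow> f e x \<le> g e x"
  shows "(\<Sum>e\<in>Edges G. integral\<^sup>L (Leb e) (f e)) \<le> (\<Sum>e\<in>Edges G. integral\<^sup>L (Leb e) (g e))"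
proof (rule sum_mono)
  fix e assume e: "e \<in> Edges G"
  show "integral\<^sup>L (Leb e) (f e) \<le> integral\<^sup>L (Leb e) (g e)"
    by (rule Bochner_Integration.integral_mono[OF assms(1)[OF e] assms(2)[OF e]]) (use assms(3)[OF e] in auto)
qed

text \<open>The smoothed moduli of an arbitrary ground state have energy at most
  \<open>eigenvalue G 1\<close> and norms tending to 1. They form a minimising sequence, whose
  pointwise limit is nonnegative and again a ground state.\<close>

lemma nonneg_ground_state:
  assumes ne: "Edges G \<noteq> {}"
  obtains u where "u \<in> V" "b u u = 1" "\<And>v. v \<in> V \<Longrightarrow> a u v = eigenvalue G 1 * b u v" "\<And>e x. 0 \<le> u e x"
proof -
  let ?\<mu> = "eigenvalue G 1"
  obtain u where u: "u \<in> V" "b u u = 1" "\<And>v. v \<in> V \<Longrightarrow> a u v = ?\<mu> * b u v"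
    and low: "\<And>v. v \<in> V \<Longrightarrow> ?\<mu> * b v v \<le> a v v"
    by (fact first_eigenvalue[OF ne])
  define c where "c n = 1 / real (Suc n)" for n
  have c: "0 < c n" for n by (simp add: c_def)
  define s where "s n e x = sqrt ((u e x)\<^sup>2 + (c n)\<^sup>2) - c n" for n e x
  define g where "g n e x = u e x / sqrt ((u e x)\<^sup>2 + (c n)\<^sup>2) * D u e x" for n e x
  have wd: "has_weak_deriv (len G e) (s n e) (g n e)" if e: "e \<in> Edges G" for n e
    using has_weak_deriv_chain[OF form_domain_weak_deriv[OF u(1) e] smoothed_abs_has_derivative[OF c[of n]]
        smoothed_abs_derivative_Lipschitz[OF c[of n]]] unfolding s_def[abs_def] g_def[abs_def] .
  obtain \<phi> where \<phi>: "\<And>e. e \<in> Edges G \<Longrightarrow> u e 0 = \<phi> (tail (skel G) e)"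
    "\<And>e. e \<in> Edges G \<Longrightarrow> u e (len G e) = \<phi> (head (skel G) e)" "\<And>v. v \<in> dirichlet G \<Longrightarrow> \<phi> v = 0"
    using form_domainE[OF u(1)] by blast
  have sV: "s n \<in> V" for n
  proof (rule form_domainI[OF _ wd, where \<phi> = "\<lambda>v. sqrt ((\<phi> v)\<^sup>2 + (c n)\<^sup>2) - c n"])
    show "s n e x = 0" if "\<not> (e \<in> Edges G \<and> 0 \<le> x \<and> x \<le> len G e)" for e x
      using form_domain_outside[OF u(1) that] c[of n] by (simp add: s_def)
    show "sqrt ((\<phi> v)\<^sup>2 + (c n)\<^sup>2) - c n = 0" if "v \<in> dirichlet G" for v
      using \<phi>(3)[OF that] c[of n] by simp
  qed (auto simp: s_def \<phi>)
  have a_le: "a (s n) (s n) \<le> ?\<mu>" for n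
  proof -
    have "a (s n) (s n) = (\<Sum>e\<in>Edges G. integral\<^sup>L (Leb e) (\<lambda>x. g n e x * g n e x))"
      by (rule dirichlet_form_eq[OF wd wd])
    also have "\<dots> \<le> (\<Sum>e\<in>Edges G. integral\<^sup>L (Leb e) (\<lambda>x. D u e x * D u e x))"
    proof (rule L2_integral_mono)
      fix e x assume "e \<in> Edges G"
      have "(u e x / sqrt ((u e x)\<^sup>2 + (c n)\<^sup>2))\<^sup>2 * (D u e x)\<^sup>2 \<le> 1 * (D u e x)\<^sup>2"
        by (intro mult_right_mono smoothed_abs_bounds c) simp
      then show "g n e x * g n e x \<le> D u e x * D u e x"
        by (simp only: g_def power2_eq_square mult_1) (simp add: mult_ac)
    qed (use L2_interval_mult_integrable L2_deriv[OF u(1)] wd[THEN has_weak_deriv_L2] in blast)+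
    also have "\<dots> = ?\<mu>" using u(2) u(3)[OF u(1)] by (simp add: dirichlet_form_def)
    finally show ?thesis .
  qed
  have L: "L2_interval (len G e) (u e)" "L2_interval (len G e) (s n e)" if "e \<in> Edges G" for e n
    using L2_form_domain[OF u(1) that] L2_form_domain[OF sV that] by auto
  have b_le: "b (s n) (s n) \<le> 1" for n
  proof -
    have "b (s n) (s n) \<le> b u u"
      unfolding L2_inner_def
    proof (rule L2_integral_mono)
      fix e x assume "e \<in> Edges G"
      show "s n e x * s n e x \<le> u e x * u e x"
        using smoothed_abs_bounds(2)[OF c, of "u e x" n] by (simp add: s_def power2_eq_square)
    qed (use L2_interval_mult_integrable L in blast)+
    then show ?thesis using u(2) by simp
  qed
  let ?L = "total_length G"
  have b_ge: "1 - 2 * c n * (1 + ?L) \<le> b (s n) (s n)" for n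
  proof -
    have i1: "integrable (Leb e) (\<lambda>x. u e x * u e x)" "integrable (Leb e) (\<lambda>x. 1 :: real)" if "e \<in> Edges G" for e
      using L2_interval_mult_integrable[OF L(1) L(1)] that by (auto intro: continuous_imp_integrable_real)
    have "(\<Sum>e\<in>Edges G. integral\<^sup>L (Leb e) (\<lambda>x. u e x * u e x - 2 * c n * (u e x * u e x + 1))) \<le> b (s n) (s n)"
      unfolding L2_inner_def
    proof (rule L2_integral_mono)
      fix e x assume "e \<in> Edges G"
      show "u e x * u e x - 2 * c n * (u e x * u e x + 1) \<le> s n e x * s n e x"
        using smoothed_abs_bounds(3)[OF c, of "u e x" n] by (simp add: s_def power2_eq_square)
    qed (use i1 L2_interval_mult_integrable[OF L(2) L(2)] in auto)
    also have "(\<Sum>e\<in>Edges G. integral\<^sup>L (Leb e) (\<lambda>x. u e x * u e x - 2 * c n * (u e x * u e x + 1)))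
      = (\<Sum>e\<in>Edges G. integral\<^sup>L (Leb e) (\<lambda>x. u e x * u e x) - 2 * c n * (integral\<^sup>L (Leb e) (\<lambda>x. u e x * u e x) + len G e))"
    proof (rule sum.cong[OF refl])
      fix e assume e: "e \<in> Edges G"
      show "integral\<^sup>L (Leb e) (\<lambda>x. u e x * u e x - 2 * c n * (u e x * u e x + 1))
        = integral\<^sup>L (Leb e) (\<lambda>x. u e x * u e x) - 2 * c n * (integral\<^sup>L (Leb e) (\<lambda>x. u e x * u e x) + len G e)"
        using i1[OF e] len_pos[OF e] by (simp add: measure_restrict_space)
    qed
    also have "\<dots> = b u u - 2 * c n * (b u u + ?L)"
      by (simp add: L2_inner_def total_length_def sum_subtractf sum_distrib_left[symmetric] sum.distrib)
    finally show ?thesis using u(2) by simp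
  qed
  have clim: "c \<longlonglongrightarrow> 0" unfolding c_def by (rule LIMSEQ_Suc[OF lim_1_over_n])
  have bs: "(\<lambda>n. b (s n) (s n)) \<longlonglongrightarrow> 1"
  proof (rule tendsto_sandwich[OF always_eventually always_eventually _ tendsto_const[of 1]])
    show "\<forall>n. 1 - 2 * c n * (1 + ?L) \<le> b (s n) (s n)" "\<forall>n. b (s n) (s n) \<le> 1" using b_ge b_le by auto
    have "(\<lambda>n. 1 - 2 * c n * (1 + ?L)) \<longlonglongrightarrow> 1 - 2 * 0 * (1 + ?L)" by (intro tendsto_intros clim)
    then show "(\<lambda>n. 1 - 2 * c n * (1 + ?L)) \<longlonglongrightarrow> 1" by simp
  qed
  have as: "(\<lambda>n. a (s n) (s n)) \<longlonglongrightarrow> ?\<mu>"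
  proof (rule tendsto_sandwich[OF always_eventually always_eventually _ tendsto_const[of ?\<mu>]])
    show "\<forall>n. ?\<mu> * b (s n) (s n) \<le> a (s n) (s n)" "\<forall>n. a (s n) (s n) \<le> ?\<mu>" using low[OF sV] a_le by auto
    show "(\<lambda>n. ?\<mu> * b (s n) (s n)) \<longlonglongrightarrow> ?\<mu>" using tendsto_mult[OF tendsto_const[of ?\<mu>] bs] by simp
  qed
  show ?thesis
  proof (rule minimizing_sequence[OF subset_refl form_domain_add low sV bs as])
    fix w and k :: "nat \<Rightarrow> nat"
    assume w: "w \<in> V" and lim: "\<And>e x. e \<in> Edges G \<Longrightarrow> 0 \<le> x \<Longrightarrow> x \<le> len G e \<Longrightarrow> (\<lambda>n. s (k n) e x) \<longlonglongrightarrow> w e x"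
      and aw: "a w w = ?\<mu>" and bw: "b w w = 1"
    have EL: "a w v = ?\<mu> * b w v" if "v \<in> V" for v
      by (rule minimizer_Euler_Lagrange[OF subset_refl form_domain_add form_domain_scale low w _ that])
        (use aw bw in simp_all)
    have "0 \<le> w e x" for e x
    proof (cases "e \<in> Edges G \<and> 0 \<le> x \<and> x \<le> len G e")
      case True
      then have l: "(\<lambda>n. s (k n) e x) \<longlonglongrightarrow> w e x" using lim by blast
      have "0 \<le> s n e x" for n unfolding s_def by (rule smoothed_abs_bounds(1)[OF c])
      then show ?thesis by (intro LIMSEQ_le_const[OF l]) auto
    qed (use form_domain_outside[OF w] in auto)
    then show ?thesis using that[OF w bw EL] by blast
  qed
qed

section \<open>Nonnegative ground states have no zeros at standard vertices\<close>

lemma hat_weak_deriv: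
  assumes "0 < \<delta>" "\<delta> \<le> l"
  shows "has_weak_deriv l (\<lambda>x. max 0 (1 - x / \<delta>)) (\<lambda>x. if x \<in> {0..\<delta>} then - 1 / \<delta> else 0)"
    "has_weak_deriv l (\<lambda>x. max 0 (1 - (l - x) / \<delta>)) (\<lambda>x. if x \<in> {l - \<delta>..l} then 1 / \<delta> else 0)"
proof -
  have L: "L2_interval l (\<lambda>x. if x \<in> {p..q} then c else 0)" for p q c :: real
  proof -
    have m: "(\<lambda>x::real. if x \<in> {p..q} then c else 0) \<in> borel_measurable (lebesgue_on {0..l})"
      by (intro measurable_restrict_space1 measurable_completion) measurable
    have "integrable (lebesgue_on {0..l}) (\<lambda>x. (if x \<in> {p..q} then c else 0)\<^sup>2)"
    proof (rule Bochner_Integration.integrable_bound)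
      show "integrable (lebesgue_on {0..l}) (\<lambda>x. c\<^sup>2)" by (intro continuous_imp_integrable_real continuous_intros)
    qed (use m in auto)
    then show ?thesis using m by (simp add: L2_interval_def)
  qed
  have I: "integral {0..x} (\<lambda>t. if t \<in> {p..q} then c else 0) = c * measure lborel ({p..q} \<inter> {0..x})" for p q x c :: real
    by (simp only: Henstock_Kurzweil_Integration.integral_restrict_Int Int_atLeastAtMost) (simp add: mult.commute)
  show "has_weak_deriv l (\<lambda>x. max 0 (1 - x / \<delta>)) (\<lambda>x. if x \<in> {0..\<delta>} then - 1 / \<delta> else 0)"
  proof (rule has_weak_derivI[OF L])
    fix x assume "0 \<le> x" "x \<le> l"
    then show "max 0 (1 - x / \<delta>) - max 0 (1 - 0 / \<delta>) = integral {0..x} (\<lambda>x. if x \<in> {0..\<delta>} then - 1 / \<delta> else 0)"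
      unfolding I using assms by (auto simp: max_def min_def field_simps)
  qed
  show "has_weak_deriv l (\<lambda>x. max 0 (1 - (l - x) / \<delta>)) (\<lambda>x. if x \<in> {l - \<delta>..l} then 1 / \<delta> else 0)"
  proof (rule has_weak_derivI[OF L])
    fix x assume "0 \<le> x" "x \<le> l"
    then show "max 0 (1 - (l - x) / \<delta>) - max 0 (1 - (l - 0) / \<delta>) = integral {0..x} (\<lambda>x. if x \<in> {l - \<delta>..l} then 1 / \<delta> else 0)"
      unfolding I using assms by (auto simp: max_def min_def field_simps)
  qed
qed

text \<open>
  The test function is a tent at the vertex \<open>p\<close>. Its slopes, and hence the integral of its product
  with the derivative of \<open>u\<close>, only involve the values of \<open>u\<close> at \<open>p\<close> and at the feet of the tent.
\<close>

lemma superharmonic_zero: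
  assumes u: "u \<in> V" and nonneg: "\<And>e x. 0 \<le> u e x"
    and super: "\<And>v. v \<in> V \<Longrightarrow> (\<And>e x. 0 \<le> v e x) \<Longrightarrow> 0 \<le> a u v"
    and p: "p \<notin> dirichlet G"
    and z: "\<And>e. e \<in> Edges G \<Longrightarrow> tail (skel G) e = p \<Longrightarrow> u e 0 = 0"
      "\<And>e. e \<in> Edges G \<Longrightarrow> head (skel G) e = p \<Longrightarrow> u e (len G e) = 0"
    and d: "d \<in> Edges G" "tail (skel G) d = p \<or> head (skel G) d = p" and x: "0 \<le> x" "x \<le> len G d"
  shows "u d x = 0"
proof -
  \<comment> \<open>Each end of each edge has its own width, so that a loop at \<open>p\<close>
    carries two halves of the tent. The form is minus a sum of nonnegative multiples of the values
    of \<open>u\<close> at the feet, so all these values are zero.\<close>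
  have main: "\<forall>e\<in>Edges G. (tail (skel G) e = p \<longrightarrow> u e (\<delta> e) = 0) \<and> (head (skel G) e = p \<longrightarrow> u e (len G e - \<epsilon> e) = 0)"
    if \<delta>: "\<And>e. e \<in> Edges G \<Longrightarrow> 0 < \<delta> e \<and> \<delta> e \<le> len G e" and \<epsilon>: "\<And>e. e \<in> Edges G \<Longrightarrow> 0 < \<epsilon> e \<and> \<epsilon> e \<le> len G e" for \<delta> \<epsilon>
  proof -
    let ?t = "\<lambda>e. of_bool (tail (skel G) e = p) :: real" and ?h = "\<lambda>e. of_bool (head (skel G) e = p) :: real"
    define \<eta> where "\<eta> e x = (if e \<in> Edges G \<and> 0 \<le> x \<and> x \<le> len G e
      then ?t e * max 0 (1 - x / \<delta> e) + ?h e * max 0 (1 - (len G e - x) / \<epsilon> e) else 0)" for e x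
    define g where "g e x = ?t e * (if x \<in> {0..\<delta> e} then - 1 / \<delta> e else 0) + ?h e * (if x \<in> {len G e - \<epsilon> e..len G e} then 1 / \<epsilon> e else 0)" for e x
    have wd: "has_weak_deriv (len G e) (\<eta> e) (g e)" if e: "e \<in> Edges G" for e
    proof (rule has_weak_deriv_cong)
      show "has_weak_deriv (len G e) (\<lambda>x. ?t e * max 0 (1 - x / \<delta> e) + ?h e * max 0 (1 - (len G e - x) / \<epsilon> e)) (g e)"
        unfolding g_def using \<delta>[OF e] \<epsilon>[OF e] by (intro has_weak_deriv_add has_weak_deriv_cmult hat_weak_deriv) auto
    qed (use e len_pos[OF e] in \<open>auto simp: \<eta>_def\<close>)
    have \<eta>V: "\<eta> \<in> V"
    proof (rule form_domainI[OF _ wd, where \<phi> = "\<lambda>v. of_bool (v = p)"])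
      show "\<eta> e 0 = of_bool (tail (skel G) e = p)" if e: "e \<in> Edges G" for e
        using e len_pos[OF e] \<epsilon>[OF e] by (simp add: \<eta>_def max_def)
      show "\<eta> e (len G e) = of_bool (head (skel G) e = p)" if e: "e \<in> Edges G" for e
        using e len_pos[OF e] \<delta>[OF e] by (simp add: \<eta>_def max_def)
    qed (use p in \<open>auto simp: \<eta>_def\<close>)
    have "0 \<le> \<eta> e x" for e x by (simp add: \<eta>_def)
    then have "0 \<le> a u \<eta>" using super[OF \<eta>V] by blast
    also have "a u \<eta> = (\<Sum>e\<in>Edges G. integral\<^sup>L (Leb e) (\<lambda>x. D u e x * g e x))"
      by (rule dirichlet_form_eq[OF form_domain_weak_deriv[OF u] wd])
    also have "\<dots> = (\<Sum>e\<in>Edges G. - (?t e * u e (\<delta> e) / \<delta> e + ?h e * u e (len G e - \<epsilon> e) / \<epsilon> e))"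
    proof (rule sum.cong[OF refl])
      fix e assume e: "e \<in> Edges G"
      note w = form_domain_weak_deriv[OF u e] and l = len_pos[OF e]
      have part: "((\<lambda>x. if x \<in> {y..y'} then D u e x else 0) has_integral (u e y' - u e y)) {0..len G e}"
        if "0 \<le> y" "y \<le> y'" "y' \<le> len G e" for y y'
      proof -
        have "(D u e has_integral (u e y' - u e y)) {y..y'}"
          unfolding has_weak_deriv_diff[OF w that]
          using L2_interval_integrable_on(2)[OF L2_deriv[OF u e]] that by (intro integrable_integral) simp
        then show ?thesis using that by (subst has_integral_restrict) auto
      qed
      have "integral\<^sup>L (Leb e) (\<lambda>x. D u e x * g e x) = integral {0..len G e} (\<lambda>x. D u e x * g e x)"
        using L2_interval_mult_integrable_on(3)[OF L2_deriv[OF u e] has_weak_deriv_L2[OF wd[OF e]], of 0 "len G e"] by simp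
      also have "\<dots> = integral {0..len G e} (\<lambda>x. (?t e * (- 1 / \<delta> e)) * (if x \<in> {0..\<delta> e} then D u e x else 0)
         + (?h e * (1 / \<epsilon> e)) * (if x \<in> {len G e - \<epsilon> e..len G e} then D u e x else 0))"
        by (rule Henstock_Kurzweil_Integration.integral_cong) (simp add: g_def algebra_simps)
      also have "\<dots> = (?t e * (- 1 / \<delta> e)) * (u e (\<delta> e) - u e 0) + (?h e * (1 / \<epsilon> e)) * (u e (len G e) - u e (len G e - \<epsilon> e))"
        using \<delta>[OF e] \<epsilon>[OF e] by (intro integral_unique has_integral_add has_integral_mult_right part) auto
      also have "\<dots> = - (?t e * u e (\<delta> e) / \<delta> e + ?h e * u e (len G e - \<epsilon> e) / \<epsilon> e)"
        using z[OF e] by (auto simp: of_bool_def field_simps)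
      finally show "integral\<^sup>L (Leb e) (\<lambda>x. D u e x * g e x) = - (?t e * u e (\<delta> e) / \<delta> e + ?h e * u e (len G e - \<epsilon> e) / \<epsilon> e)" .
    qed
    finally have le: "(\<Sum>e\<in>Edges G. ?t e * u e (\<delta> e) / \<delta> e + ?h e * u e (len G e - \<epsilon> e) / \<epsilon> e) \<le> 0"
      by (simp only: sum_negf)
    have nn: "0 \<le> ?t e * u e (\<delta> e) / \<delta> e" "0 \<le> ?h e * u e (len G e - \<epsilon> e) / \<epsilon> e" if "e \<in> Edges G" for e
      using nonneg \<delta>[OF that] \<epsilon>[OF that] by auto
    have z0: "\<forall>e\<in>Edges G. ?t e * u e (\<delta> e) / \<delta> e + ?h e * u e (len G e - \<epsilon> e) / \<epsilon> e = 0"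
      using le sum_nonneg_eq_0_iff[of "Edges G" "\<lambda>e. ?t e * u e (\<delta> e) / \<delta> e + ?h e * u e (len G e - \<epsilon> e) / \<epsilon> e"]
        nn finite_edges sum_nonneg[of "Edges G" "\<lambda>e. ?t e * u e (\<delta> e) / \<delta> e + ?h e * u e (len G e - \<epsilon> e) / \<epsilon> e"]
      by (simp add: add_nonneg_nonneg)
    show ?thesis
    proof (intro ballI conjI impI)
      fix e assume e: "e \<in> Edges G"
      have s: "?t e * u e (\<delta> e) / \<delta> e = 0" "?h e * u e (len G e - \<epsilon> e) / \<epsilon> e = 0"
        using z0 nn[OF e] e by (metis add_nonneg_eq_0_iff)+
      show "u e (\<delta> e) = 0" if "tail (skel G) e = p" using s(1) that \<delta>[OF e] by simp
      show "u e (len G e - \<epsilon> e) = 0" if "head (skel G) e = p" using s(2) that \<epsilon>[OF e] by simp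
    qed
  qed
  show ?thesis using d(2)
  proof
    assume t: "tail (skel G) d = p"
    show ?thesis
    proof (cases "x = 0")
      case False
      \<comment> \<open>The width on \<open>d\<close> puts the foot of the tent exactly at the given
        point; all other widths are full edge lengths.\<close>
      have "\<forall>e\<in>Edges G. (tail (skel G) e = p \<longrightarrow> u e (if e = d then x else len G e) = 0) \<and>
          (head (skel G) e = p \<longrightarrow> u e (len G e - len G e) = 0)"
        by (rule main) (use x False len_pos in auto)
      then have "u d (if d = d then x else len G d) = 0" using d(1) t by blast
      then show ?thesis by simp
    qed (use z(1)[OF d(1) t] in simp)
  next
    assume h: "head (skel G) d = p"
    show ?thesis
    proof (cases "x = len G d")
      case False
      have "\<forall>e\<in>Edges G. (tail (skel G) e = p \<longrightarrow> u e (len G e) = 0) \<and>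
          (head (skel G) e = p \<longrightarrow> u e (len G e - (if e = d then len G d - x else len G e)) = 0)"
        by (rule main) (use x False len_pos in auto)
      then have "u d (len G d - (if d = d then len G d - x else len G d)) = 0" using d(1) h by blast
      then show ?thesis by simp
    qed (use z(2)[OF d(1) h] in simp)
  qed
qed

end

section \<open>Trees and walks\<close>

lemma joins_sym: "joins G e v w \<Longrightarrow> joins G e w v"
  unfolding joins_def by auto

lemma joins_endpoints: "joins G e v w \<Longrightarrow> joins G e x y \<Longrightarrow> {v, w} = {x, y}"
  unfolding joins_def by auto

lemma connected_closed_verts:
  assumes wf: "wf_digraph (skel G)" and conn: "Digraph_Component.connected (skel G)"
    and Z: "v0 \<in> Z" "v0 \<in> Verts G" "\<And>e v w. joins G e v w \<Longrightarrow> v \<in> Z \<Longrightarrow> w \<in> Z"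
  shows "Verts G \<subseteq> Z"
proof
  fix v assume v: "v \<in> Verts G"
  interpret wf_digraph "skel G" by (rule wf)
  have "v0 \<rightarrow>\<^sup>*\<^bsub>with_proj (mk_symmetric (skel G))\<^esub> v"
    using conn v Z(2) unfolding Digraph_Component.connected_def strongly_connected_def by auto
  then have "(v0, v) \<in> rtrancl_on (Verts G) (parcs (mk_symmetric (skel G)))"
    unfolding reachable_def by simp
  then show "v \<in> Z"
  proof (induction rule: rtrancl_on_induct)
    case base
    show ?case by (rule Z(1))
  next
    case (step y z)
    then have "\<exists>e. joins G e y z" by (auto simp: parcs_mk_symmetric joins_def)
    then show ?case using Z(3) step by blast
  qed
qed

section \<open>Balanced slopes of modulus one on a tree\<close>

definition edge_path :: "('v, 'e) metric_graph \<Rightarrow> 'e set \<Rightarrow> 'v list \<Rightarrow> 'e list \<Rightarrow> bool" where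
  "edge_path G F vs es \<longleftrightarrow> length vs = Suc (length es) \<and> distinct vs \<and> distinct es \<and> set es \<subseteq> F \<and>
     (\<forall>i<length es. joins G (es ! i) (vs ! i) (vs ! Suc i))"

text \<open>A longest path in \<open>F\<close> starts at a leaf: a second edge of \<open>F\<close>
  at its first vertex would lengthen the path or close a cycle. \<open>F\<close> may be any nonempty
  finite set of edges, so that leaves can be found again after others have been cut off.\<close>

lemma acyclic_leaf:
  assumes ac: "\<not> (\<exists>vs es. is_cycle G vs es)" and F: "F \<subseteq> Edges G" "finite F" "F \<noteq> {}"
  shows "\<exists>e w x. e \<in> F \<and> joins G e w x \<and> w \<noteq> x \<and>
    (\<forall>e'\<in>F. tail (skel G) e' = w \<or> head (skel G) e' = w \<longrightarrow> e' = e)"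
proof -
  have noloop: "v \<noteq> w" if "joins G e v w" for e v w
  proof
    assume "v = w"
    then have "is_cycle G [v] [e]" using that by (simp add: is_cycle_def)
    then show False using ac by blast
  qed
  let ?P = "\<lambda>n. \<exists>vs es. edge_path G F vs es \<and> length es = n"
  have bd: "n \<le> card F" if P: "?P n" for n
  proof -
    obtain vs es where "edge_path G F vs es" "length es = n" using P by blast
    then have "n = card (set es)" "set es \<subseteq> F" by (auto simp: edge_path_def distinct_card)
    then show ?thesis using F(2) card_mono by blast
  qed
  have "?P 1"
  proof -
    obtain e where e: "e \<in> F" using F(3) by blast
    have "joins G e (tail (skel G) e) (head (skel G) e)" using e F(1) by (auto simp: joins_def)
    then have "edge_path G F [tail (skel G) e, head (skel G) e] [e]" using noloop e by (auto simp: edge_path_def)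
    then show ?thesis by (metis One_nat_def length_Cons list.size(3))
  qed
  then obtain N where N: "?P N" "\<And>n. ?P n \<Longrightarrow> n \<le> N"
    using Greatest_le_nat[of ?P _ "card F"] GreatestI_nat[of ?P 1 "card F"] bd by blast
  then have N1: "1 \<le> N" using \<open>?P 1\<close> by blast
  obtain vs es where p: "edge_path G F vs es" and len: "length es = N" using N(1) by blast
  let ?w = "vs ! 0" and ?x = "vs ! 1" and ?e = "es ! 0"
  have l: "length vs = Suc (length es)" "distinct vs" "distinct es" "set es \<subseteq> F"
    and j: "\<And>i. i < length es \<Longrightarrow> joins G (es ! i) (vs ! i) (vs ! Suc i)"
    using p by (auto simp: edge_path_def)
  have vsne: "vs ! i \<in> set vs" if "i \<le> length es" for i using that l(1) by simp
  have inc: "i = 0" if "i < length es" "joins G (es ! i) y ?w" for i y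
  proof -
    have "?w = vs ! i \<or> ?w = vs ! Suc i" using joins_endpoints[OF that(2) j[OF that(1)]] by auto
    then show ?thesis using nth_eq_iff_index_eq[OF l(2), of 0 i] nth_eq_iff_index_eq[OF l(2), of 0 "Suc i"] that(1) l(1) by auto
  qed
  have "e' = ?e" if e': "e' \<in> F" "tail (skel G) e' = ?w \<or> head (skel G) e' = ?w" for e'
  proof (rule ccontr)
    assume ne: "e' \<noteq> ?e"
    obtain y where y: "joins G e' y ?w" using e' F(1) unfolding joins_def by blast
    have e'es: "e' \<notin> set (take k es)" for k
    proof
      assume "e' \<in> set (take k es)"
      then obtain i where "i < length es" "es ! i = e'" by (metis in_set_conv_nth in_set_takeD)
      then show False using inc[of i y] y ne by auto
    qed
    show False
    proof (cases "y \<in> set vs")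
      case False
      \<comment> \<open>The far end of \<open>e'\<close> is new, so prepending \<open>e'\<close>
        gives a longer path.\<close>
      have "edge_path G F (y # vs) (e' # es)"
        unfolding edge_path_def
      proof (intro conjI allI impI)
        show "distinct (e' # es)" using e'es[of "length es"] l(3) by simp
        fix i assume "i < length (e' # es)"
        then show "joins G ((e' # es) ! i) ((y # vs) ! i) ((y # vs) ! Suc i)"
          using y j by (cases i) auto
      qed (use l False e' in auto)
      then have "?P (Suc N)" using len by (metis length_Cons)
      then show False using N(2) by fastforce
    next
      case True
      then obtain k where k: "k < length vs" "vs ! k = y" by (metis in_set_conv_nth)
      \<comment> \<open>The far end of \<open>e'\<close> already lies on the path, and
        \<open>e'\<close> closes the initial segment up to it.\<close>
      let ?vs = "take (Suc k) vs" and ?es = "take k es @ [e']"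
      have kl: "k \<le> length es" using k l(1) by simp
      have "is_cycle G ?vs ?es"
        unfolding is_cycle_def
      proof (intro conjI allI impI)
        show "length ?vs = length ?es" using k kl l(1) by simp
        show "distinct ?es" using e'es l(3) by simp
        fix i assume "i < length ?es"
        then have i: "i \<le> k" using kl by simp
        show "joins G (?es ! i) (?vs ! i) (?vs ! (Suc i mod length ?es))"
        proof (cases "i = k")
          case True
          then show ?thesis using y k kl by (simp add: nth_append)
        next
          case False
          then have "i < k" using i by simp
          then show ?thesis using j[of i] kl k by (simp add: nth_append)
        qed
      qed (use l(2) in auto)
      then show False using ac by blast
    qed
  qed
  moreover have "?e \<in> set es" by (rule nth_mem) (use N1 len in simp)
  then have "?e \<in> F" using l(4) by blast
  moreover have "joins G ?e ?w ?x" using j[of 0] N1 len by simp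
  ultimately show ?thesis using noloop by blast
qed

text \<open>Kept recursive so that membership at \<open>Suc n\<close> hands out one summand of
  modulus one, which becomes the slope of an edge cut off earlier.\<close>

primrec unit_sums :: "nat \<Rightarrow> complex set" where
  "unit_sums 0 = {0}"
| "unit_sums (Suc n) = {z + b | z b. z \<in> unit_sums n \<and> cmod b = 1}"

text \<open>A number of modulus one is the sum of its rotations by 60 degrees in both directions;
  splitting one summand in this way raises the number of summands by one.\<close>

lemma unit_in_unit_sums: "cmod z = 1 \<Longrightarrow> z \<in> unit_sums (Suc n)"
proof (induction n arbitrary: z)
  case (Suc n)
  have "z * cis (pi/3) \<in> unit_sums (Suc n)" using Suc.prems by (intro Suc.IH) (simp add: norm_mult)
  moreover have "cmod (z * cis (- (pi/3))) = 1" using Suc.prems by (simp add: norm_mult)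
  moreover have "cis (pi/3) + cis (- (pi/3)) = 1" by (simp add: complex_eq_iff cos_60)
  then have "z = z * cis (pi/3) + z * cis (- (pi/3))" by (metis distrib_left mult.right_neutral)
  ultimately show ?case unfolding unit_sums.simps(2)[of "Suc n"] by blast
qed simp

lemma zero_in_unit_sums: "0 \<in> unit_sums (Suc (Suc n))"
proof -
  have "1 \<in> unit_sums (Suc n)" by (rule unit_in_unit_sums) simp
  moreover have "0 = 1 + (- 1 :: complex)" "cmod (- 1) = 1" by auto
  ultimately show ?thesis unfolding unit_sums.simps(2)[of "Suc n"] by blast
qed

definition edge_degree :: "('v, 'e) metric_graph \<Rightarrow> 'e set \<Rightarrow> 'v \<Rightarrow> nat" where
  "edge_degree G F v = card {e \<in> F. tail (skel G) e = v} + card {e \<in> F. head (skel G) e = v}"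

text \<open>The sum of the outgoing slopes at \<open>v\<close>. Heads count negatively because there
  the outgoing direction runs against the coordinate of the edge.\<close>

definition outflow :: "('v, 'e) metric_graph \<Rightarrow> 'e set \<Rightarrow> ('e \<Rightarrow> complex) \<Rightarrow> 'v \<Rightarrow> complex" where
  "outflow G F \<alpha> v = (\<Sum>e | e \<in> F \<and> tail (skel G) e = v. \<alpha> e) - (\<Sum>e | e \<in> F \<and> head (skel G) e = v. \<alpha> e)"

lemma edge_degree_insert:
  fixes G :: "('v, 'e) metric_graph"
  assumes "finite F" "e \<notin> F"
  shows "edge_degree G (insert e F) v = edge_degree G F v + of_bool (tail (skel G) e = v) + of_bool (head (skel G) e = v)"
proof -
  have "{d \<in> insert e F. f d = v} = (if f e = v then insert e {d \<in> F. f d = v} else {d \<in> F. f d = v})" for f :: "'e \<Rightarrow> 'v"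
    by auto
  then show ?thesis using assms by (simp add: edge_degree_def)
qed

lemma outflow_insert:
  fixes G :: "('v, 'e) metric_graph"
  assumes "finite F" "e \<notin> F"
  shows "outflow G (insert e F) (\<alpha>(e := z)) v
    = outflow G F \<alpha> v + of_bool (tail (skel G) e = v) * z - of_bool (head (skel G) e = v) * z"
proof -
  have S: "{d. d \<in> insert e F \<and> f d = v} = (if f e = v then insert e {d. d \<in> F \<and> f d = v} else {d. d \<in> F \<and> f d = v})" for f :: "'e \<Rightarrow> 'v"
    by auto
  define \<beta> where "\<beta> = \<alpha>(e := z)"
  have c: "(\<Sum>d | d \<in> F \<and> f d = v. \<beta> d) = (\<Sum>d | d \<in> F \<and> f d = v. \<alpha> d)" for f :: "'e \<Rightarrow> 'v"
    by (rule sum.cong) (use assms(2) in \<open>auto simp: \<beta>_def\<close>)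
  have "\<beta> e = z" by (simp add: \<beta>_def)
  then show ?thesis unfolding outflow_def S \<beta>_def[symmetric] using assms by (simp add: c)
qed

text \<open>
  Leaves are cut off one at a time. The vertex \<open>v\<close> keeps a record \<open>n v\<close> of the number of edges
  already cut off there; their directions are only chosen when the induction returns to them.
\<close>

lemma unit_flow_aux:
  assumes ac: "\<not> (\<exists>vs es. is_cycle G vs es)"
  shows "finite F \<Longrightarrow> F \<subseteq> Edges G \<Longrightarrow> (\<And>v. v \<in> I \<Longrightarrow> 2 \<le> edge_degree G F v + n v) \<Longrightarrow>
    \<exists>\<alpha> \<gamma>. (\<forall>e\<in>F. cmod (\<alpha> e) = 1 \<and> \<gamma> (head (skel G) e) - \<gamma> (tail (skel G) e) = of_real (len G e) * \<alpha> e) \<and>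
      (\<forall>v\<in>I. outflow G F \<alpha> v \<in> unit_sums (n v))"
proof (induction "card F" arbitrary: F I n)
  case 0
  then have "F = {}" by simp
  moreover have "0 \<in> unit_sums (n v)" if "v \<in> I" for v
  proof -
    have "2 \<le> n v" using 0(4)[OF that] \<open>F = {}\<close> by (simp add: edge_degree_def)
    then obtain k where "n v = Suc (Suc k)" by (metis add_2_eq_Suc le_Suc_ex)
    then show ?thesis using zero_in_unit_sums by metis
  qed
  ultimately show ?case by (auto simp: outflow_def)
next
  case (Suc N)
  then have "F \<noteq> {}" by auto
  then obtain e w x where e: "e \<in> F" "joins G e w x" "w \<noteq> x"
    and leaf: "\<And>e'. e' \<in> F \<Longrightarrow> tail (skel G) e' = w \<or> head (skel G) e' = w \<Longrightarrow> e' = e"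
    using acyclic_leaf[OF ac Suc.prems(2,1)] by blast
  define F' where "F' = F - {e}"
  have F: "F = insert e F'" "e \<notin> F'" "finite F'" using e(1) Suc.prems(1) by (auto simp: F'_def)
  have card: "N = card F'" using Suc.hyps(2) F by simp
  have deg: "edge_degree G F v = edge_degree G F' v + of_bool (v = w) + of_bool (v = x)" for v
    using edge_degree_insert[OF F(3,2), of G v] e(2,3) unfolding F(1) by (auto simp: joins_def)
  have no_w: "tail (skel G) d \<noteq> w \<and> head (skel G) d \<noteq> w" if "d \<in> F'" for d
    using leaf[of d] that F by auto
  \<comment> \<open>The edge \<open>e\<close> is recorded at its remaining end \<open>x\<close>. The
    leaf \<open>w\<close> leaves the set of vertices treated by the induction hypothesis.\<close>
  define n' where "n' = n(x := Suc (n x))"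
  have deg': "2 \<le> edge_degree G F' v + n' v" if "v \<in> I - {w}" for v
    using Suc.prems(3)[of v] that deg[of v] e(3) by (auto simp: n'_def)
  have "\<exists>\<alpha> \<gamma>. (\<forall>e\<in>F'. cmod (\<alpha> e) = 1 \<and> \<gamma> (head (skel G) e) - \<gamma> (tail (skel G) e) = of_real (len G e) * \<alpha> e) \<and>
      (\<forall>v\<in>I - {w}. outflow G F' \<alpha> v \<in> unit_sums (n' v))"
    by (rule Suc.hyps(1)[OF card F(3)]) (use Suc.prems(2) F deg' in auto)
  then obtain \<alpha>' \<gamma>' where "(\<forall>e\<in>F'. cmod (\<alpha>' e) = 1 \<and> \<gamma>' (head (skel G) e) - \<gamma>' (tail (skel G) e) = of_real (len G e) * \<alpha>' e) \<and>
      (\<forall>v\<in>I - {w}. outflow G F' \<alpha>' v \<in> unit_sums (n' v))" by (elim exE)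
  then have IH: "\<And>d. d \<in> F' \<Longrightarrow> cmod (\<alpha>' d) = 1"
      "\<And>d. d \<in> F' \<Longrightarrow> \<gamma>' (head (skel G) d) - \<gamma>' (tail (skel G) d) = of_real (len G d) * \<alpha>' d"
      "\<And>v. v \<in> I - {w} \<Longrightarrow> outflow G F' \<alpha>' v \<in> unit_sums (n' v)"
    by simp_all
  \<comment> \<open>At \<open>x\<close> the induction hypothesis provides one summand in excess of
    \<open>n x\<close>. It becomes \<open>b\<close>, the slope of \<open>e\<close> out of
    \<open>w\<close>, which enters the outflow at \<open>x\<close> with a minus sign.\<close>
  have "\<exists>b. cmod b = 1 \<and> (x \<in> I \<longrightarrow> outflow G F' \<alpha>' x - b \<in> unit_sums (n x))"
  proof (cases "x \<in> I")
    case True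
    then have "outflow G F' \<alpha>' x \<in> unit_sums (Suc (n x))" using IH(3)[of x] e(3) by (simp add: n'_def)
    then show ?thesis by auto
  qed (auto intro: exI[of _ 1])
  then obtain b where b: "cmod b = 1" "x \<in> I \<Longrightarrow> outflow G F' \<alpha>' x - b \<in> unit_sums (n x)" by blast
  define z where "z = (if tail (skel G) e = w then b else - b)"
  define \<alpha> where "\<alpha> = \<alpha>'(e := z)"
  \<comment> \<open>No remaining edge meets \<open>w\<close>, so the value there may be set freely;
    it is dictated by the slope \<open>b\<close> along \<open>e\<close>.\<close>
  define \<gamma> where "\<gamma> = \<gamma>'(w := \<gamma>' x - of_real (len G e) * b)"
  have ends: "tail (skel G) e = w \<and> head (skel G) e = x \<or> tail (skel G) e = x \<and> head (skel G) e = w"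
    using e(2) by (auto simp: joins_def)
  have out: "outflow G F \<alpha> v = outflow G F' \<alpha>' v + of_bool (v = w) * b - of_bool (v = x) * b" for v
    unfolding F(1) \<alpha>_def outflow_insert[OF F(3,2)] using ends e(3) by (auto simp: z_def)
  show ?case
  proof (intro exI[of _ \<alpha>] exI[of _ \<gamma>] conjI ballI)
    fix d assume d: "d \<in> F"
    show "cmod (\<alpha> d) = 1" using IH(1)[of d] d F b(1) by (auto simp: \<alpha>_def z_def)
    show "\<gamma> (head (skel G) d) - \<gamma> (tail (skel G) d) = of_real (len G d) * \<alpha> d"
    proof (cases "d = e")
      case True
      then show ?thesis using ends e(3) by (auto simp: \<gamma>_def \<alpha>_def z_def)
    next
      case False
      then show ?thesis using IH(2)[of d] no_w[of d] d F by (simp add: \<gamma>_def \<alpha>_def)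
    qed
  next
    fix v assume v: "v \<in> I"
    consider "v = w" | "v = x" | "v \<noteq> w" "v \<noteq> x" by blast
    then show "outflow G F \<alpha> v \<in> unit_sums (n v)"
    proof cases
      case 1
      have "{d. d \<in> F' \<and> tail (skel G) d = w} = {}" "{d. d \<in> F' \<and> head (skel G) d = w} = {}"
        "{d \<in> F'. tail (skel G) d = w} = {}" "{d \<in> F'. head (skel G) d = w} = {}"
        using no_w by auto
      then have "outflow G F' \<alpha>' w = 0" "edge_degree G F' w = 0"
        unfolding outflow_def edge_degree_def by (simp_all only: sum.empty card.empty) simp_all
      \<comment> \<open>A leaf has degree one, so at least one edge was cut off at \<open>w\<close>
        before; hence the outflow \<open>b\<close> lies in \<open>unit_sums (n w)\<close>.\<close>
      moreover from this have "1 \<le> n w" using Suc.prems(3)[OF v] deg[of w] e(3) 1 by simp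
      then obtain k where "n w = Suc k" by (metis One_nat_def Suc_le_D)
      ultimately show ?thesis using out[of w] e(3) 1 unit_in_unit_sums[OF b(1), of k] by simp
    next
      case 2
      then show ?thesis using out[of x] e(3) b(2) v by simp
    next
      case 3
      then show ?thesis using out[of v] IH(3)[of v] v by (simp add: n'_def)
    qed
  qed
qed

lemma tree_unit_flow:
  assumes T: "metric_tree T"
  obtains \<alpha> \<gamma> where "\<And>e. e \<in> Edges T \<Longrightarrow> cmod (\<alpha> e) = 1"
    "\<And>e. e \<in> Edges T \<Longrightarrow> \<gamma> (head (skel T) e) - \<gamma> (tail (skel T) e) = of_real (len T e) * \<alpha> e"
    "\<And>v. v \<in> Verts T - exterior_vertices T \<Longrightarrow> outflow T (Edges T) \<alpha> v = 0"
proof -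
  have fin: "finite (Edges T)"
    using T unfolding metric_tree_def connected_metric_graph_def compact_metric_graph_def
    by (auto intro: fin_digraph.finite_arcs)
  have deg: "degree T v = edge_degree T (Edges T) v" for v
    by (simp add: degree_def edge_degree_def in_degree_def out_degree_def in_arcs_def out_arcs_def)
  let ?I = "{v. 2 \<le> edge_degree T (Edges T) v}"
  obtain \<alpha> \<gamma> where f: "\<forall>e\<in>Edges T. cmod (\<alpha> e) = 1 \<and> \<gamma> (head (skel T) e) - \<gamma> (tail (skel T) e) = of_real (len T e) * \<alpha> e"
      "\<forall>v\<in>?I. outflow T (Edges T) \<alpha> v \<in> unit_sums 0"
    using unit_flow_aux[of T "Edges T" ?I "\<lambda>_. 0"] T fin unfolding metric_tree_def by auto
  have "outflow T (Edges T) \<alpha> v = 0" if v: "v \<in> Verts T - exterior_vertices T" for v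
  \<comment> \<open>An internal vertex outside \<open>?I\<close> can only have degree 0, where both
    sums are empty.\<close>
  proof (cases "v \<in> ?I")
    case False
    then have "edge_degree T (Edges T) v = 0" using v deg[of v] by (auto simp: exterior_vertices_def)
    then have "{e \<in> Edges T. tail (skel T) e = v} = {}" "{e \<in> Edges T. head (skel T) e = v} = {}"
      using fin by (auto simp: edge_degree_def)
    then show ?thesis unfolding outflow_def by (simp only: sum.empty) simp
  qed (use f(2) in auto)
  then show ?thesis using that f(1) by blast
qed

section \<open>Closed walks that cover every edge twice\<close>

fun edge_walk :: "('v, 'e) metric_graph \<Rightarrow> 'v \<Rightarrow> 'e list \<Rightarrow> 'v \<Rightarrow> bool" where
  "edge_walk G v [] w \<longleftrightarrow> v = w"
| "edge_walk G v (e # es) w \<longleftrightarrow> (\<exists>x. joins G e v x \<and> edge_walk G x es w)"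

lemma edge_walk_append: "edge_walk G v (p @ q) w \<longleftrightarrow> (\<exists>x. edge_walk G v p x \<and> edge_walk G x q w)"
  by (induction p arbitrary: v) auto

lemma double_covering_walk:
  assumes G: "connected_metric_graph G" and v0: "v0 \<in> Verts G"
  obtains es where "edge_walk G v0 es v0" "set es = Edges G" "\<And>e. e \<in> Edges G \<Longrightarrow> count_list es e = 2"
proof -
  have fd: "fin_digraph (skel G)" and conn: "Digraph_Component.connected (skel G)"
    using G by (auto simp: connected_metric_graph_def compact_metric_graph_def)
  have fin: "finite (Edges G)" by (rule fin_digraph.finite_arcs[OF fd])
  have wf: "wf_digraph (skel G)" using fd by (simp add: fin_digraph_def)
  let ?Q = "\<lambda>es. edge_walk G v0 es v0 \<and> set es \<subseteq> Edges G \<and> (\<forall>e\<in>set es. count_list es e = 2)"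
  let ?P = "\<lambda>n. \<exists>es. ?Q es \<and> card (set es) = n"
  have bd: "n \<le> card (Edges G)" if "?P n" for n using that fin card_mono by blast
  have "?P 0" by (rule exI[of _ "[]"]) simp
  then obtain N where N: "?P N" "\<And>n. ?P n \<Longrightarrow> n \<le> N"
    using Greatest_le_nat[of ?P _ "card (Edges G)"] GreatestI_nat[of ?P 0 "card (Edges G)"] bd by blast
  then obtain es where es: "?Q es" "card (set es) = N" by blast
  \<comment> \<open>The visited vertices, described by splittings of the walk, which are the places
    where a detour can be inserted.\<close>
  define Z where "Z = {v. \<exists>p q. es = p @ q \<and> edge_walk G v0 p v \<and> edge_walk G v q v0}"
  have mem: "e \<in> set es" if v: "v \<in> Z" and j: "joins G e v x" for e v x
  proof (rule ccontr)
    assume n: "e \<notin> set es"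
    obtain p q where pq: "es = p @ q" "edge_walk G v0 p v" "edge_walk G v q v0" using v by (auto simp: Z_def)
    \<comment> \<open>The detour runs along \<open>e\<close> and straight back.\<close>
    let ?es = "p @ [e, e] @ q"
    have c: "count_list ?es d = count_list es d + (if d = e then 2 else 0)" for d
      using pq(1) by simp
    have "edge_walk G v [e, e] v" using j joins_sym by fastforce
    then have "edge_walk G v0 ?es v0" unfolding edge_walk_append using pq by blast
    moreover have "set ?es = insert e (set es)" using pq(1) by auto
    moreover have "e \<in> Edges G" using j by (simp add: joins_def)
    moreover have "count_list es e = 0" using n by (simp add: count_list_0_iff)
    ultimately have Q: "?Q ?es" using es(1) by (simp only: c) auto
    moreover have "card (set ?es) = Suc N" using \<open>set ?es = _\<close> n es(2) by simp
    ultimately have "Suc N \<le> N" by (intro N(2) exI[of _ ?es] conjI) auto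
    then show False by simp
  qed
  have ends: "x \<in> Z" if mem_e: "e \<in> set es" and j: "joins G e v x" for e v x
  proof -
    obtain p q where pq: "es = p @ e # q" using mem_e by (meson split_list)
    then obtain y z where yz: "edge_walk G v0 p y" "joins G e y z" "edge_walk G z q v0"
      using es(1) by (auto simp: edge_walk_append)
    have "y \<in> Z" unfolding Z_def using pq yz by (intro CollectI exI[of _ p] exI[of _ "e # q"]) auto
    moreover have "z \<in> Z" unfolding Z_def using pq yz
      by (intro CollectI exI[of _ "p @ [e]"] exI[of _ q]) (auto simp: edge_walk_append)
    ultimately show ?thesis using joins_endpoints[OF j yz(2)] by auto
  qed
  have "v0 \<in> Z" unfolding Z_def using es(1) by (intro CollectI exI[of _ "[]"] exI[of _ es]) auto
  then have V: "Verts G \<subseteq> Z" by (rule connected_closed_verts[OF wf conn _ v0]) (use mem ends in blast)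
  have "Edges G \<subseteq> set es"
  proof
    fix e assume e: "e \<in> Edges G"
    then have "tail (skel G) e \<in> Z" using V wf_digraph.tail_in_verts[OF wf] by blast
    then show "e \<in> set es" using mem e by (auto simp: joins_def)
  qed
  then show ?thesis using that[of es] es(1) by blast
qed

section \<open>A lower bound for the first eigenvalue\<close>

text \<open>
  The function \<open>h = k cot (k x + c)\<close> solves the Riccati equation \<open>h' = - k\<^sup>2 - h\<^sup>2\<close>, so that
  \<open>g\<^sup>2 - k\<^sup>2 f\<^sup>2 - (h f\<^sup>2)' = (g - h f)\<^sup>2\<close> for \<open>g = f'\<close>.
\<close>

lemma Riccati_energy_bound:
  fixes k c :: real
  assumes f: "has_weak_deriv l f g" and l: "0 \<le> l"
    and s: "\<And>x. 0 \<le> x \<Longrightarrow> x \<le> l \<Longrightarrow> sin (k * x + c) \<noteq> 0"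
  shows "k * cos (k * l + c) / sin (k * l + c) * (f l)\<^sup>2 - k * cos c / sin c * (f 0)\<^sup>2
    \<le> integral\<^sup>L (lebesgue_on {0..l}) (\<lambda>x. g x * g x) - k\<^sup>2 * integral\<^sup>L (lebesgue_on {0..l}) (\<lambda>x. f x * f x)"
proof -
  define h where "h x = k * cos (k * x + c) / sin (k * x + c)" for x
  define h' where "h' x = - k\<^sup>2 - (h x)\<^sup>2" for x
  have hd: "(h has_real_derivative h' x) (at x)" if x: "0 \<le> x" "x \<le> l" for x
  proof -
    let ?y = "k * x + c"
    have n: "sin ?y \<noteq> 0" by (rule s[OF x])
    have l1: "((\<lambda>x. k * x + c) has_real_derivative k) (at x)" by (auto intro!: derivative_eq_intros)
    have "((\<lambda>x. k * cos (k * x + c)) has_real_derivative k * (- sin ?y * k)) (at x)"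
      by (intro DERIV_cmult DERIV_chain2[OF DERIV_cos l1])
    from DERIV_divide[OF this DERIV_chain2[OF DERIV_sin l1] n]
    have d: "(h has_real_derivative (k * (- sin ?y * k) * sin ?y - k * cos ?y * (cos ?y * k)) / (sin ?y * sin ?y)) (at x)"
      unfolding h_def[abs_def] .
    have eq: "(k * (- S * k) * S - k * C * (C * k)) / (S * S) = - k\<^sup>2 - (k * C / S)\<^sup>2" if S: "S \<noteq> 0" for S C :: real
    proof -
      have "k * (- S * k) * S / (S * S) = - k\<^sup>2" using S by (simp add: power2_eq_square)
      moreover have "k * C * (C * k) / (S * S) = (k * C / S)\<^sup>2" by (simp add: power2_eq_square)
      ultimately show ?thesis unfolding diff_divide_distrib by simp
    qed
    show ?thesis using d unfolding eq[OF n] h'_def h_def .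
  qed
  have hc: "continuous_on {0..l} h"
  proof (rule continuous_at_imp_continuous_on, rule ballI)
    fix x assume "x \<in> {0..l}"
    then show "isCont h x" by (intro DERIV_isCont[OF hd]) auto
  qed
  have "has_weak_deriv l h h'"
    by (rule has_weak_deriv_C1[OF hd]) (auto simp: h'_def[abs_def] intro!: continuous_intros hc)
  note W = has_weak_deriv_mult[OF this has_weak_deriv_mult[OF f f]]
  have L: "L2_interval l g" "L2_interval l f"
    using has_weak_deriv_L2[OF f] L2_interval_continuous[OF has_weak_deriv_continuous[OF f]] by auto
  have i: "(\<lambda>x. g x * g x) integrable_on {0..l}" "(\<lambda>x. f x * f x) integrable_on {0..l}"
    "(\<lambda>x. h' x * (f x * f x) + h x * (g x * f x + f x * g x)) integrable_on {0..l}"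
    using L2_interval_mult_integrable_on(2)[OF L(1,1), of 0 l] L2_interval_mult_integrable_on(2)[OF L(2,2), of 0 l]
      L2_interval_integrable_on(2)[OF has_weak_deriv_L2[OF W], of 0 l] by auto
  have "h l * (f l * f l) - h 0 * (f 0 * f 0) = integral {0..l} (\<lambda>x. h' x * (f x * f x) + h x * (g x * f x + f x * g x))"
    using has_weak_deriv_diff[OF W, of 0 l] l by simp
  also have "\<dots> \<le> integral {0..l} (\<lambda>x. g x * g x - k\<^sup>2 * (f x * f x))"
  proof (rule integral_le[OF i(3)])
    show "(\<lambda>x. g x * g x - k\<^sup>2 * (f x * f x)) integrable_on {0..l}"
      using i by (intro integrable_diff integrable_on_mult_right)
    fix x
    have "0 \<le> (g x - h x * f x)\<^sup>2" by simp
    then show "h' x * (f x * f x) + h x * (g x * f x + f x * g x) \<le> g x * g x - k\<^sup>2 * (f x * f x)"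
      unfolding h'_def by (simp add: power2_eq_square algebra_simps)
  qed
  also have "\<dots> = integral {0..l} (\<lambda>x. g x * g x) - k\<^sup>2 * integral {0..l} (\<lambda>x. f x * f x)"
    using i by (intro integral_unique has_integral_diff has_integral_mult_right integrable_integral)
  finally show ?thesis
    using L2_interval_mult_integrable_on(3)[OF L(1,1), of 0 l] L2_interval_mult_integrable_on(3)[OF L(2,2), of 0 l]
    by (simp add: h_def power2_eq_square)
qed

lemma degree_one_unique_edge:
  assumes "finite (Edges G)" "degree G v = 1"
    and e: "e \<in> Edges G" "tail (skel G) e = v \<or> head (skel G) e = v"
    and d: "d \<in> Edges G" "tail (skel G) d = v \<or> head (skel G) d = v"
  shows "d = e"
proof -
  let ?A = "{e \<in> Edges G. tail (skel G) e = v}" and ?B = "{e \<in> Edges G. head (skel G) e = v}"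
  have f: "finite ?A" "finite ?B" using assms(1) by auto
  have "card ?A + card ?B = 1"
    using assms(2) by (simp add: degree_def in_degree_def out_degree_def in_arcs_def out_arcs_def)
  then consider "card ?A = 1" "?B = {}" | "?A = {}" "card ?B = 1"
    using f by (cases "card ?A") auto
  then show ?thesis
  proof cases
    case 1
    then have "e \<in> ?A" "d \<in> ?A" using e d by auto
    then show ?thesis using 1(1) by (metis (no_types, lifting) card_1_singletonE singletonD)
  next
    case 2
    then have "e \<in> ?B" "d \<in> ?B" using e d by auto
    then show ?thesis using 2(2) by (metis (no_types, lifting) card_1_singletonE singletonD)
  qed
qed

lemma sum_list_map_eq_sum_count_real:
  fixes f :: "'a \<Rightarrow> real"
  assumes "finite X" "set xs \<subseteq> X"
  shows "sum_list (map f xs) = (\<Sum>x\<in>X. real (count_list xs x) * f x)"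
  using assms(2)
proof (induction xs)
  case (Cons y xs)
  have "(\<Sum>x\<in>X. real (count_list (y # xs) x) * f x) = (\<Sum>x\<in>X. (if x = y then f x else 0) + real (count_list xs x) * f x)"
    by (rule sum.cong) (auto simp: algebra_simps)
  also have "\<dots> = f y + sum_list (map f xs)"
    using Cons assms(1) by (simp add: sum.distrib)
  finally show ?case by simp
qed simp

context finite_graph
begin

text \<open>The Riccati bound is used edge by edge, the phase advancing by \<open>k\<close> times
  the length. At intermediate vertices the boundary terms of consecutive edges cancel, because phase
  and vertex value agree; staying within the interval from 0 to pi keeps the cotangent
  finite.\<close>

lemma walk_energy_bound:
  fixes k :: real
  assumes u: "u \<in> V" and k: "0 < k"
    and \<phi>: "\<And>e. e \<in> Edges G \<Longrightarrow> u e 0 = \<phi> (tail (skel G) e)"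
      "\<And>e. e \<in> Edges G \<Longrightarrow> u e (len G e) = \<phi> (head (skel G) e)"
  shows "edge_walk G v es w \<Longrightarrow> 0 < y \<Longrightarrow> y + k * sum_list (map (len G) es) < pi \<Longrightarrow>
    k * cos (y + k * sum_list (map (len G) es)) / sin (y + k * sum_list (map (len G) es)) * (\<phi> w)\<^sup>2 - k * cos y / sin y * (\<phi> v)\<^sup>2
     \<le> (\<Sum>e\<leftarrow>es. integral\<^sup>L (Leb e) (\<lambda>x. D u e x * D u e x) - k\<^sup>2 * integral\<^sup>L (Leb e) (\<lambda>x. u e x * u e x))"
proof (induction es arbitrary: v y)
  case (Cons e es)
  then obtain x where x: "joins G e v x" "edge_walk G x es w" by auto
  then have e: "e \<in> Edges G" by (simp add: joins_def)
  let ?l = "len G e" and ?L = "sum_list (map (len G) es)"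
  have l: "0 < ?l" by (rule len_pos[OF e])
  have sub: "set es \<subseteq> Edges G" using x(2) by (induction es arbitrary: x) (auto simp: joins_def)
  have L: "0 \<le> ?L" by (rule sum_list_nonneg) (use sub len_pos in \<open>auto intro: less_imp_le\<close>)
  have eq: "(y + k * ?l) + k * ?L = y + k * sum_list (map (len G) (e # es))" by (simp add: algebra_simps)
  have y: "0 < y" "y + k * ?l < pi" "0 < y + k * ?l"
  proof -
    have "0 \<le> k * ?L" "0 < k * ?l" using k l L by simp_all
    then show "0 < y" "y + k * ?l < pi" "0 < y + k * ?l" using Cons.prems(2,3) eq by linarith+
  qed
  have IH: "k * cos ((y + k * ?l) + k * ?L) / sin ((y + k * ?l) + k * ?L) * (\<phi> w)\<^sup>2
      - k * cos (y + k * ?l) / sin (y + k * ?l) * (\<phi> x)\<^sup>2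
     \<le> (\<Sum>e\<leftarrow>es. integral\<^sup>L (Leb e) (\<lambda>x. D u e x * D u e x) - k\<^sup>2 * integral\<^sup>L (Leb e) (\<lambda>x. u e x * u e x))"
    using Cons.prems(3) by (intro Cons.IH[OF x(2) y(3)]) (simp only: eq)
  have kz: "0 \<le> k * z" "k * z \<le> k * ?l" if "0 \<le> z" "z \<le> ?l" for z
    using that k by (auto intro: mult_left_mono)
  have step: "k * cos (y + k * ?l) / sin (y + k * ?l) * (\<phi> x)\<^sup>2 - k * cos y / sin y * (\<phi> v)\<^sup>2
     \<le> integral\<^sup>L (Leb e) (\<lambda>x. D u e x * D u e x) - k\<^sup>2 * integral\<^sup>L (Leb e) (\<lambda>x. u e x * u e x)"
  proof -
    consider "tail (skel G) e = v" "head (skel G) e = x" | "tail (skel G) e = x" "head (skel G) e = v"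
      using x(1) by (auto simp: joins_def)
    then show ?thesis
    proof cases
      case 1
      have "sin (k * z + y) \<noteq> 0" if "0 \<le> z" "z \<le> ?l" for z
      proof -
        have "0 < k * z + y" "k * z + y < pi" using kz[OF that] y by linarith+
        then show ?thesis using sin_gt_zero by fastforce
      qed
      from Riccati_energy_bound[OF form_domain_weak_deriv[OF u e] less_imp_le[OF l] this]
      show ?thesis using \<phi>[OF e] 1 by (simp add: add.commute)
    next
      case 2
      \<comment> \<open>The edge is traversed against its coordinate. The reflected phase runs from
        \<open>- (k * ?l + y)\<close> to \<open>- y\<close>, and oddness of the cotangent exchanges
        the two boundary terms with the right signs.\<close>
      let ?c = "- (k * ?l + y)"
      have "sin (k * z + ?c) \<noteq> 0" if "0 \<le> z" "z \<le> ?l" for z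
      proof -
        have "0 < - (k * z + ?c)" "- (k * z + ?c) < pi" using kz[OF that] y by linarith+
        then have "0 < sin (- (k * z + ?c))" by (rule sin_gt_zero)
        then show ?thesis by (simp only: sin_minus)
      qed
      from Riccati_energy_bound[OF form_domain_weak_deriv[OF u e] less_imp_le[OF l] this]
      have "k * cos (k * ?l + ?c) / sin (k * ?l + ?c) * (\<phi> v)\<^sup>2 - k * cos ?c / sin ?c * (\<phi> x)\<^sup>2
        \<le> integral\<^sup>L (Leb e) (\<lambda>x. D u e x * D u e x) - k\<^sup>2 * integral\<^sup>L (Leb e) (\<lambda>x. u e x * u e x)"
        using \<phi>[OF e] 2 by simp
      moreover have "k * ?l + ?c = - y" by simp
      moreover have "cos ?c = cos (y + k * ?l)" "sin ?c = - sin (y + k * ?l)"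
        by (simp_all only: cos_minus sin_minus add.commute)
      ultimately show ?thesis by simp
    qed
  qed
  show ?case using IH step unfolding eq by simp
qed simp

text \<open>
  Doubling the edges turns \<open>G\<close> into a closed curve of length \<open>2 L\<close> on which \<open>u\<close> vanishes at the
  Dirichlet vertex.
\<close>

lemma Nicaise_inequality:
  assumes G: "connected_metric_graph G" and v0: "v0 \<in> dirichlet G" and u: "u \<in> V"
  shows "(pi / (2 * total_length G))\<^sup>2 * b u u \<le> a u u"
proof -
  let ?L = "total_length G"
  have V: "v0 \<in> Verts G" and ne: "Edges G \<noteq> {}"
    using G v0 by (auto simp: connected_metric_graph_def compact_metric_graph_def)
  have L: "0 < ?L" unfolding total_length_def using finite_edges ne len_pos by (intro sum_pos) auto
  obtain \<phi> where \<phi>: "\<And>e. e \<in> Edges G \<Longrightarrow> u e 0 = \<phi> (tail (skel G) e)"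
    "\<And>e. e \<in> Edges G \<Longrightarrow> u e (len G e) = \<phi> (head (skel G) e)" "\<And>v. v \<in> dirichlet G \<Longrightarrow> \<phi> v = 0"
    using form_domainE[OF u] by blast
  obtain es where es: "edge_walk G v0 es v0" "set es = Edges G" "\<And>e. e \<in> Edges G \<Longrightarrow> count_list es e = 2"
    using double_covering_walk[OF G V] by blast
  have twice: "(\<Sum>e\<leftarrow>es. f e) = 2 * (\<Sum>e\<in>Edges G. f e)" for f :: "'e \<Rightarrow> real"
    using sum_list_map_eq_sum_count_real[OF finite_edges, of es f] es(2,3) by (simp add: sum_distrib_left)
  have below: "k\<^sup>2 * b u u \<le> a u u" if k: "0 < k" "k < pi / (2 * ?L)" for k
  proof -
    have kL: "k * (2 * ?L) < pi" using k(2) L by (simp add: pos_less_divide_eq)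
    \<comment> \<open>Centres the phases traversed along the walk, an interval of length
      \<open>k * (2 * ?L)\<close>, between 0 and pi.\<close>
    define y where "y = (pi - k * (2 * ?L)) / 2"
    have y: "0 < y" "y + k * (2 * ?L) < pi" using kL by (auto simp: y_def field_simps)
    have sl: "sum_list (map (len G) es) = 2 * ?L" using twice[of "len G"] by (simp add: total_length_def)
    have "0 \<le> (\<Sum>e\<leftarrow>es. integral\<^sup>L (Leb e) (\<lambda>x. D u e x * D u e x) - k\<^sup>2 * integral\<^sup>L (Leb e) (\<lambda>x. u e x * u e x))"
      using walk_energy_bound[where \<phi> = \<phi>, OF u k(1) \<phi>(1,2) es(1) y(1)] y(2) \<phi>(3)[OF v0] unfolding sl by simp
    also have "\<dots> = 2 * (a u u - k\<^sup>2 * b u u)"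
      unfolding twice by (simp add: dirichlet_form_def L2_inner_def sum_subtractf sum_distrib_left)
    finally show ?thesis by simp
  qed
  \<comment> \<open>At the critical value the phase would reach the poles of the cotangent, so it is
    approached from below. The shift by 2 makes the factor positive already at
    \<open>n = 0\<close>.\<close>
  let ?k = "\<lambda>n. (pi / (2 * ?L)) * (1 - 1 / real (n + 2))"
  have "(\<lambda>n. (?k n)\<^sup>2 * b u u) \<longlonglongrightarrow> ((pi / (2 * ?L)) * (1 - 0))\<^sup>2 * b u u"
    by (intro tendsto_intros) real_asymp
  moreover have "(?k n)\<^sup>2 * b u u \<le> a u u" for n
  proof (rule below)
    have p: "0 < pi / (2 * ?L)" using L by simp
    show "0 < ?k n" using p by (intro mult_pos_pos) auto
    show "?k n < pi / (2 * ?L)" using mult_strict_left_mono[of "1 - 1 / real (n + 2)" 1, OF _ p] by simp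
  qed
  ultimately have "((pi / (2 * ?L)) * (1 - 0))\<^sup>2 * b u u \<le> a u u"
    by (intro LIMSEQ_le_const2) auto
  then show ?thesis by simp
qed

lemma Nicaise_eigenvalue_bound:
  assumes G: "connected_metric_graph G" and v0: "v0 \<in> dirichlet G"
  shows "(pi / (2 * total_length G))\<^sup>2 \<le> eigenvalue G 1"
proof -
  have "Edges G \<noteq> {}" using G by (auto simp: connected_metric_graph_def compact_metric_graph_def)
  then obtain u where "u \<in> V" "b u u = 1" "a u u = eigenvalue G 1 * b u u" using first_eigenvalue by metis
  then show ?thesis using Nicaise_inequality[OF G v0, of u] by simp
qed

end

section \<open>Ornamented trees\<close>

text \<open>Summation by parts on the graph: regrouping by vertices gives each \<open>X v\<close>
  the net inflow of \<alpha> at \<open>v\<close> as its factor, so balance matters only where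
  \<open>X\<close> is nonzero.\<close>

lemma outflow_weighted_sum:
  fixes \<alpha> :: "'e \<Rightarrow> real" and X :: "'v \<Rightarrow> real"
  assumes "wf_digraph (skel T)" "finite (Edges T)" "finite (Verts T)"
    and zero: "\<And>v. v \<in> Verts T \<Longrightarrow> X v \<noteq> 0 \<Longrightarrow>
      (\<Sum>e | e \<in> Edges T \<and> tail (skel T) e = v. \<alpha> e) = (\<Sum>e | e \<in> Edges T \<and> head (skel T) e = v. \<alpha> e)"
  shows "(\<Sum>e\<in>Edges T. \<alpha> e * (X (head (skel T) e) - X (tail (skel T) e))) = 0"
proof -
  have group: "(\<Sum>e\<in>Edges T. \<alpha> e * X (f e)) = (\<Sum>v\<in>Verts T. X v * (\<Sum>e | e \<in> Edges T \<and> f e = v. \<alpha> e))"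
    if "f ` Edges T \<subseteq> Verts T" for f
  proof -
    have "(\<Sum>e\<in>Edges T. \<alpha> e * X (f e)) = (\<Sum>v\<in>Verts T. \<Sum>e | e \<in> Edges T \<and> f e = v. \<alpha> e * X (f e))"
      by (rule sum.group[symmetric]) (use assms that in auto)
    also have "\<dots> = (\<Sum>v\<in>Verts T. X v * (\<Sum>e | e \<in> Edges T \<and> f e = v. \<alpha> e))"
      by (rule sum.cong[OF refl]) (auto simp: sum_distrib_left mult.commute intro!: sum.cong)
    finally show ?thesis .
  qed
  have "(\<Sum>e\<in>Edges T. \<alpha> e * (X (head (skel T) e) - X (tail (skel T) e)))
    = (\<Sum>v\<in>Verts T. X v * (\<Sum>e | e \<in> Edges T \<and> head (skel T) e = v. \<alpha> e)
       - X v * (\<Sum>e | e \<in> Edges T \<and> tail (skel T) e = v. \<alpha> e))"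
    unfolding right_diff_distrib sum_subtractf
    using assms(1) by (subst (1 2) group) (auto simp: wf_digraph.head_in_verts wf_digraph.tail_in_verts)
  also have "\<dots> = 0"
  proof (rule sum.neutral, rule ballI)
    fix v assume "v \<in> Verts T"
    then show "X v * (\<Sum>e | e \<in> Edges T \<and> head (skel T) e = v. \<alpha> e)
       - X v * (\<Sum>e | e \<in> Edges T \<and> tail (skel T) e = v. \<alpha> e) = 0"
      using zero[of v] by (cases "X v = 0") simp_all
  qed
  finally show ?thesis .
qed

locale ornamented =
  fixes T :: "('v, 'e) metric_graph" and m :: nat and P :: "nat \<Rightarrow> ('w, 'f) metric_graph"
    and r :: "nat \<Rightarrow> 'w" and q :: "nat \<Rightarrow> 'v"
  assumes orn: "ornamented_tree T m P r q"
begin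

section \<open>The glued graph\<close>

abbreviation "\<Gamma> \<equiv> attach_pendants T m P r q"

lemma tree: "metric_tree T" "dirichlet T = exterior_vertices T"
  and pendant: "j \<in> {1..m} \<Longrightarrow> connected_metric_graph (P j)"
    "j \<in> {1..m} \<Longrightarrow> r j \<in> Verts (P j)" "j \<in> {1..m} \<Longrightarrow> r j \<notin> dirichlet (P j)"
    "j \<in> {1..m} \<Longrightarrow> q j \<in> Verts T" "j \<in> {1..m} \<Longrightarrow> q j \<notin> exterior_vertices T"
  using orn unfolding ornamented_tree_def by auto

lemma tree_facts: "wf_digraph (skel T)" "finite (Edges T)" "finite (Verts T)" "Edges T \<noteq> {}"
  "e \<in> Edges T \<Longrightarrow> 0 < len T e" "Digraph_Component.connected (skel T)"
  using tree(1) unfolding metric_tree_def connected_metric_graph_def compact_metric_graph_def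
  by (auto intro: fin_digraph.finite_arcs fin_digraph.finite_verts simp: fin_digraph_def)

lemma pendant_facts:
  assumes "j \<in> {1..m}"
  shows "wf_digraph (skel (P j))" "finite (Edges (P j))" "Edges (P j) \<noteq> {}"
  "e \<in> Edges (P j) \<Longrightarrow> 0 < len (P j) e" "Digraph_Component.connected (skel (P j))"
  "v \<in> dirichlet (P j) \<Longrightarrow> degree (P j) v = 1"
  using pendant(1)[OF assms] unfolding connected_metric_graph_def compact_metric_graph_def
  by (auto intro: fin_digraph.finite_arcs simp: fin_digraph_def)

lemma Edges_\<Gamma>: "Edges \<Gamma> = Inl ` Edges T \<union> (\<Union>j\<in>{1..m}. (\<lambda>f. Inr (j, f)) ` Edges (P j))"
  and tail_\<Gamma>: "tail (skel \<Gamma>) (Inl e) = Inl (tail (skel T) e)"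
    "tail (skel \<Gamma>) (Inr (j, f)) = pendant_vertex r q j (tail (skel (P j)) f)"
  and head_\<Gamma>: "head (skel \<Gamma>) (Inl e) = Inl (head (skel T) e)"
    "head (skel \<Gamma>) (Inr (j, f)) = pendant_vertex r q j (head (skel (P j)) f)"
  and len_\<Gamma>: "len \<Gamma> (Inl e) = len T e" "len \<Gamma> (Inr (j, f)) = len (P j) f"
  and dirichlet_\<Gamma>: "dirichlet \<Gamma> = Inl ` dirichlet T \<union> (\<Union>j\<in>{1..m}. pendant_vertex r q j ` dirichlet (P j))"
  by (simp_all add: attach_pendants_def)

lemma Edges_\<Gamma>_iff: "Inl e \<in> Edges \<Gamma> \<longleftrightarrow> e \<in> Edges T"
  "Inr (j, f) \<in> Edges \<Gamma> \<longleftrightarrow> j \<in> {1..m} \<and> f \<in> Edges (P j)"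
  unfolding Edges_\<Gamma> by auto

lemma Edges_\<Gamma>_cases:
  assumes "d \<in> Edges \<Gamma>"
  obtains e where "d = Inl e" "e \<in> Edges T" | j f where "d = Inr (j, f)" "j \<in> {1..m}" "f \<in> Edges (P j)"
  using assms unfolding Edges_\<Gamma> by auto

sublocale \<Gamma>: finite_graph \<Gamma>
proof
  show "finite (Edges \<Gamma>)" unfolding Edges_\<Gamma> using tree_facts(2) pendant_facts(2) by auto
  fix d assume "d \<in> Edges \<Gamma>"
  then show "0 < len \<Gamma> d" by (cases rule: Edges_\<Gamma>_cases) (auto simp: len_\<Gamma> tree_facts pendant_facts)
qed

lemma finite_graph_pendant: "j \<in> {1..m} \<Longrightarrow> finite_graph (P j)"
  using pendant_facts by unfold_locales auto

lemma sum_Edges_\<Gamma>: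
  fixes F :: "'e + nat \<times> 'f \<Rightarrow> real"
  shows "(\<Sum>d\<in>Edges \<Gamma>. F d) = (\<Sum>e\<in>Edges T. F (Inl e)) + (\<Sum>j\<in>{1..m}. \<Sum>f\<in>Edges (P j). F (Inr (j, f)))"
proof -
  have "(\<Sum>d\<in>Edges \<Gamma>. F d) = (\<Sum>d\<in>Inl ` Edges T. F d) + (\<Sum>d\<in>(\<Union>j\<in>{1..m}. (\<lambda>f. Inr (j, f)) ` Edges (P j)). F d)"
    unfolding Edges_\<Gamma> using tree_facts(2) pendant_facts(2) by (intro sum.union_disjoint) auto
  also have "(\<Sum>d\<in>(\<Union>j\<in>{1..m}. (\<lambda>f. Inr (j, f)) ` Edges (P j)). F d)
    = (\<Sum>j\<in>{1..m}. \<Sum>d\<in>(\<lambda>f. Inr (j, f)) ` Edges (P j). F d)"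
    using pendant_facts(2) by (intro sum.UNION_disjoint) auto
  also have "\<dots> = (\<Sum>j\<in>{1..m}. \<Sum>f\<in>Edges (P j). F (Inr (j, f)))"
    by (intro sum.cong refl sum.reindex_cong[of "\<lambda>f. Inr (_, f)"]) (auto simp: inj_on_def)
  also have "(\<Sum>d\<in>Inl ` Edges T. F d) = (\<Sum>e\<in>Edges T. F (Inl e))"
    by (subst sum.reindex) auto
  finally show ?thesis .
qed

lemma pendant_vertex_not_dirichlet:
  assumes j: "j \<in> {1..m}" and w: "w \<notin> dirichlet (P j)"
  shows "pendant_vertex r q j w \<notin> dirichlet \<Gamma>"
  using j w pendant(3,5) tree(2) unfolding dirichlet_\<Gamma> pendant_vertex_def by (auto split: if_splits)

section \<open>Norm and energy on the tree and on the pendants\<close>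

definition tree_norm :: "('e + nat \<times> 'f \<Rightarrow> real \<Rightarrow> real) \<Rightarrow> real" where
  "tree_norm u = (\<Sum>e\<in>Edges T. integral\<^sup>L (\<Gamma>.Leb (Inl e)) (\<lambda>x. u (Inl e) x * u (Inl e) x))"

definition tree_energy :: "('e + nat \<times> 'f \<Rightarrow> real \<Rightarrow> real) \<Rightarrow> real" where
  "tree_energy u = (\<Sum>e\<in>Edges T. integral\<^sup>L (\<Gamma>.Leb (Inl e)) (\<lambda>x. \<Gamma>.D u (Inl e) x * \<Gamma>.D u (Inl e) x))"

definition pendant_part :: "nat \<Rightarrow> ('e + nat \<times> 'f \<Rightarrow> real \<Rightarrow> real) \<Rightarrow> 'f \<Rightarrow> real \<Rightarrow> real" where
  "pendant_part j u = (\<lambda>f. u (Inr (j, f)))"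

text \<open>Restriction leaves the value at \<open>r j\<close> free, and a standard vertex asks no
  more than continuity in the form domain. This is where the convention for the first eigenvalue of
  a pendant enters.\<close>

lemma pendant_part_form_domain:
  assumes u: "u \<in> \<Gamma>.V" and j: "j \<in> {1..m}"
  shows "pendant_part j u \<in> form_domain (P j)"
proof -
  interpret Pj: finite_graph "P j" by (rule finite_graph_pendant[OF j])
  obtain \<phi> where \<phi>: "\<And>d. d \<in> Edges \<Gamma> \<Longrightarrow> u d 0 = \<phi> (tail (skel \<Gamma>) d)"
    "\<And>d. d \<in> Edges \<Gamma> \<Longrightarrow> u d (len \<Gamma> d) = \<phi> (head (skel \<Gamma>) d)" "\<And>v. v \<in> dirichlet \<Gamma> \<Longrightarrow> \<phi> v = 0"
    using \<Gamma>.form_domainE[OF u] by blast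
  show ?thesis
  proof (rule Pj.form_domainI[where \<phi> = "\<lambda>w. \<phi> (pendant_vertex r q j w)" and g = "\<lambda>f. \<Gamma>.D u (Inr (j, f))"])
    fix f assume f: "f \<in> Edges (P j)"
    then have e: "Inr (j, f) \<in> Edges \<Gamma>" using j Edges_\<Gamma>_iff by blast
    show "has_weak_deriv (len (P j) f) (pendant_part j u f) (\<Gamma>.D u (Inr (j, f)))"
      using \<Gamma>.form_domain_weak_deriv[OF u e] by (simp add: pendant_part_def len_\<Gamma>)
    show "pendant_part j u f 0 = \<phi> (pendant_vertex r q j (tail (skel (P j)) f))"
      using \<phi>(1)[OF e] by (simp add: pendant_part_def tail_\<Gamma>)
    show "pendant_part j u f (len (P j) f) = \<phi> (pendant_vertex r q j (head (skel (P j)) f))"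
      using \<phi>(2)[OF e] by (simp add: pendant_part_def head_\<Gamma> len_\<Gamma>)
  next
    fix f x assume "\<not> (f \<in> Edges (P j) \<and> 0 \<le> x \<and> x \<le> len (P j) f)"
    then show "pendant_part j u f x = 0"
      unfolding pendant_part_def by (intro \<Gamma>.form_domain_outside[OF u]) (simp add: Edges_\<Gamma>_iff len_\<Gamma>)
  next
    fix w assume "w \<in> dirichlet (P j)"
    then show "\<phi> (pendant_vertex r q j w) = 0" using j by (intro \<phi>(3)) (auto simp: dirichlet_\<Gamma>)
  qed
qed

lemma forms_split:
  "L2_inner \<Gamma> u u = tree_norm u + (\<Sum>j\<in>{1..m}. L2_inner (P j) (pendant_part j u) (pendant_part j u))"
  "dirichlet_form \<Gamma> u u = tree_energy u + (\<Sum>j\<in>{1..m}. dirichlet_form (P j) (pendant_part j u) (pendant_part j u))"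
  unfolding L2_inner_def dirichlet_form_def sum_Edges_\<Gamma> tree_norm_def tree_energy_def pendant_part_def len_\<Gamma> by simp_all

lemma Edges_\<Gamma>_ne: "Edges \<Gamma> \<noteq> {}" unfolding Edges_\<Gamma> using tree_facts(4) by auto

lemma pendant_Rayleigh:
  assumes u: "u \<in> \<Gamma>.V" and j: "j \<in> {1..m}"
  shows "eigenvalue (P j) 1 * L2_inner (P j) (pendant_part j u) (pendant_part j u) \<le> dirichlet_form (P j) (pendant_part j u) (pendant_part j u)"
proof -
  interpret Pj: finite_graph "P j" by (rule finite_graph_pendant[OF j])
  show ?thesis using Pj.first_eigenvalue[OF pendant_facts(3)[OF j]] pendant_part_form_domain[OF u j] by metis
qed

lemma tree_energy_le:
  assumes u: "u \<in> \<Gamma>.V" "dirichlet_form \<Gamma> u u = \<mu> * L2_inner \<Gamma> u u"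
    and le: "\<And>j. j \<in> {1..m} \<Longrightarrow> \<mu> \<le> eigenvalue (P j) 1"
  shows "tree_energy u \<le> \<mu> * tree_norm u"
proof -
  have "(\<Sum>j\<in>{1..m}. \<mu> * L2_inner (P j) (pendant_part j u) (pendant_part j u)) \<le> (\<Sum>j\<in>{1..m}. dirichlet_form (P j) (pendant_part j u) (pendant_part j u))"
  proof (rule sum_mono)
    fix j assume j: "j \<in> {1..m}"
    have "0 \<le> L2_inner (P j) (pendant_part j u) (pendant_part j u)" by (rule finite_graph.b_nonneg[OF finite_graph_pendant[OF j]])
    then have "\<mu> * L2_inner (P j) (pendant_part j u) (pendant_part j u) \<le> eigenvalue (P j) 1 * L2_inner (P j) (pendant_part j u) (pendant_part j u)"
      by (rule mult_right_mono[OF le[OF j]])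
    then show "\<mu> * L2_inner (P j) (pendant_part j u) (pendant_part j u) \<le> dirichlet_form (P j) (pendant_part j u) (pendant_part j u)"
      using pendant_Rayleigh[OF u(1) j] by linarith
  qed
  then show ?thesis using u(2) unfolding forms_split by (simp add: sum_distrib_left distrib_left)
qed

text \<open>
  A ground state that vanished on the tree would vanish at the attachment points, and hence on the
  pendants.
\<close>

lemma tree_norm_pos:
  assumes u: "u \<in> \<Gamma>.V" "L2_inner \<Gamma> u u = 1" "\<And>e x. 0 \<le> u e x"
    and super: "\<And>v. v \<in> \<Gamma>.V \<Longrightarrow> (\<And>e x. 0 \<le> v e x) \<Longrightarrow> 0 \<le> dirichlet_form \<Gamma> u v"
  shows "0 < tree_norm u"
proof (rule ccontr)
  assume "\<not> 0 < tree_norm u"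
  moreover have nn: "0 \<le> integral\<^sup>L (\<Gamma>.Leb (Inl e)) (\<lambda>x. u (Inl e) x * u (Inl e) x)" for e
    by (rule Bochner_Integration.integral_nonneg) simp
  ultimately have "(\<Sum>e\<in>Edges T. integral\<^sup>L (\<Gamma>.Leb (Inl e)) (\<lambda>x. u (Inl e) x * u (Inl e) x)) = 0"
    using sum_nonneg[where A = "Edges T" and f = "\<lambda>e. integral\<^sup>L (\<Gamma>.Leb (Inl e)) (\<lambda>x. u (Inl e) x * u (Inl e) x)", OF nn]
    unfolding tree_norm_def by linarith
  then have z: "integral\<^sup>L (\<Gamma>.Leb (Inl e)) (\<lambda>x. u (Inl e) x * u (Inl e) x) = 0" if "e \<in> Edges T" for e
    using that nn tree_facts(2) by (simp add: sum_nonneg_eq_0_iff)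
  have uT: "u (Inl e) x = 0" if e: "e \<in> Edges T" "0 \<le> x" "x \<le> len T e" for e x
    using \<Gamma>.edge_zero_if_norm_zero[OF u(1) _ z[OF e(1)], of x] e by (simp add: Edges_\<Gamma>_iff len_\<Gamma>)
  obtain \<phi> where \<phi>: "\<And>d. d \<in> Edges \<Gamma> \<Longrightarrow> u d 0 = \<phi> (tail (skel \<Gamma>) d)"
    "\<And>d. d \<in> Edges \<Gamma> \<Longrightarrow> u d (len \<Gamma> d) = \<phi> (head (skel \<Gamma>) d)"
    using \<Gamma>.form_domainE[OF u(1)] by metis
  have spread: "u d x = 0" if p: "p \<notin> dirichlet \<Gamma>" "\<phi> p = 0"
    and d: "d \<in> Edges \<Gamma>" "tail (skel \<Gamma>) d = p \<or> head (skel \<Gamma>) d = p" and x: "0 \<le> x" "x \<le> len \<Gamma> d" for p d x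
    by (rule \<Gamma>.superharmonic_zero[OF u(1,3) super p(1) _ _ d x]) (use \<phi> p(2) in auto)
  have pend: "u (Inr (j, f)) x = 0" if j: "j \<in> {1..m}" and f: "f \<in> Edges (P j)" and x: "0 \<le> x" "x \<le> len (P j) f" for j f x
  proof -
    \<comment> \<open>The vertices of the pendant at which \<open>u\<close> vanishes along all
      incident pendant edges; the zeros spread from \<open>r j\<close> through
      \<open>Z\<close>.\<close>
    define Z where "Z = {w \<in> Verts (P j). \<forall>f\<in>Edges (P j). tail (skel (P j)) f = w \<or> head (skel (P j)) f = w \<longrightarrow>
        (\<forall>x. 0 \<le> x \<and> x \<le> len (P j) f \<longrightarrow> u (Inr (j, f)) x = 0)}"
    have inZ: "w \<in> Z" if w: "w \<in> Verts (P j)" "w \<notin> dirichlet (P j)" "\<phi> (pendant_vertex r q j w) = 0" for w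
      unfolding Z_def
    proof (intro CollectI conjI ballI impI allI w(1))
      fix f x assume f: "f \<in> Edges (P j)" and ends: "tail (skel (P j)) f = w \<or> head (skel (P j)) f = w" and x: "0 \<le> x \<and> x \<le> len (P j) f"
      show "u (Inr (j, f)) x = 0"
        by (rule spread[OF pendant_vertex_not_dirichlet[OF j w(2)] w(3)])
          (use f ends x j in \<open>auto simp: Edges_\<Gamma>_iff tail_\<Gamma> head_\<Gamma> len_\<Gamma>\<close>)
    qed
    have "r j \<in> Z"
    proof (rule inZ[OF pendant(2,3)[OF j]])
      \<comment> \<open>The tree is connected and has an edge, so every vertex, in particular
        \<open>q j\<close>, lies on a tree edge, where \<open>u\<close> is already known to
        vanish.\<close>
      define I where "I = {v. \<exists>e\<in>Edges T. tail (skel T) e = v \<or> head (skel T) e = v}"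
      obtain e0 where e0: "e0 \<in> Edges T" using tree_facts(4) by blast
      have "Verts T \<subseteq> I"
        by (rule connected_closed_verts[OF tree_facts(1) tree_facts(6), of "tail (skel T) e0"])
          (use e0 wf_digraph.tail_in_verts[OF tree_facts(1)] in \<open>auto simp: I_def joins_def\<close>)
      then obtain e where e: "e \<in> Edges T" "tail (skel T) e = q j \<or> head (skel T) e = q j"
        using pendant(4)[OF j] unfolding I_def by blast
      have eG: "Inl e \<in> Edges \<Gamma>" using e(1) Edges_\<Gamma>_iff by blast
      have "\<phi> (Inl (q j)) = 0"
        using e(2) \<phi>(1)[OF eG] \<phi>(2)[OF eG] uT[OF e(1), of 0] uT[OF e(1), of "len T e"] tree_facts(5)[OF e(1)]
        by (auto simp: tail_\<Gamma> head_\<Gamma> len_\<Gamma>)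
      then show "\<phi> (pendant_vertex r q j (r j)) = 0" by (simp add: pendant_vertex_def)
    qed
    then have "Verts (P j) \<subseteq> Z"
    proof (rule connected_closed_verts[OF pendant_facts(1)[OF j] pendant_facts(5)[OF j] _ pendant(2)[OF j]])
      fix f v w assume fvw: "joins (P j) f v w" and v: "v \<in> Z"
      then have f: "f \<in> Edges (P j)" by (simp add: joins_def)
      have z: "u (Inr (j, f)) x = 0" if "0 \<le> x" "x \<le> len (P j) f" for x
        using v fvw that unfolding Z_def joins_def by blast
      have w: "w \<in> Verts (P j)"
        using fvw wf_digraph.tail_in_verts[OF pendant_facts(1)[OF j]] wf_digraph.head_in_verts[OF pendant_facts(1)[OF j]]
        by (auto simp: joins_def)
      show "w \<in> Z"
      proof (cases "w \<in> dirichlet (P j)")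
        case True
        \<comment> \<open>At a Dirichlet vertex the tent is not admissible, but the only incident
          edge is \<open>f\<close>, along which \<open>u\<close> is already zero.\<close>
        have "g = f" if "g \<in> Edges (P j)" "tail (skel (P j)) g = w \<or> head (skel (P j)) g = w" for g
          by (rule degree_one_unique_edge[OF pendant_facts(2)[OF j] pendant_facts(6)[OF j True] f _ that])
            (use fvw in \<open>auto simp: joins_def\<close>)
        then show ?thesis using w z unfolding Z_def by blast
      next
        case False
        have fG: "Inr (j, f) \<in> Edges \<Gamma>" using f j Edges_\<Gamma>_iff by blast
        have "\<phi> (pendant_vertex r q j w) = 0"
          using fvw \<phi>(1)[OF fG] \<phi>(2)[OF fG] z[of 0] z[of "len (P j) f"] pendant_facts(4)[OF j f]
          by (auto simp: joins_def tail_\<Gamma> head_\<Gamma> len_\<Gamma>)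
        then show ?thesis using inZ w False by blast
      qed
    qed
    then have "tail (skel (P j)) f \<in> Z" using wf_digraph.tail_in_verts[OF pendant_facts(1)[OF j] f] by blast
    then show ?thesis using f x unfolding Z_def by blast
  qed
  have "u d x = 0" for d x
  proof (cases "d \<in> Edges \<Gamma> \<and> 0 \<le> x \<and> x \<le> len \<Gamma> d")
    case True
    then show ?thesis using uT pend by (auto elim!: Edges_\<Gamma>_cases simp: len_\<Gamma>)
  qed (use \<Gamma>.form_domain_outside[OF u(1)] in blast)
  then have "L2_inner \<Gamma> u u = 0" by (simp add: L2_inner_def)
  then show False using u(2) by simp
qed

section \<open>The gap inequality for one real flow\<close>

text \<open>
  The test function is \<open>g u\<close> with \<open>g\<close> affine of slope \<open>\<alpha>\<close> on the edges of the tree and constant on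
  the pendants; no boundary terms arise since \<open>\<alpha>\<close> is a flow. The choice \<open>t = (\<lambda>\<^sub>2 - \<lambda>\<^sub>1) / 2\<close> in
  \<open>- 2 x y \<le> t x\<^sup>2 + y\<^sup>2 / t\<close> absorbs the norm of the test function.
\<close>

lemma flow_gap_inequality:
  fixes \<alpha> :: "'e \<Rightarrow> real" and \<gamma> :: "'v \<Rightarrow> real"
  assumes u: "u \<in> \<Gamma>.V" "L2_inner \<Gamma> u u = 1"
      "\<And>v. v \<in> \<Gamma>.V \<Longrightarrow> dirichlet_form \<Gamma> u v = eigenvalue \<Gamma> 1 * L2_inner \<Gamma> u v"
    and \<gamma>: "\<And>e. e \<in> Edges T \<Longrightarrow> \<gamma> (head (skel T) e) - \<gamma> (tail (skel T) e) = len T e * \<alpha> e"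
    and flow: "\<And>v. v \<in> Verts T - exterior_vertices T \<Longrightarrow>
      (\<Sum>e | e \<in> Edges T \<and> tail (skel T) e = v. \<alpha> e) = (\<Sum>e | e \<in> Edges T \<and> head (skel T) e = v. \<alpha> e)"
  shows "(eigenvalue \<Gamma> 2 - eigenvalue \<Gamma> 1) *
      (\<Sum>e\<in>Edges T. (\<alpha> e)\<^sup>2 * integral\<^sup>L (\<Gamma>.Leb (Inl e)) (\<lambda>x. u (Inl e) x * u (Inl e) x))
    \<le> 4 * (\<Sum>e\<in>Edges T. (\<alpha> e)\<^sup>2 * integral\<^sup>L (\<Gamma>.Leb (Inl e)) (\<lambda>x. \<Gamma>.D u (Inl e) x * \<Gamma>.D u (Inl e) x))"
    (is "(?\<mu>2 - ?\<mu>1) * ?A \<le> 4 * ?B")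
proof -
  let ?a = "dirichlet_form \<Gamma>" and ?b = "L2_inner \<Gamma>"
  \<comment> \<open>The multiplier is \<open>base d + sl d * x\<close> on the edge \<open>d\<close>,
    with vertex values \<open>vert\<close>. Giving a whole pendant the value at \<open>q j\<close>
    makes it continuous.\<close>
  define sl where "sl d = (case d of Inl e \<Rightarrow> \<alpha> e | Inr _ \<Rightarrow> 0)" for d :: "'e + nat \<times> 'f"
  define base where "base d = (case d of Inl e \<Rightarrow> \<gamma> (tail (skel T) e) | Inr (j, f) \<Rightarrow> \<gamma> (q j))" for d :: "'e + nat \<times> 'f"
  define vert where "vert v = (case v of Inl v \<Rightarrow> \<gamma> v | Inr (j, w) \<Rightarrow> \<gamma> (q j))" for v :: "'v + nat \<times> 'w"
  have [simp]: "sl (Inl e) = \<alpha> e" "sl (Inr y) = 0" "base (Inl e) = \<gamma> (tail (skel T) e)" "base (Inr (j, f)) = \<gamma> (q j)"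
    "vert (Inl v) = \<gamma> v" "vert (pendant_vertex r q j w) = \<gamma> (q j)" for e y j f v w
    by (auto simp: sl_def base_def vert_def pendant_vertex_def)
  have ends: "base d = vert (tail (skel \<Gamma>) d)" "base d + sl d * len \<Gamma> d = vert (head (skel \<Gamma>) d)" if "d \<in> Edges \<Gamma>" for d
    using that \<gamma> by (auto elim!: Edges_\<Gamma>_cases simp: tail_\<Gamma> head_\<Gamma> len_\<Gamma> algebra_simps)
  obtain \<phi> where \<phi>: "\<And>d. d \<in> Edges \<Gamma> \<Longrightarrow> u d 0 = \<phi> (tail (skel \<Gamma>) d)"
    "\<And>d. d \<in> Edges \<Gamma> \<Longrightarrow> u d (len \<Gamma> d) = \<phi> (head (skel \<Gamma>) d)" "\<And>v. v \<in> dirichlet \<Gamma> \<Longrightarrow> \<phi> v = 0"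
    using \<Gamma>.form_domainE[OF u(1)] by blast
  define times where "times c w = (\<lambda>d x. (base d + sl d * x - c) * w d x)" for c and w :: "'e + nat \<times> 'f \<Rightarrow> real \<Rightarrow> real"
  have gd: "has_weak_deriv l (\<lambda>x. base d + sl d * x - c) (\<lambda>x. sl d)" for l d c
    by (rule has_weak_deriv_C1) (auto intro!: derivative_eq_intros)
  have wd: "has_weak_deriv (len \<Gamma> d) (times c w d) (\<lambda>x. sl d * w d x + (base d + sl d * x - c) * w' x)"
    if "has_weak_deriv (len \<Gamma> d) (w d) w'" for c w w' d
    using has_weak_deriv_mult[OF gd that] by (simp add: times_def)
  have timesV: "times c w \<in> \<Gamma>.V" if w: "w \<in> \<Gamma>.V" for c w
  proof -
    obtain \<psi> where \<psi>: "\<And>d. d \<in> Edges \<Gamma> \<Longrightarrow> w d 0 = \<psi> (tail (skel \<Gamma>) d)"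
      "\<And>d. d \<in> Edges \<Gamma> \<Longrightarrow> w d (len \<Gamma> d) = \<psi> (head (skel \<Gamma>) d)" "\<And>v. v \<in> dirichlet \<Gamma> \<Longrightarrow> \<psi> v = 0"
      using \<Gamma>.form_domainE[OF w] by blast
    show ?thesis
    proof (rule \<Gamma>.form_domainI[OF _ wd[where w = w, OF \<Gamma>.form_domain_weak_deriv[OF w]], where \<phi> = "\<lambda>v. (vert v - c) * \<psi> v"])
      show "times c w d x = 0" if "\<not> (d \<in> Edges \<Gamma> \<and> 0 \<le> x \<and> x \<le> len \<Gamma> d)" for d x
        using \<Gamma>.form_domain_outside[OF w that] by (simp add: times_def)
      show "times c w d 0 = (vert (tail (skel \<Gamma>) d) - c) * \<psi> (tail (skel \<Gamma>) d)" if "d \<in> Edges \<Gamma>" for d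
        using \<psi>(1)[OF that] ends(1)[OF that] by (simp add: times_def)
      show "times c w d (len \<Gamma> d) = (vert (head (skel \<Gamma>) d) - c) * \<psi> (head (skel \<Gamma>) d)" if "d \<in> Edges \<Gamma>" for d
        using \<psi>(2)[OF that] ends(2)[OF that] by (simp add: times_def)
      show "(vert v - c) * \<psi> v = 0" if "v \<in> dirichlet \<Gamma>" for v
        using \<psi>(3)[OF that] by simp
    qed
  qed
  \<comment> \<open>The mean of the multiplier with respect to \<open>u^2\<close>; subtracting it
    makes \<open>f\<close> orthogonal to \<open>u\<close>.\<close>
  define c where "c = ?b (times 0 u) u"
  define f where "f = times c u"
  \<comment> \<open>\<open>h\<close> is \<open>g^2 u\<close>, the test function for the eigenvalue
    equation. Since \<open>((g u)')^2 = u' (g^2 u)' + (g')^2 u^2\<close>, it yields the identity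
    \<open>aff\<close>.\<close>
  define h where "h = times c f"
  define g where "g d x = base d + sl d * x - c" for d x
  have fV: "f \<in> \<Gamma>.V" and hV: "h \<in> \<Gamma>.V" unfolding h_def f_def by (intro timesV u(1))+
  have "f = times 0 u + scale_fun (- c) u"
    by (intro ext) (simp add: f_def times_def scale_fun_def algebra_simps)
  then have "?b f u = ?b (times 0 u) u + - c * ?b u u"
    using \<Gamma>.b_add[OF timesV[OF u(1)] \<Gamma>.form_domain_scale[OF u(1)] u(1), of 0 "- c"] \<Gamma>.b_scale[of "- c" u u] by metis
  then have orth: "?b f u = 0" using u(2) by (simp add: c_def)
  have Wu: "has_weak_deriv (len \<Gamma> d) (u d) (\<Gamma>.D u d)" if "d \<in> Edges \<Gamma>" for d
    by (rule \<Gamma>.form_domain_weak_deriv[OF u(1) that])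
  have Wf: "has_weak_deriv (len \<Gamma> d) (f d) (\<lambda>x. sl d * u d x + g d x * \<Gamma>.D u d x)" if "d \<in> Edges \<Gamma>" for d
    unfolding f_def g_def by (rule wd[where w = u and d = d, OF Wu[OF that]])
  have Wh: "has_weak_deriv (len \<Gamma> d) (h d) (\<lambda>x. sl d * f d x + g d x * (sl d * u d x + g d x * \<Gamma>.D u d x))"
    if "d \<in> Edges \<Gamma>" for d
    unfolding h_def g_def by (rule wd[where w = f and d = d, OF Wf[OF that, unfolded g_def]])
  have Lu: "L2_interval (len \<Gamma> d) (u d)" and LD: "L2_interval (len \<Gamma> d) (\<Gamma>.D u d)"
    and Lf: "L2_interval (len \<Gamma> d) (f d)" if "d \<in> Edges \<Gamma>" for d
    using \<Gamma>.L2_form_domain \<Gamma>.L2_deriv u(1) fV that by auto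
  have fg: "f d x = g d x * u d x" for d x by (simp add: f_def times_def g_def)
  have "?a f f = (\<Sum>d\<in>Edges \<Gamma>. integral\<^sup>L (\<Gamma>.Leb d) (\<lambda>x. (sl d * u d x + g d x * \<Gamma>.D u d x) * (sl d * u d x + g d x * \<Gamma>.D u d x)))"
    by (rule \<Gamma>.dirichlet_form_eq[OF Wf Wf])
  also have "\<dots> = (\<Sum>d\<in>Edges \<Gamma>. integral\<^sup>L (\<Gamma>.Leb d) (\<lambda>x. \<Gamma>.D u d x * (sl d * f d x + g d x * (sl d * u d x + g d x * \<Gamma>.D u d x)))
      + (sl d)\<^sup>2 * integral\<^sup>L (\<Gamma>.Leb d) (\<lambda>x. u d x * u d x))"
  proof (rule sum.cong[OF refl])
    fix d assume d: "d \<in> Edges \<Gamma>"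
    have "integral\<^sup>L (\<Gamma>.Leb d) (\<lambda>x. (sl d * u d x + g d x * \<Gamma>.D u d x) * (sl d * u d x + g d x * \<Gamma>.D u d x))
      = integral\<^sup>L (\<Gamma>.Leb d) (\<lambda>x. \<Gamma>.D u d x * (sl d * f d x + g d x * (sl d * u d x + g d x * \<Gamma>.D u d x)) + (sl d)\<^sup>2 * (u d x * u d x))"
      by (rule Bochner_Integration.integral_cong) (auto simp: fg power2_eq_square algebra_simps)
    also have "\<dots> = integral\<^sup>L (\<Gamma>.Leb d) (\<lambda>x. \<Gamma>.D u d x * (sl d * f d x + g d x * (sl d * u d x + g d x * \<Gamma>.D u d x)))
      + integral\<^sup>L (\<Gamma>.Leb d) (\<lambda>x. (sl d)\<^sup>2 * (u d x * u d x))"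
      by (intro Bochner_Integration.integral_add integrable_mult_right L2_interval_mult_integrable LD[OF d] Lu[OF d]
          has_weak_deriv_L2[OF Wh[OF d]])
    finally show "integral\<^sup>L (\<Gamma>.Leb d) (\<lambda>x. (sl d * u d x + g d x * \<Gamma>.D u d x) * (sl d * u d x + g d x * \<Gamma>.D u d x))
      = integral\<^sup>L (\<Gamma>.Leb d) (\<lambda>x. \<Gamma>.D u d x * (sl d * f d x + g d x * (sl d * u d x + g d x * \<Gamma>.D u d x)))
      + (sl d)\<^sup>2 * integral\<^sup>L (\<Gamma>.Leb d) (\<lambda>x. u d x * u d x)" by simp
  qed
  also have "\<dots> = ?a u h + ?A"
  proof -
    have "?a u h = (\<Sum>d\<in>Edges \<Gamma>. integral\<^sup>L (\<Gamma>.Leb d) (\<lambda>x. \<Gamma>.D u d x * (sl d * f d x + g d x * (sl d * u d x + g d x * \<Gamma>.D u d x))))"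
      by (rule \<Gamma>.dirichlet_form_eq[OF Wu Wh])
    moreover have "(\<Sum>d\<in>Edges \<Gamma>. (sl d)\<^sup>2 * integral\<^sup>L (\<Gamma>.Leb d) (\<lambda>x. u d x * u d x)) = ?A"
      by (simp add: sum_Edges_\<Gamma>)
    ultimately show ?thesis by (simp only: sum.distrib)
  qed
  also have "?a u h = ?\<mu>1 * ?b f f"
  proof -
    have "?b u h = ?b f f" unfolding L2_inner_def by (simp add: h_def fg times_def g_def mult_ac)
    then show ?thesis using u(3)[OF hV] by simp
  qed
  finally have aff: "?a f f = ?\<mu>1 * ?b f f + ?A" .
  have gap: "(?\<mu>2 - ?\<mu>1) * ?b f f \<le> ?A"
    using \<Gamma>.second_eigenvalue[OF Edges_\<Gamma>_ne u fV orth] aff by (simp add: left_diff_distrib)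
  have Inl: "Inl e \<in> Edges \<Gamma>" if "e \<in> Edges T" for e using that Edges_\<Gamma>_iff by blast
  have cross: "(\<Sum>e\<in>Edges T. (\<alpha> e)\<^sup>2 * integral\<^sup>L (\<Gamma>.Leb (Inl e)) (\<lambda>x. u (Inl e) x * u (Inl e) x)
      + 2 * \<alpha> e * integral\<^sup>L (\<Gamma>.Leb (Inl e)) (\<lambda>x. f (Inl e) x * \<Gamma>.D u (Inl e) x)) = 0"
  proof -
    \<comment> \<open>On each edge, integrating the derivative of \<open>g u^2\<close> produces a
      difference of values of \<open>X\<close>. Weighted with the slopes these differences sum to
      zero, because the slopes balance wherever \<open>X\<close> is nonzero.\<close>
    define X where "X v = (\<gamma> v - c) * (\<phi> (Inl v))\<^sup>2" for v
    have "(\<alpha> e)\<^sup>2 * integral\<^sup>L (\<Gamma>.Leb (Inl e)) (\<lambda>x. u (Inl e) x * u (Inl e) x)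
      + 2 * \<alpha> e * integral\<^sup>L (\<Gamma>.Leb (Inl e)) (\<lambda>x. f (Inl e) x * \<Gamma>.D u (Inl e) x)
      = \<alpha> e * (X (head (skel T) e) - X (tail (skel T) e))" if e: "e \<in> Edges T" for e
    proof -
      let ?d = "Inl e :: 'e + nat \<times> 'f" and ?l = "len T e"
      note d = Inl[OF e]
      have l: "0 \<le> ?l" using tree_facts(5)[OF e] by simp
      have W: "has_weak_deriv ?l (\<lambda>x. f ?d x * u ?d x) (\<lambda>x. (\<alpha> e * u ?d x + g ?d x * \<Gamma>.D u ?d x) * u ?d x + f ?d x * \<Gamma>.D u ?d x)"
        using has_weak_deriv_mult[OF Wf[OF d] Wu[OF d]] by (simp add: len_\<Gamma>)
      have i: "(\<lambda>x. u ?d x * u ?d x) integrable_on {0..?l}" "(\<lambda>x. f ?d x * \<Gamma>.D u ?d x) integrable_on {0..?l}"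
        using L2_interval_mult_integrable_on(2)[OF Lu[OF d] Lu[OF d], of 0 ?l]
          L2_interval_mult_integrable_on(2)[OF Lf[OF d] LD[OF d], of 0 ?l] by (simp_all add: len_\<Gamma>)
      have "f ?d ?l * u ?d ?l - f ?d 0 * u ?d 0 = integral {0..?l} (\<lambda>x. (\<alpha> e * u ?d x + g ?d x * \<Gamma>.D u ?d x) * u ?d x + f ?d x * \<Gamma>.D u ?d x)"
        using has_weak_deriv_diff[OF W, of 0 ?l] l by simp
      also have "\<dots> = integral {0..?l} (\<lambda>x. \<alpha> e * (u ?d x * u ?d x) + 2 * (f ?d x * \<Gamma>.D u ?d x))"
        by (rule Henstock_Kurzweil_Integration.integral_cong) (simp add: fg algebra_simps)
      also have "\<dots> = \<alpha> e * integral {0..?l} (\<lambda>x. u ?d x * u ?d x) + 2 * integral {0..?l} (\<lambda>x. f ?d x * \<Gamma>.D u ?d x)"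
        using i by (intro integral_unique has_integral_add has_integral_mult_right integrable_integral)
      also have "integral {0..?l} (\<lambda>x. u ?d x * u ?d x) = integral\<^sup>L (\<Gamma>.Leb ?d) (\<lambda>x. u ?d x * u ?d x)"
        using L2_interval_mult_integrable_on(3)[OF Lu[OF d] Lu[OF d], of 0 ?l] by (simp add: len_\<Gamma>)
      also have "integral {0..?l} (\<lambda>x. f ?d x * \<Gamma>.D u ?d x) = integral\<^sup>L (\<Gamma>.Leb ?d) (\<lambda>x. f ?d x * \<Gamma>.D u ?d x)"
        using L2_interval_mult_integrable_on(3)[OF Lf[OF d] LD[OF d], of 0 ?l] by (simp add: len_\<Gamma>)
      finally have eq: "f ?d ?l * u ?d ?l - f ?d 0 * u ?d 0 = \<alpha> e * integral\<^sup>L (\<Gamma>.Leb ?d) (\<lambda>x. u ?d x * u ?d x)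
        + 2 * integral\<^sup>L (\<Gamma>.Leb ?d) (\<lambda>x. f ?d x * \<Gamma>.D u ?d x)" .
      have "u ?d 0 = \<phi> (Inl (tail (skel T) e))" "u ?d ?l = \<phi> (Inl (head (skel T) e))"
        using \<phi>(1)[OF d] \<phi>(2)[OF d] by (simp_all add: tail_\<Gamma> head_\<Gamma> len_\<Gamma>)
      moreover have "g ?d 0 = \<gamma> (tail (skel T) e) - c" "g ?d ?l = \<gamma> (head (skel T) e) - c"
        using \<gamma>[OF e] by (simp_all add: g_def algebra_simps)
      ultimately have "f ?d ?l * u ?d ?l - f ?d 0 * u ?d 0 = X (head (skel T) e) - X (tail (skel T) e)"
        by (simp add: fg X_def power2_eq_square)
      then have "\<alpha> e * (X (head (skel T) e) - X (tail (skel T) e)) = \<alpha> e * (\<alpha> e * integral\<^sup>L (\<Gamma>.Leb ?d) (\<lambda>x. u ?d x * u ?d x)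
        + 2 * integral\<^sup>L (\<Gamma>.Leb ?d) (\<lambda>x. f ?d x * \<Gamma>.D u ?d x))" using eq by simp
      then show ?thesis by (simp only: power2_eq_square distrib_left mult.assoc mult.left_commute[of _ 2])
    qed
    then have "(\<Sum>e\<in>Edges T. (\<alpha> e)\<^sup>2 * integral\<^sup>L (\<Gamma>.Leb (Inl e)) (\<lambda>x. u (Inl e) x * u (Inl e) x)
      + 2 * \<alpha> e * integral\<^sup>L (\<Gamma>.Leb (Inl e)) (\<lambda>x. f (Inl e) x * \<Gamma>.D u (Inl e) x))
      = (\<Sum>e\<in>Edges T. \<alpha> e * (X (head (skel T) e) - X (tail (skel T) e)))"
      by (rule sum.cong[OF refl])
    also have "\<dots> = 0"
    proof (rule outflow_weighted_sum[OF tree_facts(1-3)])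
      fix v assume v: "v \<in> Verts T" "X v \<noteq> 0"
      have "v \<notin> exterior_vertices T"
        using v(2) \<phi>(3)[of "Inl v"] tree(2) unfolding X_def dirichlet_\<Gamma> by auto
      then show "(\<Sum>e | e \<in> Edges T \<and> tail (skel T) e = v. \<alpha> e) = (\<Sum>e | e \<in> Edges T \<and> head (skel T) e = v. \<alpha> e)"
        using flow v(1) by blast
    qed
    finally show ?thesis .
  qed
  \<comment> \<open>By \<open>cross\<close>, \<open>?A\<close> equals minus the mixed term, to which
    the weighted inequality between \<open>f\<close> and the slope times \<open>u'\<close>
    applies.\<close>
  have bound: "?A \<le> t * ?b f f + ?B / t" if t: "0 < t" for t
  proof -
    have "- (2 * \<alpha> e * integral\<^sup>L (\<Gamma>.Leb (Inl e)) (\<lambda>x. f (Inl e) x * \<Gamma>.D u (Inl e) x))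
      \<le> t * integral\<^sup>L (\<Gamma>.Leb (Inl e)) (\<lambda>x. f (Inl e) x * f (Inl e) x)
        + (\<alpha> e)\<^sup>2 * integral\<^sup>L (\<Gamma>.Leb (Inl e)) (\<lambda>x. \<Gamma>.D u (Inl e) x * \<Gamma>.D u (Inl e) x) / t"
      if e: "e \<in> Edges T" for e
    proof -
      let ?d = "Inl e :: 'e + nat \<times> 'f"
      note d = Inl[OF e]
      note int = L2_interval_mult_integrable[OF Lf[OF d] LD[OF d]] L2_interval_mult_integrable[OF Lf[OF d] Lf[OF d]]
        L2_interval_mult_integrable[OF LD[OF d] LD[OF d]]
      have "0 \<le> integral\<^sup>L (\<Gamma>.Leb ?d) (\<lambda>x. (t * (f ?d x * f ?d x) + (\<alpha> e)\<^sup>2 / t * (\<Gamma>.D u ?d x * \<Gamma>.D u ?d x)) + 2 * \<alpha> e * (f ?d x * \<Gamma>.D u ?d x))"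
      proof (rule Bochner_Integration.integral_nonneg)
        fix x
        have "(t * f ?d x + \<alpha> e * \<Gamma>.D u ?d x)\<^sup>2 / t = (t * (f ?d x * f ?d x) + (\<alpha> e)\<^sup>2 / t * (\<Gamma>.D u ?d x * \<Gamma>.D u ?d x)) + 2 * \<alpha> e * (f ?d x * \<Gamma>.D u ?d x)"
          using t by (simp add: power2_eq_square field_simps)
        moreover have "0 \<le> (t * f ?d x + \<alpha> e * \<Gamma>.D u ?d x)\<^sup>2 / t" using t by simp
        ultimately show "0 \<le> (t * (f ?d x * f ?d x) + (\<alpha> e)\<^sup>2 / t * (\<Gamma>.D u ?d x * \<Gamma>.D u ?d x)) + 2 * \<alpha> e * (f ?d x * \<Gamma>.D u ?d x)" by simp
      qed
      also have "\<dots> = integral\<^sup>L (\<Gamma>.Leb ?d) (\<lambda>x. t * (f ?d x * f ?d x)) + integral\<^sup>L (\<Gamma>.Leb ?d) (\<lambda>x. (\<alpha> e)\<^sup>2 / t * (\<Gamma>.D u ?d x * \<Gamma>.D u ?d x))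
         + integral\<^sup>L (\<Gamma>.Leb ?d) (\<lambda>x. 2 * \<alpha> e * (f ?d x * \<Gamma>.D u ?d x))"
        using int by (simp only: Bochner_Integration.integral_add Bochner_Integration.integrable_add integrable_mult_right)
      finally show ?thesis by simp
    qed
    then have "(\<Sum>e\<in>Edges T. - (2 * \<alpha> e * integral\<^sup>L (\<Gamma>.Leb (Inl e)) (\<lambda>x. f (Inl e) x * \<Gamma>.D u (Inl e) x)))
      \<le> (\<Sum>e\<in>Edges T. t * integral\<^sup>L (\<Gamma>.Leb (Inl e)) (\<lambda>x. f (Inl e) x * f (Inl e) x)
        + (\<alpha> e)\<^sup>2 * integral\<^sup>L (\<Gamma>.Leb (Inl e)) (\<lambda>x. \<Gamma>.D u (Inl e) x * \<Gamma>.D u (Inl e) x) / t)"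
      by (rule sum_mono)
    also have "\<dots> = t * tree_norm f + ?B / t"
      by (simp add: sum.distrib sum_distrib_left sum_divide_distrib tree_norm_def)
    finally have "?A \<le> t * tree_norm f + ?B / t"
      using cross by (simp add: sum.distrib sum_negf)
    moreover have "0 \<le> (\<Sum>j\<in>{1..m}. L2_inner (P j) (pendant_part j f) (pendant_part j f))"
      by (rule sum_nonneg) (rule finite_graph.b_nonneg[OF finite_graph_pendant])
    then have "tree_norm f \<le> ?b f f" unfolding forms_split by linarith
    ultimately show ?thesis using t mult_left_mono[of "tree_norm f" "?b f f" t] by linarith
  qed
  have nn: "0 \<le> ?A" "0 \<le> ?B"
    by (intro sum_nonneg mult_nonneg_nonneg[OF zero_le_power2] Bochner_Integration.integral_nonneg zero_le_square)+
  show ?thesis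
  proof (cases "?\<mu>2 - ?\<mu>1 > 0")
    case True
    let ?\<delta> = "?\<mu>2 - ?\<mu>1"
    have "?A \<le> ?\<delta> / 2 * ?b f f + ?B / (?\<delta> / 2)" using bound[of "?\<delta> / 2"] True by simp
    \<comment> \<open>This half of \<open>?A\<close> moves to the left-hand side, leaving
      \<open>?A\<close> bounded by \<open>4 * ?B / ?\<delta>\<close>.\<close>
    moreover have "?\<delta> / 2 * ?b f f \<le> ?A / 2" using gap by simp
    ultimately have "?A \<le> 4 * ?B / ?\<delta>" by simp
    then show ?thesis using True by (simp add: pos_le_divide_eq mult.commute)
  next
    case False
    then have "(?\<mu>2 - ?\<mu>1) * ?A \<le> 0" using nn by (intro mult_nonpos_nonneg) auto
    then show ?thesis using nn by linarith
  qed
qed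

section \<open>The bound 5 and the case of short pendants\<close>

lemma ratio_le_5:
  assumes le: "\<And>j. j \<in> {1..m} \<Longrightarrow> eigenvalue \<Gamma> 1 \<le> eigenvalue (P j) 1"
  shows "eigenvalue \<Gamma> 2 / eigenvalue \<Gamma> 1 \<le> 5"
proof -
  let ?\<mu>1 = "eigenvalue \<Gamma> 1" and ?\<mu>2 = "eigenvalue \<Gamma> 2"
  obtain u where u: "u \<in> \<Gamma>.V" "L2_inner \<Gamma> u u = 1" "\<And>v. v \<in> \<Gamma>.V \<Longrightarrow> dirichlet_form \<Gamma> u v = ?\<mu>1 * L2_inner \<Gamma> u v"
    and unn: "\<And>e x. 0 \<le> u e x"
    by (fact \<Gamma>.nonneg_ground_state[OF Edges_\<Gamma>_ne])
  have \<mu>1: "0 \<le> ?\<mu>1" using u(3)[OF u(1)] u(2) \<Gamma>.a_nonneg[of u] by simp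
  have pos: "0 < tree_norm u"
  proof (rule tree_norm_pos[OF u(1,2) unn])
    fix v assume v: "v \<in> \<Gamma>.V" "\<And>e x. 0 \<le> v e x"
    have "0 \<le> L2_inner \<Gamma> u v" unfolding L2_inner_def
      using unn v(2) by (intro sum_nonneg Bochner_Integration.integral_nonneg mult_nonneg_nonneg)
    then show "0 \<le> dirichlet_form \<Gamma> u v" using u(3)[OF v(1)] \<mu>1 by simp
  qed
  obtain \<alpha> \<gamma> where flow: "\<And>e. e \<in> Edges T \<Longrightarrow> cmod (\<alpha> e) = 1"
    "\<And>e. e \<in> Edges T \<Longrightarrow> \<gamma> (head (skel T) e) - \<gamma> (tail (skel T) e) = of_real (len T e) * \<alpha> e"
    "\<And>v. v \<in> Verts T - exterior_vertices T \<Longrightarrow> outflow T (Edges T) \<alpha> v = 0"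
    using tree_unit_flow[OF tree(1)] by blast
  have key: "(?\<mu>2 - ?\<mu>1) * (\<Sum>e\<in>Edges T. (p (\<alpha> e))\<^sup>2 * integral\<^sup>L (\<Gamma>.Leb (Inl e)) (\<lambda>x. u (Inl e) x * u (Inl e) x))
    \<le> 4 * (\<Sum>e\<in>Edges T. (p (\<alpha> e))\<^sup>2 * integral\<^sup>L (\<Gamma>.Leb (Inl e)) (\<lambda>x. \<Gamma>.D u (Inl e) x * \<Gamma>.D u (Inl e) x))"
    if p: "p = Re \<or> p = Im" for p
  proof (rule flow_gap_inequality[OF u])
    show "p (\<gamma> (head (skel T) e)) - p (\<gamma> (tail (skel T) e)) = len T e * p (\<alpha> e)" if e: "e \<in> Edges T" for e
      using arg_cong[OF flow(2)[OF e], of p] p by auto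
    show "(\<Sum>e | e \<in> Edges T \<and> tail (skel T) e = v. p (\<alpha> e)) = (\<Sum>e | e \<in> Edges T \<and> head (skel T) e = v. p (\<alpha> e))"
      if v: "v \<in> Verts T - exterior_vertices T" for v
      using arg_cong[OF flow(3)[OF v, unfolded outflow_def], of p] p by auto
  qed
  \<comment> \<open>Modulus one makes the squared real and imaginary weights add up to 1 on every
    edge, so the slopes disappear from the sum of the two inequalities.\<close>
  have unit: "(\<Sum>e\<in>Edges T. (Re (\<alpha> e))\<^sup>2 * F e) + (\<Sum>e\<in>Edges T. (Im (\<alpha> e))\<^sup>2 * F e) = (\<Sum>e\<in>Edges T. F e)" for F
  proof -
    have "(\<Sum>e\<in>Edges T. (Re (\<alpha> e))\<^sup>2 * F e) + (\<Sum>e\<in>Edges T. (Im (\<alpha> e))\<^sup>2 * F e)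
      = (\<Sum>e\<in>Edges T. (cmod (\<alpha> e))\<^sup>2 * F e)"
      by (simp only: cmod_power2 distrib_right sum.distrib)
    also have "\<dots> = (\<Sum>e\<in>Edges T. F e)" using flow(1) by (intro sum.cong) auto
    finally show ?thesis .
  qed
  have "(?\<mu>2 - ?\<mu>1) * tree_norm u \<le> 4 * tree_energy u"
    using add_mono[OF key[OF disjI1[OF refl]] key[OF disjI2[OF refl]]]
    by (simp only: tree_norm_def tree_energy_def distrib_left[symmetric] unit)
  also have "\<dots> \<le> 4 * (?\<mu>1 * tree_norm u)"
    using tree_energy_le[OF u(1) u(3)[OF u(1)] le] by simp
  finally have "(?\<mu>2 - ?\<mu>1) * tree_norm u \<le> (4 * ?\<mu>1) * tree_norm u" by simp
  then have "?\<mu>2 \<le> 5 * ?\<mu>1" using pos by (simp add: mult_le_cancel_right)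
  \<comment> \<open>Division by zero gives 0 in HOL, so the case \<open>?\<mu>1 = 0\<close> needs no
    separate positivity argument.\<close>
  then show ?thesis using \<mu>1 by (cases "?\<mu>1 = 0") (auto simp: pos_divide_le_eq)
qed

lemma short_pendants:
  assumes D: "\<And>j. j \<in> {1..m} \<Longrightarrow> dirichlet (P j) \<noteq> {}"
    and short: "\<And>j. j \<in> {1..m} \<Longrightarrow> total_length (P j) \<le> max_edge_length T / 2"
    and j: "j \<in> {1..m}"
  shows "eigenvalue \<Gamma> 1 \<le> eigenvalue (P j) 1"
proof -
  interpret Pj: finite_graph "P j" by (rule finite_graph_pendant[OF j])
  have "max_edge_length T \<in> len T ` Edges T" unfolding max_edge_length_def
    using tree_facts(2,4) by (intro Max_in) auto
  then obtain e where e: "e \<in> Edges T" "len T e = max_edge_length T" by auto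
  have "eigenvalue \<Gamma> 1 \<le> (pi / len T e)\<^sup>2"
    using \<Gamma>.eigenvalue_1_le_edge[of "Inl e"] e(1) by (simp add: Edges_\<Gamma>_iff len_\<Gamma>)
  \<comment> \<open>The half in the length hypothesis is matched to the factor 2 in the denominator
    of Nicaise's bound.\<close>
  also have "\<dots> \<le> (pi / (2 * total_length (P j)))\<^sup>2"
  proof (intro power_mono divide_left_mono)
    have p: "0 < total_length (P j)" unfolding total_length_def
      using pendant_facts(2-4)[OF j] by (intro sum_pos) auto
    then show "0 < len T e * (2 * total_length (P j))" using tree_facts(5)[OF e(1)] by simp
    show "2 * total_length (P j) \<le> len T e" using short[OF j] e(2) by simp
    show "0 \<le> pi / len T e" using tree_facts(5)[OF e(1)] by simp
  qed simp
  also obtain v where "v \<in> dirichlet (P j)" using D[OF j] by blast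
  then have "(pi / (2 * total_length (P j)))\<^sup>2 \<le> eigenvalue (P j) 1"
    by (rule Pj.Nicaise_eigenvalue_bound[OF pendant(1)[OF j]])
  finally show ?thesis .
qed

end

theorem proposition6p2:
  fixes T :: "('v, 'e) metric_graph"
    and m :: nat
    and P :: "nat \<Rightarrow> ('w, 'f) metric_graph"
    and r :: "nat \<Rightarrow> 'w"
    and q :: "nat \<Rightarrow> 'v"
    and \<Gamma> :: "('v + nat \<times> 'w, 'e + nat \<times> 'f) metric_graph"
  assumes "ornamented_tree T m P r q"
    and "\<forall>j\<in>{1..m}. dirichlet (P j) \<noteq> {}"
    and "\<Gamma> = attach_pendants T m P r q"
  shows "((\<forall>j\<in>{1..m}. eigenvalue \<Gamma> 1 \<le> eigenvalue (P j) 1) \<longrightarrow>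
            eigenvalue \<Gamma> 2 / eigenvalue \<Gamma> 1 \<le> 5) \<and>
         ((\<forall>j\<in>{1..m}. total_length (P j) \<le> max_edge_length T / 2) \<longrightarrow>
            eigenvalue \<Gamma> 2 / eigenvalue \<Gamma> 1 \<le> 5)"
proof -
  interpret ornamented T m P r q by unfold_locales (rule assms(1))
  show ?thesis unfolding assms(3) using ratio_le_5 short_pendants assms(2) by blast
qed

end
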